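(* Let $n\ge 1$ be an integer and let $f\colon\mathbb{R}\to\mathbb{R}$ be a function. Consider the following conditions. (i) (for an integer $k\ge 0$) for all $h\in\mathbb{R}$, $\Delta_h f\in\mathscr{C}^{k}(\mathbb{R})$, and $\mathbf{D}f$ is continuous at at least one point; (ii) (for an integer $k\ge 1$) for all $h\in\mathbb{R}$, $\Delta_h f\in\mathscr{D}^{k}(\mathbb{R})$, and $\mathbf{D}f$ is continuous at at least one point; (iii) for all $h\in\mathbb{R}$, $\Delta_h f\in\mathscr{C}^{\omega}(\mathbb{R})$, and $\mathbf{D}f$ is continuous at at least one point; (iv) for all $h\in\mathbb{R}$, $\Delta_h f\in\mathscr{R}(\mathbb{R})$, and $\mathbf{D}f$ is bounded on a measurable set of positive measure or has Lebesgue measurable restriction to some set of positive Lebesgue measure; (v) for all $h\in\mathbb{R}$, $\Delta_h f\in\mathscr{AC}(\mathbb{R})$, and $\mathbf{D}f$ is bounded on a measurable set of positive measure or has Lebesgue measurable restriction to some set of positive Lebesgue measure; (vi) for all $h\in\mathbb{R}$, $\Delta_h f\in\mathscr{BV}(\mathbb{R})$, and $\mathbf{D}f$ is bounded on a measurable set of positive measure or has Lebesgue measurable restriction to some set of positive Lebesgue measure. Then each of these conditions (in (i) and (ii), for each admissible $k$) holds if and only if there exist a derivation $d\colon\mathbb{R}\to\mathbb{R}$ of order $n$, a constant $\lambda\in\mathbb{R}$ and a function $\gamma\colon\mathbb{R}\to\mathbb{R}$ such that $$f(x)=d(x)+\lambda x+\gamma(x)\qquad\text{for all } x\in\mathbb{R},$$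 where $\gamma$ belongs, in the respective cases (i)--(vi), to $\mathscr{C}^{k}(\mathbb{R})$, $\mathscr{D}^{k}(\mathbb{R})$, $\mathscr{C}^{\omega}(\mathbb{R})$, $\mathscr{R}(\mathbb{R})$, $\mathscr{AC}(\mathbb{R})$, $\mathscr{BV}(\mathbb{R})$.
   Context: A function $f\colon\mathbb{R}\to\mathbb{R}$ is additive if $f(x+y)=f(x)+f(y)$ for all $x,y\in\mathbb{R}$. For $h\in\mathbb{R}$ the difference operator is $\Delta_h f(x)=f(x+h)-f(x)$, $x\in\mathbb{R}$. For any function $f\colon\mathbb{R}\to\mathbb{R}$ and $\alpha\in\mathbb{R}$, the function $\delta_{\alpha}f\colon\mathbb{R}\to\mathbb{R}$ is defined by $\delta_{\alpha}f(x)=f(\alpha x)-\alpha f(x)$ for $x\in\mathbb{R}$. Compositions $\delta_{\alpha_1}\circ\cdots\circ\delta_{\alpha_m}f$ denote successive application of these operators to $f$; $\delta_{\alpha}^{n+1}f$ is the result of applying $\delta_\alpha$ to $f$ a total of $n+1$ times. For the fixed $n$, the function $\mathbf{D}f\colon\mathbb{R}\to\mathbb{R}$ is defined by $(\mathbf{D}f)(\alpha)=\delta_{\alpha}^{n+1}f(1)$ for $\alpha\in\mathbb{R}$. An additive function $d\colon\mathbb{R}\to\mathbb{R}$ is a derivation of order $n$ if $d(1)=0$ and $\delta_{\alpha_1}\circ\cdots\circ\delta_{\alpha_{n+1}}d(x)=0$ for all $x,\alpha_1,\ldots,\alpha_{n+1}\in\mathbb{R}$. Function spaces (of functions $\mathbb{R}\to\mathbb{R}$):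 $\mathscr{C}^{k}(\mathbb{R})$: $k$-times continuously differentiable functions ($\mathscr{C}^0(\mathbb{R})$: continuous functions); $\mathscr{D}^{k}(\mathbb{R})$: $k$-times differentiable functions; $\mathscr{C}^{\omega}(\mathbb{R})$: (real) analytic functions; $\mathscr{R}(\mathbb{R})$: functions Riemann integrable on every bounded interval; $\mathscr{AC}(\mathbb{R})$: functions absolutely continuous on every bounded interval; $\mathscr{BV}(\mathbb{R})$: functions of bounded variation on every bounded interval. *)

theory Defs
  imports "HOL-Analysis.Analysis"
begin

definition diff_op :: "real \<Rightarrow> (real \<Rightarrow> real) \<Rightarrow> real \<Rightarrow> real" where
  "diff_op h f = (\<lambda>x. f (x + h) - f x)"

definition delta :: "real \<Rightarrow> (real \<Rightarrow> real) \<Rightarrow> real \<Rightarrow> real" where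
  "delta \<alpha> f = (\<lambda>x. f (\<alpha> * x) - \<alpha> * f x)"

definition bold_D :: "nat \<Rightarrow> (real \<Rightarrow> real) \<Rightarrow> real \<Rightarrow> real" where
  "bold_D n f = (\<lambda>\<alpha>. (delta \<alpha> ^^ (n + 1)) f 1)"

(* The qualified name selects additivity of functions rather than Measure_Space.additive
   (additivity of set functions).  The list \<alpha>s is [\<alpha>_1, ..., \<alpha>_(n+1)], and foldr makes
   delta \<alpha>_1 the outermost operator. *)
definition derivation_of_order :: "nat \<Rightarrow> (real \<Rightarrow> real) \<Rightarrow> bool" where
  "derivation_of_order n d \<longleftrightarrow>
     Modules.additive d \<and> d 1 = 0 \<and>
     (\<forall>\<alpha>s x. length \<alpha>s = n + 1 \<longrightarrow> foldr delta \<alpha>s d x = 0)"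

definition D_space :: "nat \<Rightarrow> (real \<Rightarrow> real) set" where
  "D_space k = {f. \<forall>j<k. \<forall>x. (deriv ^^ j) f field_differentiable at x}"

definition C_space :: "nat \<Rightarrow> (real \<Rightarrow> real) set" where
  "C_space k = {f \<in> D_space k. continuous_on UNIV ((deriv ^^ k) f)}"

(* The library's analytic_on is holomorphy; for type real it would only mean differentiability. *)
definition C_omega_space :: "(real \<Rightarrow> real) set" where
  "C_omega_space = {f. \<forall>x. \<exists>r>0. \<exists>c. \<forall>y. \<bar>y - x\<bar> < r \<longrightarrow> (\<lambda>i. c i * (y - x) ^ i) sums f y}"

(* Not integrable_on, which is the Henstock-Kurzweil integral: here the bound on the mesh of the
   tagged division is a constant instead of a gauge. *)
definition riemann_integrable :: "(real \<Rightarrow> real) \<Rightarrow> real \<Rightarrow> real \<Rightarrow> bool" where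
  "riemann_integrable f a b \<longleftrightarrow>
     (\<exists>I. \<forall>\<epsilon>>0. \<exists>\<eta>>0. \<forall>p. p tagged_division_of {a..b} \<and> (\<forall>(t, K)\<in>p. measure lborel K < \<eta>) \<longrightarrow>
        \<bar>(\<Sum>(t, K)\<in>p. measure lborel K * f t) - I\<bar> < \<epsilon>)"

definition R_space :: "(real \<Rightarrow> real) set" where
  "R_space = {f. \<forall>a b. a \<le> b \<longrightarrow> riemann_integrable f a b}"

definition absolutely_continuous_fun :: "(real \<Rightarrow> real) \<Rightarrow> real \<Rightarrow> real \<Rightarrow> bool" where
  "absolutely_continuous_fun f a b \<longleftrightarrow>
     (\<forall>\<epsilon>>0. \<exists>\<eta>>0. \<forall>(m::nat) s t.
        (\<forall>i<m. a \<le> s i \<and> s i \<le> t i \<and> t i \<le> b) \<and>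
        disjoint_family_on (\<lambda>i. {s i<..<t i}) {..<m} \<and>
        (\<Sum>i<m. t i - s i) < \<eta> \<longrightarrow>
        (\<Sum>i<m. \<bar>f (t i) - f (s i)\<bar>) < \<epsilon>)"

definition AC_space :: "(real \<Rightarrow> real) set" where
  "AC_space = {f. \<forall>a b. a \<le> b \<longrightarrow> absolutely_continuous_fun f a b}"

definition bounded_variation_fun :: "(real \<Rightarrow> real) \<Rightarrow> real \<Rightarrow> real \<Rightarrow> bool" where
  "bounded_variation_fun f a b \<longleftrightarrow>
     (\<exists>V. \<forall>(m::nat) x. x 0 = a \<and> x m = b \<and> (\<forall>i<m. x i \<le> x (Suc i)) \<longrightarrow>
        (\<Sum>i<m. \<bar>f (x (Suc i)) - f (x i)\<bar>) \<le> V)"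

definition BV_space :: "(real \<Rightarrow> real) set" where
  "BV_space = {f. \<forall>a b. a \<le> b \<longrightarrow> bounded_variation_fun f a b}"

definition bounded_or_measurable_on_positive_set :: "(real \<Rightarrow> real) \<Rightarrow> bool" where
  "bounded_or_measurable_on_positive_set g \<longleftrightarrow>
     (\<exists>S\<in>sets lebesgue. emeasure lebesgue S > 0 \<and> bounded (g ` S)) \<or>
     (\<exists>S\<in>sets lebesgue. emeasure lebesgue S > 0 \<and> g \<in> borel_measurable (lebesgue_on S))"

end

theory Submission
  imports Defs "HOL-Computational_Algebra.Polynomial"
begin

text \<open>
  Difference property. If all differences of \<open>f\<close> are Riemann integrable, then
  \<open>A t = (\<integral>\<^sub>0\<^sup>1 \<Delta>\<^sub>t f) - (\<integral>\<^sub>0\<^sup>t \<Delta>\<^sub>1 f)\<close> is exactly additive, and \<open>A 1 = 0\<close>. For \<open>g = f - A\<close> and an interval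
  \<open>I = [a, a + L]\<close> of rational length the mean of \<open>\<Delta>\<^sub>t g\<close> over \<open>I\<close> is, up to a constant,
  \<open>w t = (1 / L) (\<integral>\<^sub>0\<^sup>a\<^sup>+\<^sup>t \<Delta>\<^sub>L g)\<close>, which is locally Lipschitz. If \<open>\<Lambda>\<close> is a finite combination of
  functionals \<open>\<phi> x - \<phi> y\<close>, averaging a bound on \<open>\<Lambda> (\<Delta>\<^sub>h g)\<close> over \<open>h \<in> I\<close> bounds \<open>\<Lambda> (w - g)\<close>. Baire's
  theorem turns bounds that depend on \<open>h\<close> into one bound that holds for a dense set of
  \<open>h\<close> in some interval \<open>I\<close>, which suffices for averaging Riemann integrable functions.
  Taking for \<open>\<Lambda>\<close> differences of Riemann sums, variation sums or difference quotients shows that \<open>g\<close> lies in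
  the class of its differences.

  Derivations. Then \<open>\<phi> \<alpha> = \<delta>\<^sub>\<alpha>\<^sup>n\<^sup>+\<^sup>1 A 1\<close> is bounded on a set of positive measure. It is a generalized
  monomial of degree \<open>n + 1\<close>, so by a Steinhaus argument it is bounded near \<open>0\<close>. Since
  \<open>\<delta>\<^sub>q A = 0\<close> for rational \<open>q\<close>, it is invariant under rational translations, hence bounded
  everywhere, hence \<open>0\<close> by homogeneity, and its polarization vanishes as well.
\<close>

section \<open>Additive functions and the operators \<open>\<delta>\<^sub>\<alpha>\<close>\<close>

text \<open>For an integrable \<open>f\<close> with primitive F, F(0) = 0, both integrals in the
  formula for \<open>A t\<close> equal F(1 + t) - F(1) - F(t), so \<open>A\<close> vanishes; for an
  additive \<open>f\<close> the formula gives f(t) - t f(1). Hence \<open>A\<close> isolates the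
  irregular additive part up to a linear term. The obstacle is that \<open>f\<close> may be
  nonmeasurable, so neither \<open>f\<close> nor \<open>g\<close> can be integrated before the
  regularity of \<open>g\<close> is known. Everything is phrased through differences: only
  functionals that annihilate constants are averaged, and Riemann integrability and
  differentiability are tested by Cauchy criteria instead of against a limit value. The set of
  \<open>h\<close> obeying a given bound is an uncountable intersection whose measurability is not
  evident. Category needs no measurability, and density is enough because the tags of a Riemann sum
  can be moved into a dense set. Rational length has an algebraic origin: step and length may be
  exchanged at length 1 by normalization, and additivity extends this to rational lengths.\<close>

lemma additive_of_nat:
  fixes A :: "real \<Rightarrow> real"
  assumes "Modules.additive A"
  shows "A (real n * x) = real n * A x"
proof -
  interpret additive A by fact
  show ?thesis by (induction n) (simp_all add: zero add algebra_simps)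
qed

lemma additive_Rats:
  fixes A :: "real \<Rightarrow> real"
  assumes A: "Modules.additive A" and q: "q \<in> \<rat>"
  shows "A (q * x) = q * A x"
proof -
  interpret additive A by fact
  obtain m n where mn: "\<bar>q\<bar> = real m / real n" "n \<noteq> 0"
    using Rats_abs_nat_div_natE[OF q] by metis
  have "real n * A (\<bar>q\<bar> * x) = A (real n * (\<bar>q\<bar> * x))"
    using additive_of_nat[OF A] by simp
  also have "real n * (\<bar>q\<bar> * x) = real m * x"
    using mn by simp
  finally have "A (\<bar>q\<bar> * x) = \<bar>q\<bar> * A x"
    using mn additive_of_nat[OF A, of m x]
    by (metis mult.assoc nonzero_mult_div_cancel_left of_nat_eq_0_iff times_divide_eq_left)
  then show ?thesis
    using minus[of "q * x"] by (cases "q \<ge> 0") simp_all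
qed

lemma additive_delta:
  assumes "Modules.additive A"
  shows "Modules.additive (delta \<alpha> A)"
proof -
  interpret additive A by fact
  show ?thesis by (auto simp: Modules.additive_def delta_def add algebra_simps)
qed

lemma delta_commute: "delta \<alpha> (delta \<beta> f) = delta \<beta> (delta \<alpha> f)"
  by (simp add: delta_def algebra_simps)

lemma delta_plus: "delta \<alpha> (\<lambda>x. f x + g x) = (\<lambda>x. delta \<alpha> f x + delta \<alpha> g x)"
  by (simp add: delta_def algebra_simps)

lemma delta_scale: "delta \<alpha> (\<lambda>x. c * f x) = (\<lambda>x. c * delta \<alpha> f x)"
  by (simp add: delta_def algebra_simps)

lemma delta_funpow_plus:
  "(delta \<alpha> ^^ m) (\<lambda>x. f x + g x) = (\<lambda>x. (delta \<alpha> ^^ m) f x + (delta \<alpha> ^^ m) g x)"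
  by (induction m) (simp_all add: delta_plus)

lemma delta_funpow_scale: "(delta \<alpha> ^^ m) (\<lambda>x. c * f x) = (\<lambda>x. c * (delta \<alpha> ^^ m) f x)"
  by (induction m) (simp_all add: delta_scale)

lemma delta_add_of_nat_mult:
  assumes "Modules.additive A"
  shows "delta (\<alpha> + real j * \<beta>) A = (\<lambda>x. delta \<alpha> A x + real j * delta \<beta> A x)"
proof -
  interpret additive A by fact
  show ?thesis
    using additive_of_nat[OF assms] by (simp add: delta_def add ring_distribs mult.assoc)
       (simp add: algebra_simps)
qed

lemma delta_funpow_of_nat_mult:
  assumes "Modules.additive A"
  shows "(delta (real k * \<alpha>) ^^ m) A x = real k ^ m * (delta \<alpha> ^^ m) A x"
  using assms
proof (induction m arbitrary: A)
  case (Suc m)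
  interpret additive A by fact
  have "delta (real k * \<alpha>) A = (\<lambda>x. real k * delta \<alpha> A x)"
    using additive_of_nat[OF Suc.prems, of k] by (simp add: delta_def mult.assoc right_diff_distrib)
  then show ?case
    using Suc.IH[OF additive_delta[OF Suc.prems]]
    by (simp add: funpow_Suc_right delta_funpow_scale del: funpow.simps)
qed simp

lemma delta_funpow_add_Rats:
  assumes "Modules.additive A" "q \<in> \<rat>"
  shows "(delta (\<alpha> + q) ^^ m) A = (delta \<alpha> ^^ m) A"
  using assms(1)
proof (induction m arbitrary: A)
  case (Suc m)
  interpret additive A by fact
  have "delta (\<alpha> + q) A = delta \<alpha> A"
    using additive_Rats[OF Suc.prems assms(2)] by (simp add: delta_def add algebra_simps)
  then show ?case
    using Suc.IH[OF additive_delta[OF Suc.prems]]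
    by (simp add: funpow_Suc_right del: funpow.simps)
qed simp

text \<open>The innermost factor is affine in \<open>j\<close>: it maps \<open>A\<close> to
  \<open>delta \<alpha> A\<close> plus \<open>j\<close> times \<open>delta \<beta> A\<close>.
  Induction on both summands therefore gives the new polynomial as \<open>p + pCons 0 q\<close>. The
  top coefficient serves the boundedness near 0, the coefficient of degree 1 serves polarization,
  and the constant one is needed to compute the latter in the induction.\<close>

lemma delta_funpow_poly:
  assumes "Modules.additive A"
  shows "\<exists>p. degree p \<le> m \<and> coeff p 0 = (delta \<alpha> ^^ m) A 1 \<and> coeff p m = (delta \<beta> ^^ m) A 1 \<and>
           coeff p 1 = real m * (delta \<alpha> ^^ (m - 1)) (delta \<beta> A) 1 \<and>
           (\<forall>j::nat. poly p (real j) = (delta (\<alpha> + real j * \<beta>) ^^ m) A 1)"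
  using assms
proof (induction m arbitrary: A)
  case 0
  then show ?case by (intro exI[of _ "[:A 1:]"]) simp
next
  case (Suc m)
  obtain p where p: "degree p \<le> m" "coeff p 0 = (delta \<alpha> ^^ m) (delta \<alpha> A) 1"
      "coeff p 1 = real m * (delta \<alpha> ^^ (m - 1)) (delta \<beta> (delta \<alpha> A)) 1"
      "\<And>j::nat. poly p (real j) = (delta (\<alpha> + real j * \<beta>) ^^ m) (delta \<alpha> A) 1"
    using Suc.IH[OF additive_delta[OF Suc.prems], of \<alpha>] by metis
  obtain q where q: "degree q \<le> m" "coeff q 0 = (delta \<alpha> ^^ m) (delta \<beta> A) 1"
      "coeff q m = (delta \<beta> ^^ m) (delta \<beta> A) 1"
      "\<And>j::nat. poly q (real j) = (delta (\<alpha> + real j * \<beta>) ^^ m) (delta \<beta> A) 1"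
    using Suc.IH[OF additive_delta[OF Suc.prems], of \<beta>] by metis
  have "(delta (\<alpha> + real j * \<beta>) ^^ Suc m) A 1 = poly (p + pCons 0 q) (real j)" for j
    by (simp add: funpow_Suc_right delta_add_of_nat_mult[OF Suc.prems] delta_funpow_plus
        delta_funpow_scale p(4) q(4) del: funpow.simps)
  moreover have "degree (p + pCons 0 q) \<le> Suc m"
    using p(1) q(1) by (intro degree_add_le) (auto intro: order_trans[OF degree_pCons_le])
  moreover have "coeff p (Suc m) = 0"
    using p(1) by (intro coeff_eq_0) auto
  \<comment> \<open>For m = 0 the exponent \<open>m - 1\<close> is truncated to 0, and the factor
    \<open>real m\<close> hides the wrong power.\<close>
  moreover have "real m * (delta \<alpha> ^^ (m - 1)) (delta \<beta> (delta \<alpha> A)) 1 =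
      real m * (delta \<alpha> ^^ m) (delta \<beta> A) 1"
    by (cases m) (simp_all add: delta_commute[of \<beta>] funpow_Suc_right del: funpow.simps)
  ultimately show ?case
    using p q
    by (intro exI[of _ "p + pCons 0 q"])
       (simp add: funpow_Suc_right algebra_simps coeff_pCons del: funpow.simps)
qed

text \<open>Polarization: the coefficient of \<open>j\<close> in the polynomial \<open>j \<mapsto> \<delta>\<^sub>\<alpha>\<^sub>+\<^sub>j\<^sub>\<beta>\<^sup>m A 1\<close> is
  \<open>m\<close> times \<open>\<delta>\<^sub>\<alpha>\<^sup>m\<^sup>-\<^sup>1 \<delta>\<^sub>\<beta> A 1\<close>.\<close>

lemma delta_mixed_eq_0:
  assumes "Modules.additive A" "\<And>\<alpha>. (delta \<alpha> ^^ m) A 1 = 0" "length \<alpha>s = m"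
  shows "foldr delta \<alpha>s A 1 = 0"
  using assms
proof (induction m arbitrary: A \<alpha>s)
  case 0
  then show ?case by simp
next
  case (Suc m)
  obtain \<beta>s \<beta> where \<alpha>s: "\<alpha>s = \<beta>s @ [\<beta>]" "length \<beta>s = m"
    using Suc.prems(3) by (metis length_Suc_conv_rev)
  have "(delta \<alpha> ^^ m) (delta \<beta> A) 1 = 0" for \<alpha>
  proof -
    obtain p where p: "coeff p 1 = real (Suc m) * (delta \<alpha> ^^ m) (delta \<beta> A) 1"
      "\<And>j::nat. poly p (real j) = (delta (\<alpha> + real j * \<beta>) ^^ Suc m) A 1"
      using delta_funpow_poly[OF Suc.prems(1), of "Suc m" \<alpha> \<beta>] by (metis diff_Suc_1)
    have "range real \<subseteq> {x. poly p x = 0}"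
      using p(2) Suc.prems(2) by auto
    moreover have "infinite (range real)"
      using range_inj_infinite[OF inj_of_nat] by blast
    ultimately have "p = 0"
      using poly_roots_finite[of p] finite_subset by blast
    then show ?thesis using p(1) by simp
  qed
  then show ?case
    using Suc.IH[OF additive_delta[OF Suc.prems(1)] _ \<alpha>s(2)] \<alpha>s(1) by simp
qed

text \<open>Dividing p(x) - p(k) by x - k keeps the top coefficient and lowers the degree. At the
  remaining integer nodes the denominator is at least 1, so the bound at most doubles; this is the
  origin of \<open>2 ^ m\<close>. The start \<open>k\<close> is arbitrary because each division uses
  up the leftmost node.\<close>

lemma lead_coeff_bound:
  fixes p :: "real poly"
  assumes "degree p \<le> m" "\<And>j. j \<in> {k..k + m} \<Longrightarrow> \<bar>poly p (real j)\<bar> \<le> M"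
  shows "\<bar>coeff p m\<bar> \<le> 2 ^ m * M"
  using assms
proof (induction m arbitrary: p k M)
  case 0
  then obtain c where "p = [:c:]" by (auto elim: degree_eq_zeroE)
  with 0(2)[of k] show ?case by simp
next
  case (Suc m)
  define q where "q = synthetic_div p (real k)"
  have pq: "p + smult (real k) q = pCons (poly p (real k)) q"
    unfolding q_def by (rule synthetic_div_correct)
  have degq: "degree q \<le> m" using Suc.prems(1) by (simp add: q_def degree_synthetic_div)
  have ev: "poly p x = poly p (real k) + (x - real k) * poly q x" for x
    using arg_cong[OF pq, of "\<lambda>r. poly r x"] by (simp add: algebra_simps)
  have "coeff p (Suc m) = coeff q m"
    using arg_cong[OF pq, of "\<lambda>r. coeff r (Suc m)"] coeff_eq_0[of q "Suc m"] degq by simp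
  moreover have "\<bar>poly q (real j)\<bar> \<le> 2 * M" if j: "j \<in> {Suc k..Suc k + m}" for j
  proof -
    have "1 * \<bar>poly q (real j)\<bar> \<le> \<bar>real j - real k\<bar> * \<bar>poly q (real j)\<bar>"
      using j by (intro mult_right_mono) auto
    also have "\<dots> = \<bar>poly p (real j) - poly p (real k)\<bar>"
      using ev[of "real j"] by (simp add: abs_mult)
    also have "\<dots> \<le> 2 * M"
      using Suc.prems(2)[of j] Suc.prems(2)[of k] j by (simp add: abs_le_iff)
    finally show ?thesis by simp
  qed
  ultimately show ?case using Suc.IH[of q "Suc k" "2 * M"] degq by simp
qed

section \<open>Sets of positive measure and generalized monomials bounded on them\<close>

text \<open>A compact part of \<open>S\<close> nearly fills an open neighbourhood \<open>T\<close>.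
  Its translates by small multiples of \<open>h\<close> stay in \<open>T\<close>, so each misses
  only a small part of it, and these missed parts together cannot cover the compact set.\<close>

lemma steinhaus_progression:
  fixes S :: "real set"
  assumes S: "S \<in> lmeasurable" "measure lebesgue S > 0"
  shows "\<exists>\<epsilon>>0. \<forall>h. \<bar>h\<bar> < \<epsilon> \<longrightarrow> (\<exists>x. \<forall>j\<le>m. x + real j * h \<in> S)"
proof -
  let ?\<mu> = "measure lebesgue"
  obtain C where C: "closed C" "C \<subseteq> S" "S - C \<in> lmeasurable"
      "emeasure lebesgue (S - C) < ennreal (?\<mu> S / 2)"
    using sets_lebesgue_inner_closed[of S "?\<mu> S / 2"] S by (auto simp: fmeasurableD)
  have Clm: "C \<in> lmeasurable"
    using C(1,2) S(1) by (intro fmeasurableI2[OF S(1)]) auto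
  have "?\<mu> (S - C) < ?\<mu> S / 2"
    using C(3,4) S(2) by (simp add: emeasure_eq_measure2 ennreal_less_iff)
  moreover have "?\<mu> S = ?\<mu> C + ?\<mu> (S - C)"
    using S(1) Clm C(2) by (subst measure_Un2[symmetric]) (auto simp: Un_absorb1)
  ultimately have posC: "?\<mu> C > 0" using S(2) by simp
  \<comment> \<open>Compactness, and with it a uniform distance to the complement of
    \<open>T\<close>, needs a bounded piece; countable additivity supplies one of positive
    measure.\<close>
  have "\<exists>R::nat. ?\<mu> (C \<inter> cball 0 (real R)) > 0"
  proof (rule ccontr)
    assume "\<not> ?thesis"
    then have "?\<mu> (C \<inter> cball 0 (real R)) = 0" for R :: nat
      by (meson measure_nonneg not_less order_antisym)
    moreover have lm: "C \<inter> cball 0 (real R) \<in> lmeasurable" for R :: nat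
      using Clm by (intro fmeasurable_Int_fmeasurable) auto
    ultimately have "C \<inter> cball 0 (real R) \<in> null_sets lebesgue" for R :: nat
      by (metis completion.complete_measure_axioms fmeasurableD measure_eq_0_null_sets
          negligible_iff_measure negligible_iff_null_sets)
    then have "(\<Union>R::nat. C \<inter> cball 0 (real R)) \<in> null_sets lebesgue"
      by (intro null_sets_UN) auto
    moreover have "C \<subseteq> (\<Union>R::nat. C \<inter> cball 0 (real R))"
      using real_arch_simple by (auto simp: dist_norm)
    ultimately have "C \<in> null_sets lebesgue"
      using Clm null_sets_subset by blast
    then show False using posC by (simp add: measure_eq_0_null_sets)
  qed
  then obtain R :: nat where R: "?\<mu> (C \<inter> cball 0 (real R)) > 0" ..
  define K where "K = C \<inter> cball 0 (real R)"
  have K: "compact K" "K \<subseteq> S" "?\<mu> K > 0"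
    using R C(1,2) by (auto simp: K_def intro: closed_Int_compact)
  have Klm: "K \<in> lmeasurable" using K(1) by (rule lmeasurable_compact)
  \<comment> \<open>There are m + 1 translates, so a slack below the fraction 1 / (m + 1) keeps the
    total missed measure below that of \<open>K\<close>.\<close>
  obtain T where T: "open T" "K \<subseteq> T" "T - K \<in> lmeasurable"
      "emeasure lebesgue (T - K) < ennreal (?\<mu> K / real (Suc m))"
    using sets_lebesgue_outer_open[of K "?\<mu> K / real (Suc m)"] K Klm by (auto simp: fmeasurableD)
  have Tlm: "T \<in> lmeasurable"
    using fmeasurable.Un[OF T(3) Klm] T(2) by (simp add: Un_absorb2)
  have TK: "?\<mu> (T - K) < ?\<mu> K / real (Suc m)"
    using T(3,4) K(3) by (simp add: emeasure_eq_measure2 ennreal_less_iff)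
  obtain d where d: "d > 0" "(\<Union>x\<in>K. ball x d) \<subseteq> T"
    using compact_subset_open_imp_ball_epsilon_subset[OF K(1) T(1,2)] by blast
  show ?thesis
  proof (rule exI[of _ "d / real (Suc m)"], intro conjI allI impI)
    fix h :: real assume h: "\<bar>h\<bar> < d / real (Suc m)"
    define Kj where "Kj j = (\<lambda>x. x - real j * h) ` K" for j :: nat
    have Kjlm: "Kj j \<in> lmeasurable" for j
      unfolding Kj_def by (rule measurable_translation_subtract[OF Klm])
    have sub: "Kj j \<subseteq> T" if "j \<le> m" for j
    proof
      fix y assume "y \<in> Kj j"
      then obtain x where x: "x \<in> K" "y = x - real j * h" by (auto simp: Kj_def)
      have "real j * \<bar>h\<bar> \<le> real (Suc m) * \<bar>h\<bar>"
        using that by (intro mult_right_mono) auto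
      also have "\<dots> < d" using h by (simp add: field_simps)
      finally have "dist x y < d" using x(2) by (simp add: dist_real_def abs_mult)
      then have "y \<in> ball x d" by (simp add: mem_ball)
      then show "y \<in> T" using d(2) x(1) by blast
    qed
    have small: "?\<mu> (T - Kj j) < ?\<mu> K / real (Suc m)" if "j \<le> m" for j
    proof -
      have "?\<mu> (T - Kj j) = ?\<mu> T - ?\<mu> (Kj j)"
        using Kjlm Tlm sub[OF that] by (intro measurable_measure_Diff) (auto simp: fmeasurableD)
      also have "?\<mu> (Kj j) = ?\<mu> K"
        unfolding Kj_def by (rule measure_translation_subtract)
      also have "?\<mu> T - ?\<mu> K = ?\<mu> (T - K)"
        using Klm Tlm T(2) by (intro measurable_measure_Diff[symmetric]) (auto simp: fmeasurableD)
      finally show ?thesis using TK by simp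
    qed
    have "\<not> K \<subseteq> (\<Union>j\<in>{..m}. T - Kj j)"
    proof
      assume "K \<subseteq> (\<Union>j\<in>{..m}. T - Kj j)"
      then have "?\<mu> K \<le> ?\<mu> (\<Union>j\<in>{..m}. T - Kj j)"
        using Kjlm Tlm Klm by (intro measure_mono_fmeasurable fmeasurable.finite_UN) (auto simp: fmeasurableD)
      also have "\<dots> \<le> (\<Sum>j\<in>{..m}. ?\<mu> (T - Kj j))"
        using Kjlm Tlm by (intro measure_UNION_le) (auto simp: fmeasurableD)
      also have "\<dots> < (\<Sum>j\<in>{..m}. ?\<mu> K / real (Suc m))"
        using small by (intro sum_strict_mono) auto
      also have "\<dots> = ?\<mu> K" by simp
      finally show False by simp
    qed
    then obtain x where x: "x \<in> K" "\<And>j. j \<le> m \<Longrightarrow> x \<in> Kj j"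
      using T(2) by blast
    have "x + real j * h \<in> S" if "j \<le> m" for j
      using x(2)[OF that] K(2) by (auto simp: Kj_def)
    then show "\<exists>x. \<forall>j\<le>m. x + real j * h \<in> S" by blast
  qed (use d in auto)
qed

text \<open>In the measurable case one of the countably many truncations of \<open>g\<close> lives
  on a set of positive measure, so both alternatives reduce to boundedness. The set is also made
  bounded because the contribution of the regular part to \<open>bold_D\<close> is controlled only
  on bounded intervals.\<close>

lemma bounded_on_bounded_positive_set:
  assumes "bounded_or_measurable_on_positive_set g"
  obtains S N where "S \<in> lmeasurable" "measure lebesgue S > 0"
    "\<And>x. x \<in> S \<Longrightarrow> \<bar>x\<bar> \<le> N" "\<And>x. x \<in> S \<Longrightarrow> \<bar>g x\<bar> \<le> N"
proof -
  obtain S where S: "S \<in> sets lebesgue" "emeasure lebesgue S > 0"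
    and S2: "bounded (g ` S) \<or> g \<in> borel_measurable (lebesgue_on S)"
    using assms unfolding bounded_or_measurable_on_positive_set_def by blast
  have "\<exists>T. T \<in> sets lebesgue \<and> emeasure lebesgue T > 0 \<and> bounded (g ` T)"
    using S2
  proof
    assume g: "g \<in> borel_measurable (lebesgue_on S)"
    define T where "T N = {x \<in> S. \<bar>g x\<bar> \<le> real N}" for N :: nat
    have meas: "T N \<in> sets lebesgue" for N
    proof -
      have "g -` {- real N..real N} \<inter> space (lebesgue_on S) \<in> sets (lebesgue_on S)"
        using g by (rule measurable_sets) auto
      moreover have "g -` {- real N..real N} \<inter> space (lebesgue_on S) = T N"
        by (auto simp: T_def space_restrict_space abs_le_iff)
      ultimately show ?thesis using S(1) by (simp add: sets_restrict_space_iff)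
    qed
    have "\<exists>N. emeasure lebesgue (T N) \<noteq> 0"
    proof (rule ccontr)
      assume "\<not> ?thesis"
      then have "(\<Union>N. T N) \<in> null_sets lebesgue"
        using meas by (intro null_sets_UN) auto
      moreover have "(\<Union>N. T N) = S" using real_arch_simple by (auto simp: T_def)
      ultimately show False using S by auto
    qed
    then obtain N where "emeasure lebesgue (T N) > 0" by (auto simp: zero_less_iff_neq_zero)
    moreover have "bounded (g ` T N)" by (auto simp: bounded_iff T_def)
    ultimately show ?thesis using meas by (intro exI[of _ "T N"]) auto
  qed (use S in blast)
  then obtain T where T: "T \<in> sets lebesgue" "emeasure lebesgue T > 0" "bounded (g ` T)" by blast
  define U where "U N = T \<inter> {- real N..real N}" for N :: nat
  have Ulm: "U N \<in> lmeasurable" for N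
    using T(1) unfolding U_def by (subst Int_commute) (intro fmeasurable_Int_fmeasurable, auto)
  have "\<exists>N. emeasure lebesgue (U N) \<noteq> 0"
  proof (rule ccontr)
    assume "\<not> ?thesis"
    then have "(\<Union>N. U N) \<in> null_sets lebesgue"
      using Ulm by (intro null_sets_UN) (auto simp: fmeasurableD)
    moreover have "(\<Union>N. U N) = T"
    proof -
      have "\<exists>N. x \<in> {- real N..real N}" for x
        using real_arch_simple[of "\<bar>x\<bar>"] by (auto simp: abs_le_iff minus_le_iff)
      then show ?thesis by (auto simp: U_def)
    qed
    ultimately show False using T(2) by auto
  qed
  then obtain N where N: "emeasure lebesgue (U N) \<noteq> 0" by blast
  have pos: "measure lebesgue (U N) > 0"
    using N Ulm by (simp add: emeasure_eq_measure2 zero_less_measure_iff)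
  obtain B where B: "\<And>x. x \<in> T \<Longrightarrow> \<bar>g x\<bar> \<le> B" using T(3) by (auto simp: bounded_iff)
  show ?thesis
    using that[OF Ulm pos, of "max (real N) B"] B by (force simp: U_def abs_le_iff)
qed

theorem delta_mixed_vanish:
  assumes A: "Modules.additive A" and S: "S \<in> lmeasurable" "measure lebesgue S > 0"
    and bound: "\<And>x. x \<in> S \<Longrightarrow> \<bar>(delta x ^^ m) A 1\<bar> \<le> M"
    and m: "m \<ge> 1" and len: "length \<alpha>s = m"
  shows "foldr delta \<alpha>s A 1 = 0"
proof (rule delta_mixed_eq_0[OF A _ len])
  define \<phi> where "\<phi> x = (delta x ^^ m) A 1" for x
  obtain \<epsilon> where \<epsilon>: "\<epsilon> > 0" "\<And>h. \<bar>h\<bar> < \<epsilon> \<Longrightarrow> \<exists>x. \<forall>j\<le>m. x + real j * h \<in> S"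
    using steinhaus_progression[OF S, of m] by blast
  \<comment> \<open>\<open>\<phi> h\<close> is the top coefficient of the polynomial with values
    \<phi>(x + j h), which are bounded because the progression lies in \<open>S\<close>.\<close>
  have near: "\<bar>\<phi> h\<bar> \<le> 2 ^ m * M" if h: "\<bar>h\<bar> < \<epsilon>" for h
  proof -
    obtain x where x: "\<And>j. j \<le> m \<Longrightarrow> x + real j * h \<in> S" using \<epsilon>(2)[OF h] by blast
    obtain p where p: "degree p \<le> m" "coeff p m = \<phi> h" "\<And>j::nat. poly p (real j) = \<phi> (x + real j * h)"
      using delta_funpow_poly[OF A, of m x h] unfolding \<phi>_def by metis
    show ?thesis
      using lead_coeff_bound[OF p(1), of 0 M] p(2,3) x bound by (auto simp: \<phi>_def)
  qed
  have everywhere: "\<bar>\<phi> h\<bar> \<le> 2 ^ m * M" for h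
  proof -
    obtain q where q: "q \<in> \<rat>" "h - \<epsilon> < q" "q < h + \<epsilon>"
      using Rats_dense_in_real[of "h - \<epsilon>" "h + \<epsilon>"] \<epsilon>(1) by auto
    have "\<phi> h = \<phi> (h - q)"
      using delta_funpow_add_Rats[OF A q(1), where \<alpha> = "h - q" and m = m] by (simp add: \<phi>_def)
    then show ?thesis using near[of "h - q"] q by (simp add: abs_less_iff)
  qed
  show "(delta x ^^ m) A 1 = 0" for x
  proof (rule ccontr)
    assume "(delta x ^^ m) A 1 \<noteq> 0"
    then have pos: "\<bar>\<phi> x\<bar> > 0" by (simp add: \<phi>_def)
    obtain k :: nat where k: "2 ^ m * M < real k * \<bar>\<phi> x\<bar>"
      using reals_Archimedean3[OF pos] by blast
    \<comment> \<open>The base \<open>Suc k\<close> is at least 1, so its \<open>m\<close>-th power,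
      with \<open>m\<close> positive, is at least the base, and linear growth already contradicts
      the bound.\<close>
    have "real (Suc k) * \<bar>\<phi> x\<bar> \<le> real (Suc k) ^ m * \<bar>\<phi> x\<bar>"
      using m by (intro mult_right_mono self_le_power) auto
    also have "\<dots> = \<bar>\<phi> (real (Suc k) * x)\<bar>"
      unfolding \<phi>_def delta_funpow_of_nat_mult[OF A] by (simp add: abs_mult power_abs)
    also have "\<dots> \<le> 2 ^ m * M" by (rule everywhere)
    finally show False using k by (simp add: algebra_simps)
  qed
qed

text \<open>Strip off the outermost operator and call the rest \<open>H\<close>. Vanishing at 1 with
  the free parameter y in its place says H(y) = y H(1); a linear \<open>H\<close> is annihilated by
  every \<open>delta\<close> at every point.\<close>

lemma derivation_of_orderI:
  assumes A: "Modules.additive A" "A 1 = 0"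
    and zero: "\<And>\<alpha>s. length \<alpha>s = n + 1 \<Longrightarrow> foldr delta \<alpha>s A 1 = 0"
  shows "derivation_of_order n A"
  unfolding derivation_of_order_def
proof (intro conjI allI impI A)
  fix \<alpha>s :: "real list" and x assume "length \<alpha>s = n + 1"
  then obtain \<alpha> \<beta>s where \<alpha>s: "\<alpha>s = \<alpha> # \<beta>s" "length \<beta>s = n" by (cases \<alpha>s) auto
  define H where "H = foldr delta \<beta>s A"
  have "H y = y * H 1" for y
    using zero[of "y # \<beta>s"] \<alpha>s(2) by (simp add: H_def delta_def)
  then have "H (\<alpha> * x) - \<alpha> * H x = 0" by (metis diff_self mult.assoc)
  then show "foldr delta \<alpha>s A x = 0" by (simp add: \<alpha>s(1) H_def delta_def)
qed

section \<open>Riemann integrable functions\<close>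

definition riemann_sum :: "(real \<Rightarrow> real) \<Rightarrow> (real \<times> real set) set \<Rightarrow> real" where
  "riemann_sum f p = (\<Sum>(t, K)\<in>p. measure lborel K * f t)"

definition fine_tagged_division :: "real \<Rightarrow> real \<Rightarrow> real \<Rightarrow> (real \<times> real set) set \<Rightarrow> bool" where
  "fine_tagged_division \<eta> a b p \<longleftrightarrow>
     p tagged_division_of {a..b} \<and> (\<forall>(t, K)\<in>p. measure lborel K < \<eta>)"

lemma riemann_integrable_iff:
  "riemann_integrable f a b \<longleftrightarrow>
     (\<exists>I. \<forall>\<epsilon>>0. \<exists>\<eta>>0. \<forall>p. fine_tagged_division \<eta> a b p \<longrightarrow> \<bar>riemann_sum f p - I\<bar> < \<epsilon>)"
  by (simp add: riemann_integrable_def riemann_sum_def fine_tagged_division_def)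

lemma riemann_integrableI:
  assumes "\<And>\<epsilon>. \<epsilon> > 0 \<Longrightarrow> \<exists>\<eta>>0. \<forall>p. fine_tagged_division \<eta> a b p \<longrightarrow> \<bar>riemann_sum f p - I\<bar> < \<epsilon>"
  shows "riemann_integrable f a b"
  using assms unfolding riemann_integrable_iff by blast

lemma tagged_division_interval:
  fixes a b :: real
  assumes "p tagged_division_of {a..b}" "(t, K) \<in> p"
  obtains c d where "K = {c..d}" "a \<le> c" "c \<le> t" "t \<le> d" "d \<le> b"
proof -
  obtain c d where K: "K = cbox c d" using tagged_division_ofD(4)[OF assms] by blast
  moreover have "t \<in> K" "K \<subseteq> {a..b}" using tagged_division_ofD(2,3)[OF assms] by auto
  ultimately show ?thesis using that[of c d] by auto
qed

lemma fine_tagged_division_mono: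
  "fine_tagged_division \<eta> a b p \<Longrightarrow> \<eta> \<le> \<eta>' \<Longrightarrow> fine_tagged_division \<eta>' a b p"
  by (fastforce simp: fine_tagged_division_def)

lemma fine_tagged_division_exists:
  assumes "\<eta> > 0"
  shows "\<exists>p. fine_tagged_division \<eta> a b p"
proof -
  have g: "gauge (\<lambda>x::real. ball x (\<eta> / 2))" using assms by (intro gauge_ball) auto
  obtain p where p: "p tagged_division_of {a..b}" "(\<lambda>x. ball x (\<eta> / 2)) fine p"
    using fine_division_exists_real[OF g] by blast
  have "measure lborel K < \<eta>" if tK: "(t, K) \<in> p" for t K
  proof -
    obtain c d where K: "K = {c..d}" "c \<le> t" "t \<le> d"
      using tagged_division_interval[OF p(1) tK] by metis
    have "K \<subseteq> ball t (\<eta> / 2)" using p(2) tK by (auto simp: fine_def)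
    then have "dist t c < \<eta> / 2" "dist t d < \<eta> / 2" using K unfolding subset_iff mem_ball by auto
    then show ?thesis using K by (simp add: dist_real_def)
  qed
  then show ?thesis using p(1) by (auto simp: fine_tagged_division_def)
qed

text \<open>A constant mesh is the special gauge of balls of radius \<open>\<eta> / 2\<close>: a
  cell inside such a ball is shorter than \<open>\<eta>\<close>. This makes the calculus of the
  library integral available for Riemann integrals.\<close>

lemma has_integral_if_riemann:
  assumes "\<And>\<epsilon>. \<epsilon> > 0 \<Longrightarrow> \<exists>\<eta>>0. \<forall>p. fine_tagged_division \<eta> a b p \<longrightarrow> \<bar>riemann_sum f p - I\<bar> < \<epsilon>"
  shows "(f has_integral I) {a..b}"
  unfolding has_integral_real
proof (intro allI impI)
  fix e :: real assume "e > 0"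
  then obtain \<eta> where \<eta>: "\<eta> > 0" "\<And>p. fine_tagged_division \<eta> a b p \<Longrightarrow> \<bar>riemann_sum f p - I\<bar> < e"
    using assms by blast
  show "\<exists>\<gamma>. gauge \<gamma> \<and> (\<forall>\<D>. \<D> tagged_division_of {a..b} \<and> \<gamma> fine \<D> \<longrightarrow>
          norm ((\<Sum>(x, K)\<in>\<D>. measure lborel K *\<^sub>R f x) - I) < e)"
  proof (intro exI conjI allI impI)
    show "gauge (\<lambda>x::real. ball x (\<eta> / 2))" using \<eta> by (intro gauge_ball) auto
    fix p assume p: "p tagged_division_of {a..b} \<and> (\<lambda>x. ball x (\<eta> / 2)) fine p"
    have "measure lborel K < \<eta>" if tK: "(t, K) \<in> p" for t K
    proof -
      obtain c d where K: "K = {c..d}" "c \<le> t" "t \<le> d"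
        using tagged_division_interval[OF conjunct1[OF p] tK] by metis
      have "K \<subseteq> ball t (\<eta> / 2)" using p tK by (auto simp: fine_def)
      then have "dist t c < \<eta> / 2" "dist t d < \<eta> / 2" using K unfolding subset_iff mem_ball by auto
      then show ?thesis using K by (simp add: dist_real_def)
    qed
    then have "fine_tagged_division \<eta> a b p" using p by (auto simp: fine_tagged_division_def)
    from \<eta>(2)[OF this] show "norm ((\<Sum>(x, K)\<in>p. measure lborel K *\<^sub>R f x) - I) < e"
      by (simp add: riemann_sum_def)
  qed
qed

lemma riemann_integrableD:
  assumes "riemann_integrable f a b"
  shows "f integrable_on {a..b}"
    and "\<epsilon> > 0 \<Longrightarrow> \<exists>\<eta>>0. \<forall>p. fine_tagged_division \<eta> a b p \<longrightarrow>
           \<bar>riemann_sum f p - integral {a..b} f\<bar> < \<epsilon>"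
proof -
  obtain I where I: "\<And>\<epsilon>. \<epsilon> > 0 \<Longrightarrow> \<exists>\<eta>>0. \<forall>p. fine_tagged_division \<eta> a b p \<longrightarrow> \<bar>riemann_sum f p - I\<bar> < \<epsilon>"
    using assms unfolding riemann_integrable_iff by blast
  have hi: "(f has_integral I) {a..b}" by (rule has_integral_if_riemann[OF I])
  then show "f integrable_on {a..b}" by blast
  show "\<epsilon> > 0 \<Longrightarrow> \<exists>\<eta>>0. \<forall>p. fine_tagged_division \<eta> a b p \<longrightarrow>
           \<bar>riemann_sum f p - integral {a..b} f\<bar> < \<epsilon>"
    using I integral_unique[OF hi] by blast
qed

text \<open>The Cauchy form compares two Riemann sums, a quantity that annihilates constants and so
  can be averaged over translations. The difference between a sum and a prospective integral is not
  of this kind.\<close>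

lemma riemann_integrable_Cauchy:
  assumes "\<And>\<epsilon>. \<epsilon> > 0 \<Longrightarrow> \<exists>\<eta>>0. \<forall>p q. fine_tagged_division \<eta> a b p \<longrightarrow> fine_tagged_division \<eta> a b q \<longrightarrow>
             \<bar>riemann_sum f p - riemann_sum f q\<bar> < \<epsilon>"
  shows "riemann_integrable f a b"
proof -
  define P where "P n = (SOME p. fine_tagged_division (1 / real (Suc n)) a b p)" for n :: nat
  have P: "fine_tagged_division (1 / real (Suc n)) a b (P n)" for n
    unfolding P_def by (rule someI_ex[OF fine_tagged_division_exists]) simp
  have P': "\<exists>N. \<forall>n\<ge>N. fine_tagged_division \<eta> a b (P n)" if \<eta>: "\<eta> > 0" for \<eta>
  proof -
    obtain N where N: "1 / real (Suc N) < \<eta>" using nat_approx_posE[OF \<eta>] by blast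
    have "fine_tagged_division \<eta> a b (P n)" if n: "n \<ge> N" for n
    proof (rule fine_tagged_division_mono[OF P])
      have "1 / real (Suc n) \<le> 1 / real (Suc N)" using n by (intro divide_left_mono) auto
      then show "1 / real (Suc n) \<le> \<eta>" using N by simp
    qed
    then show ?thesis by blast
  qed
  have "Cauchy (\<lambda>n. riemann_sum f (P n))"
  proof (rule metric_CauchyI)
    fix e :: real assume "e > 0"
    then obtain \<eta> where \<eta>: "\<eta> > 0" "\<And>p q. fine_tagged_division \<eta> a b p \<Longrightarrow> fine_tagged_division \<eta> a b q \<Longrightarrow>
             \<bar>riemann_sum f p - riemann_sum f q\<bar> < e"
      using assms by blast
    obtain N where N: "\<And>n. n \<ge> N \<Longrightarrow> fine_tagged_division \<eta> a b (P n)" using P'[OF \<eta>(1)] by blast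
    then show "\<exists>M. \<forall>m\<ge>M. \<forall>n\<ge>M. dist (riemann_sum f (P m)) (riemann_sum f (P n)) < e"
      using \<eta>(2) by (auto simp: dist_real_def intro!: exI[of _ N])
  qed
  then obtain I where I: "(\<lambda>n. riemann_sum f (P n)) \<longlonglongrightarrow> I"
    using Cauchy_convergent convergent_def by blast
  show ?thesis
  proof (rule riemann_integrableI)
    fix e :: real assume e: "e > 0"
    then obtain \<eta> where \<eta>: "\<eta> > 0" "\<And>p q. fine_tagged_division \<eta> a b p \<Longrightarrow> fine_tagged_division \<eta> a b q \<Longrightarrow>
             \<bar>riemann_sum f p - riemann_sum f q\<bar> < e / 2"
      using assms[of "e / 2"] by auto
    obtain N where N: "\<And>n. n \<ge> N \<Longrightarrow> fine_tagged_division \<eta> a b (P n)" using P'[OF \<eta>(1)] by blast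
    obtain N' where N': "\<And>n. n \<ge> N' \<Longrightarrow> \<bar>riemann_sum f (P n) - I\<bar> < e / 2"
      using LIMSEQ_D[OF I, of "e / 2"] e by auto
    have "\<bar>riemann_sum f p - I\<bar> < e" if p: "fine_tagged_division \<eta> a b p" for p
      using \<eta>(2)[OF p N[of "max N N'"]] N'[of "max N N'"] by (simp add: abs_if split: if_splits)
    then show "\<exists>\<eta>>0. \<forall>p. fine_tagged_division \<eta> a b p \<longrightarrow> \<bar>riemann_sum f p - I\<bar> < e"
      using \<eta>(1) by blast
  qed
qed

lemma riemann_sum_linear:
  "riemann_sum (\<lambda>x. f x + g x) p = riemann_sum f p + riemann_sum g p"
  "riemann_sum (\<lambda>x. f x - g x) p = riemann_sum f p - riemann_sum g p"
  "riemann_sum (\<lambda>x. c * f x) p = c * riemann_sum f p"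
  by (simp_all add: riemann_sum_def split_def sum.distrib sum_subtractf sum_distrib_left distrib_left
      right_diff_distrib mult.left_commute)

lemma riemann_sum_const:
  assumes "p tagged_division_of {a..b}" "a \<le> b"
  shows "riemann_sum (\<lambda>_. c) p = c * (b - a)"
proof -
  have "(\<Sum>(t, K)\<in>p. measure lborel K) = b - a"
    using additive_content_tagged_division[of p a b] assms by simp
  then show ?thesis
    unfolding riemann_sum_def split_def by (metis sum_distrib_right mult.commute)
qed

lemma riemann_integrable_plus:
  assumes "riemann_integrable f a b" "riemann_integrable g a b"
  shows "riemann_integrable (\<lambda>x. f x + g x) a b"
proof (rule riemann_integrableI)
  fix e :: real assume e: "e > 0"
  let ?I = "integral {a..b} f" and ?J = "integral {a..b} g"
  obtain \<eta>1 where 1: "\<eta>1 > 0" "\<And>p. fine_tagged_division \<eta>1 a b p \<Longrightarrow> \<bar>riemann_sum f p - ?I\<bar> < e / 2"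
    using riemann_integrableD(2)[OF assms(1), of "e / 2"] e by auto
  obtain \<eta>2 where 2: "\<eta>2 > 0" "\<And>p. fine_tagged_division \<eta>2 a b p \<Longrightarrow> \<bar>riemann_sum g p - ?J\<bar> < e / 2"
    using riemann_integrableD(2)[OF assms(2), of "e / 2"] e by auto
  have "\<bar>riemann_sum (\<lambda>x. f x + g x) p - (?I + ?J)\<bar> < e" if p: "fine_tagged_division (min \<eta>1 \<eta>2) a b p" for p
    using 1(2)[OF fine_tagged_division_mono[OF p]] 2(2)[OF fine_tagged_division_mono[OF p]]
    by (simp add: riemann_sum_linear abs_if split: if_splits)
  then show "\<exists>\<eta>>0. \<forall>p. fine_tagged_division \<eta> a b p \<longrightarrow> \<bar>riemann_sum (\<lambda>x. f x + g x) p - (?I + ?J)\<bar> < e"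
    using 1(1) 2(1) by (intro exI[of _ "min \<eta>1 \<eta>2"]) auto
qed

lemma riemann_integrable_cmult:
  assumes "riemann_integrable f a b"
  shows "riemann_integrable (\<lambda>x. c * f x) a b"
proof (rule riemann_integrableI)
  fix e :: real assume e: "e > 0"
  let ?I = "integral {a..b} f"
  obtain \<eta> where \<eta>: "\<eta> > 0" "\<And>p. fine_tagged_division \<eta> a b p \<Longrightarrow> \<bar>riemann_sum f p - ?I\<bar> < e / (\<bar>c\<bar> + 1)"
    using riemann_integrableD(2)[OF assms(1), of "e / (\<bar>c\<bar> + 1)"] e by auto
  have "\<bar>riemann_sum (\<lambda>x. c * f x) p - c * ?I\<bar> < e" if p: "fine_tagged_division \<eta> a b p" for p
  proof -
    have "\<bar>riemann_sum (\<lambda>x. c * f x) p - c * ?I\<bar> = \<bar>c\<bar> * \<bar>riemann_sum f p - ?I\<bar>"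
      by (simp add: riemann_sum_linear flip: abs_mult right_diff_distrib)
    also have "\<dots> \<le> (\<bar>c\<bar> + 1) * \<bar>riemann_sum f p - ?I\<bar>" by (intro mult_right_mono) auto
    also have "\<dots> < (\<bar>c\<bar> + 1) * (e / (\<bar>c\<bar> + 1))"
      using \<eta>(2)[OF p] by (intro mult_strict_left_mono) auto
    also have "\<dots> = e" by (simp add: add_nonneg_eq_0_iff)
    finally show ?thesis .
  qed
  then show "\<exists>\<eta>>0. \<forall>p. fine_tagged_division \<eta> a b p \<longrightarrow> \<bar>riemann_sum (\<lambda>x. c * f x) p - c * ?I\<bar> < e"
    using \<eta>(1) by blast
qed

lemma measure_lborel_translation_Icc:
  fixes c d h :: real
  shows "measure lborel ((\<lambda>x. x + h) ` {c..d}) = measure lborel {c..d}"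
  by (simp add: image_add_atLeastAtMost')

lemma tagged_division_translation:
  fixes a b h :: real
  assumes "p tagged_division_of {a..b}"
  shows "(\<lambda>(t, K). (t + h, (\<lambda>x. x + h) ` K)) ` p tagged_division_of {a + h..b + h}"
proof (rule tagged_division_ofI)
  note D = tagged_division_ofD[OF assms]
  let ?T = "\<lambda>x::real. x + h"
  show "finite ((\<lambda>(t, K). (t + h, ?T ` K)) ` p)" using D(1) by (rule finite_imageI)
  fix x K assume "(x, K) \<in> (\<lambda>(t, K). (t + h, ?T ` K)) ` p"
  then obtain t L where L: "(t, L) \<in> p" "x = t + h" "K = ?T ` L" by auto
  obtain c d where cd: "L = {c..d}" using tagged_division_interval[OF assms L(1)] by metis
  show "x \<in> K" using D(2)[OF L(1)] L by auto
  show "K \<subseteq> {a + h..b + h}" using D(3)[OF L(1)] L by auto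
  show "\<exists>a b. K = cbox a b" using L(3) cd by (auto simp: image_add_atLeastAtMost')
  fix x' K' assume "(x', K') \<in> (\<lambda>(t, K). (t + h, ?T ` K)) ` p" and ne: "(x, K) \<noteq> (x', K')"
  then obtain t' L' where L': "(t', L') \<in> p" "x' = t' + h" "K' = ?T ` L'" by auto
  obtain c' d' where cd': "L' = {c'..d'}" using tagged_division_interval[OF assms L'(1)] by metis
  have "(t, L) \<noteq> (t', L')" using ne L L' by auto
  then have "interior L \<inter> interior L' = {}" using D(5)[OF L(1) L'(1)] by blast
  then have i: "{c<..<d} \<inter> {c'<..<d'} = {}" using cd cd' by simp
  have "interior K = {c + h<..<d + h}" "interior K' = {c' + h<..<d' + h}"
    using L(3) L'(3) cd cd' by (simp_all add: image_add_atLeastAtMost')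
  moreover have "{c + h<..<d + h} \<inter> {c' + h<..<d' + h} = {}"
  proof (rule ccontr)
    assume "\<not> ?thesis"
    then obtain y where "y \<in> {c + h<..<d + h} \<inter> {c' + h<..<d' + h}" by blast
    then have "y - h \<in> {c<..<d} \<inter> {c'<..<d'}" by auto
    with i show False by blast
  qed
  ultimately show "interior K \<inter> interior K' = {}" by simp
next
  note D = tagged_division_ofD[OF assms]
  let ?T = "\<lambda>x::real. x + h"
  have "\<Union> {K. \<exists>x. (x, K) \<in> (\<lambda>(t, K). (t + h, ?T ` K)) ` p} = ?T ` (\<Union>{K. \<exists>x. (x, K) \<in> p})"
    by force
  also have "\<dots> = {a + h..b + h}" unfolding D(6) by (simp add: image_add_atLeastAtMost')
  finally show "\<Union> {K. \<exists>x. (x, K) \<in> (\<lambda>(t, K). (t + h, ?T ` K)) ` p} = {a + h..b + h}" .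
qed

lemma riemann_integrable_translate:
  assumes "riemann_integrable f (a + h) (b + h)"
  shows "riemann_integrable (\<lambda>x. f (x + h)) a b"
proof (rule riemann_integrableI)
  fix e :: real assume e: "e > 0"
  let ?I = "integral {a + h..b + h} f"
  obtain \<eta> where \<eta>: "\<eta> > 0" "\<And>p. fine_tagged_division \<eta> (a + h) (b + h) p \<Longrightarrow> \<bar>riemann_sum f p - ?I\<bar> < e"
    using riemann_integrableD(2)[OF assms(1) e] by auto
  have "\<bar>riemann_sum (\<lambda>x. f (x + h)) p - ?I\<bar> < e" if p: "fine_tagged_division \<eta> a b p" for p
  proof -
    let ?S = "\<lambda>(t, K). (t + h, (\<lambda>x. x + h) ` K)"
    have td: "p tagged_division_of {a..b}" using p by (simp add: fine_tagged_division_def)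
    have cont: "measure lborel ((\<lambda>x. x + h) ` K) = measure lborel K" if "(t, K) \<in> p" for t K
      using tagged_division_interval[OF td that] measure_lborel_translation_Icc by metis
    have "inj_on ?S p"
    proof (rule inj_onI)
      fix u v assume "u \<in> p" "v \<in> p" and eq: "?S u = ?S v"
      obtain t K where u: "u = (t, K)" by (cases u)
      obtain t' K' where v: "v = (t', K')" by (cases v)
      have "inj (\<lambda>x::real. x + h)" by (auto simp: inj_def)
      then show "u = v" using eq by (simp add: u v inj_image_eq_iff)
    qed
    then have "riemann_sum f (?S ` p) = riemann_sum (\<lambda>x. f (x + h)) p"
      unfolding riemann_sum_def using cont
      by (subst sum.reindex) (auto intro!: sum.cong)
    moreover have "fine_tagged_division \<eta> (a + h) (b + h) (?S ` p)"
      using p cont tagged_division_translation[OF td, of h] by (auto simp: fine_tagged_division_def)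
    ultimately show ?thesis using \<eta>(2) by metis
  qed
  then show "\<exists>\<eta>>0. \<forall>p. fine_tagged_division \<eta> a b p \<longrightarrow> \<bar>riemann_sum (\<lambda>x. f (x + h)) p - ?I\<bar> < e"
    using \<eta>(1) by blast
qed

text \<open>The cells and their lengths stay the same, so fineness survives. It is the freedom to
  move tags that yields boundedness and the estimate on dense sets.\<close>

lemma retag:
  fixes \<tau> :: "real \<Rightarrow> real set \<Rightarrow> real"
  assumes p: "fine_tagged_division \<eta> a b p" and \<tau>: "\<And>t K. (t, K) \<in> p \<Longrightarrow> \<tau> t K \<in> K"
  defines "q \<equiv> (\<lambda>(t, K). (\<tau> t K, K)) ` p"
  shows "fine_tagged_division \<eta> a b q"
    and "riemann_sum f q = (\<Sum>(t, K)\<in>p. measure lborel K * f (\<tau> t K))"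
proof -
  have td: "p tagged_division_of {a..b}" using p by (simp add: fine_tagged_division_def)
  note D = tagged_division_ofD[OF td]
  have "q tagged_division_of {a..b}"
  proof (rule tagged_division_ofI)
    show "finite q" using D(1) by (simp add: q_def)
    have "\<Union> {K. \<exists>x. (x, K) \<in> q} = \<Union>{K. \<exists>x. (x, K) \<in> p}"
      unfolding q_def by force
    then show "\<Union> {K. \<exists>x. (x, K) \<in> q} = {a..b}" using D(6) by simp
    fix x K assume "(x, K) \<in> q"
    then obtain t where t: "(t, K) \<in> p" "x = \<tau> t K" by (auto simp: q_def)
    show "x \<in> K" "K \<subseteq> {a..b}" "\<exists>a b. K = cbox a b" using t \<tau> D(3,4)[OF t(1)] by auto
    fix x' K' assume "(x', K') \<in> q" and ne: "(x, K) \<noteq> (x', K')"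
    then obtain t' where t': "(t', K') \<in> p" "x' = \<tau> t' K'" by (auto simp: q_def)
    show "interior K \<inter> interior K' = {}" using D(5)[OF t(1) t'(1)] ne t t' by auto
  qed
  then show "fine_tagged_division \<eta> a b q" using p by (auto simp: fine_tagged_division_def q_def)
  have "riemann_sum f q = sum ((\<lambda>(t, K). measure lborel K * f t) \<circ> (\<lambda>(t, K). (\<tau> t K, K))) p"
    unfolding riemann_sum_def q_def
  \<comment> \<open>A division is a set of pairs, so retagging may merge two pairs with the same
    cell. Such a cell has empty interior, hence length 0, and contributes nothing.\<close>
  proof (rule sum.reindex_nontrivial[OF D(1)])
    fix u v assume uv: "u \<in> p" "v \<in> p" "u \<noteq> v" and eq: "(case u of (t, K) \<Rightarrow> (\<tau> t K, K)) = (case v of (t, K) \<Rightarrow> (\<tau> t K, K))"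
    obtain t K where u: "u = (t, K)" by (cases u)
    obtain t' K' where v: "v = (t', K')" by (cases v)
    have "K' = K" using eq u v by simp
    then have "interior K = {}" using D(5)[of t K t' K] uv u v by auto
    moreover obtain c d where "K = {c..d}"
      using tagged_division_interval[OF td] uv(1) u by metis
    ultimately have "measure lborel K = 0" by simp
    then show "(case case u of (t, K) \<Rightarrow> (\<tau> t K, K) of (t, K) \<Rightarrow> measure lborel K * f t) = 0"
      by (simp add: u)
  qed
  also have "\<dots> = (\<Sum>(t, K)\<in>p. measure lborel K * f (\<tau> t K))"
    by (intro sum.cong) auto
  finally show "riemann_sum f q = (\<Sum>(t, K)\<in>p. measure lborel K * f (\<tau> t K))" .
qed

text \<open>Moving a single tag from \<open>t\<close> to \<open>y\<close> within its cell
  \<open>K\<close> alters the Riemann sum by |K| (f(y) - f(t)). Both sums lie within 1 of the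
  integral, so this change is below 2.\<close>

lemma riemann_integrable_bounded:
  assumes "riemann_integrable f a b"
  shows "\<exists>B. \<forall>x\<in>{a..b}. \<bar>f x\<bar> \<le> B"
proof -
  obtain \<eta> where \<eta>: "\<eta> > 0" "\<And>p. fine_tagged_division \<eta> a b p \<Longrightarrow> \<bar>riemann_sum f p - integral {a..b} f\<bar> < 1"
    using riemann_integrableD(2)[OF assms, of 1] by auto
  obtain p where p: "fine_tagged_division \<eta> a b p" using fine_tagged_division_exists[OF \<eta>(1)] by blast
  have td: "p tagged_division_of {a..b}" using p by (simp add: fine_tagged_division_def)
  note D = tagged_division_ofD[OF td]
  \<comment> \<open>The sum of \<open>w\<close> over all cells serves as one bound for every
    \<open>y\<close>. On a degenerate cell the quotient is 0 by convention, which is harmless since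
    then y = t.\<close>
  define w where "w = (\<lambda>(t::real, K::real set). \<bar>f t\<bar> + 2 / measure lborel K)"
  have "\<bar>f y\<bar> \<le> sum w p" if y: "y \<in> {a..b}" for y
  proof -
    have "y \<in> \<Union>{K. \<exists>t. (t, K) \<in> p}" using y D(6) by simp
    then obtain t K where tK: "(t, K) \<in> p" "y \<in> K" by blast
    define \<tau> where "\<tau> t' K' = (if (t', K') = (t, K) then y else t')" for t' K'
    have \<tau>: "\<tau> t' K' \<in> K'" if "(t', K') \<in> p" for t' K'
      using that tK D(2) by (auto simp: \<tau>_def)
    define q where "q = (\<lambda>(t, K). (\<tau> t K, K)) ` p"
    have q_sum: "riemann_sum f q = (\<Sum>(t, K)\<in>p. measure lborel K * f (\<tau> t K))"
      unfolding q_def by (rule retag(2)[OF p \<tau>])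
    have q_fine: "fine_tagged_division \<eta> a b q"
      unfolding q_def by (rule retag(1)[OF p \<tau>])
    have "riemann_sum f q - riemann_sum f p = (\<Sum>(t', K')\<in>p. measure lborel K' * (f (\<tau> t' K') - f t'))"
      unfolding q_sum unfolding riemann_sum_def
      by (simp add: sum_subtractf[symmetric] split_def right_diff_distrib)
    also have "\<dots> = (\<Sum>u\<in>p. if u = (t, K) then measure lborel K * (f y - f t) else 0)"
      by (intro sum.cong refl) (simp add: \<tau>_def split: prod.split)
    also have "\<dots> = measure lborel K * (f y - f t)" using tK(1) D(1) by simp
    finally have "\<bar>measure lborel K * (f y - f t)\<bar> < 2"
      using \<eta>(2)[OF p] \<eta>(2)[OF q_fine] by (simp add: abs_if split: if_splits)
    then have *: "measure lborel K * \<bar>f y - f t\<bar> < 2" by (simp add: abs_mult)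
    have "\<bar>f y\<bar> \<le> w (t, K)"
    proof (cases "measure lborel K = 0")
      case True
      then obtain c d where "K = {c..d}" "c \<le> t" "t \<le> d" using tagged_division_interval[OF td tK(1)] by metis
      then have "y = t" using True tK(2) by simp
      then show ?thesis by (simp add: w_def True)
    next
      case False
      then have "measure lborel K > 0" by (simp add: zero_less_measure_iff)
      then have "\<bar>f y - f t\<bar> < 2 / measure lborel K" using * by (simp add: field_simps)
      then show ?thesis by (simp add: w_def)
    qed
    also have "\<dots> \<le> sum w p" using D(1) tK(1) by (intro member_le_sum) (auto simp: w_def)
    finally show ?thesis .
  qed
  then show ?thesis by blast
qed

text \<open>Every nondegenerate cell contains a point where the bound holds, and it can be made the
  tag. This is where the constant mesh is essential: for Lebesgue or gauge integrals a bound on a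
  dense set says nothing about the integral.\<close>

lemma integral_le_dense:
  assumes f: "riemann_integrable f a b" and "a \<le> b"
    and dense: "\<And>c d. a \<le> c \<Longrightarrow> c < d \<Longrightarrow> d \<le> b \<Longrightarrow> \<exists>y\<in>{c..d}. \<bar>f y\<bar> \<le> M"
  shows "\<bar>integral {a..b} f\<bar> \<le> M * (b - a)"
proof (rule field_le_epsilon)
  fix e :: real assume "e > 0"
  then obtain \<eta> where \<eta>: "\<eta> > 0" "\<And>p. fine_tagged_division \<eta> a b p \<Longrightarrow> \<bar>riemann_sum f p - integral {a..b} f\<bar> < e"
    using riemann_integrableD(2)[OF f] by blast
  obtain p where p: "fine_tagged_division \<eta> a b p" using fine_tagged_division_exists[OF \<eta>(1)] by blast
  have td: "p tagged_division_of {a..b}" using p by (simp add: fine_tagged_division_def)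
  have "\<exists>y\<in>K. measure lborel K * \<bar>f y\<bar> \<le> measure lborel K * M" if tK: "(t, K) \<in> p" for t K
  proof -
    obtain c d where K: "K = {c..d}" "a \<le> c" "c \<le> t" "t \<le> d" "d \<le> b"
      using tagged_division_interval[OF td tK] by metis
    show ?thesis
    proof (cases "c = d")
      case False
      then have "c < d" using K by simp
      then obtain y where "y \<in> K" "\<bar>f y\<bar> \<le> M" using dense[of c d] K by auto
      then show ?thesis by (intro bexI[of _ y] mult_left_mono) auto
    qed (use K in auto)
  qed
  then obtain \<tau> where \<tau>: "\<And>t K. (t, K) \<in> p \<Longrightarrow> \<tau> t K \<in> K"
      "\<And>t K. (t, K) \<in> p \<Longrightarrow> measure lborel K * \<bar>f (\<tau> t K)\<bar> \<le> measure lborel K * M"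
    by metis
  define q where "q = (\<lambda>(t, K). (\<tau> t K, K)) ` p"
  have q_sum: "riemann_sum f q = (\<Sum>(t, K)\<in>p. measure lborel K * f (\<tau> t K))"
    unfolding q_def by (rule retag(2)[OF p \<tau>(1)])
  have q_fine: "fine_tagged_division \<eta> a b q"
    unfolding q_def by (rule retag(1)[OF p \<tau>(1)])
  have "\<bar>riemann_sum f q\<bar> \<le> (\<Sum>(t, K)\<in>p. \<bar>measure lborel K * f (\<tau> t K)\<bar>)"
    using sum_abs[of "\<lambda>(t, K). measure lborel K * f (\<tau> t K)" p]
    unfolding q_sum by (simp add: split_def)
  also have "\<dots> \<le> (\<Sum>(t, K)\<in>p. measure lborel K * M)"
    using \<tau>(2) by (intro sum_mono) (auto simp: abs_mult)
  also have "\<dots> = M * (b - a)" using riemann_sum_const[OF td \<open>a \<le> b\<close>] by (simp add: riemann_sum_def)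
  finally show "\<bar>integral {a..b} f\<bar> \<le> M * (b - a) + e"
    using \<eta>(2)[OF q_fine] by simp
qed

text \<open>The integral is split along the cells of \<open>p\<close>. The bound \<open>v\<close>
  for the oscillation around the tag will be a constant for continuous functions and the increment
  of a majorant for functions of bounded variation.\<close>

lemma riemann_sum_integral_diff:
  assumes f: "f integrable_on {a..b}" and td: "p tagged_division_of {a..b}"
    and v: "\<And>t K y. (t, K) \<in> p \<Longrightarrow> y \<in> K \<Longrightarrow> \<bar>f t - f y\<bar> \<le> v K"
  shows "\<bar>riemann_sum f p - integral {a..b} f\<bar> \<le> (\<Sum>(t, K)\<in>p. measure lborel K * v K)"
proof -
  have "integral {a..b} f = (\<Sum>(t, K)\<in>p. integral K f)"
    using integral_combine_tagged_division_topdown[of f a b p] f td by simp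
  then have "riemann_sum f p - integral {a..b} f = (\<Sum>(t, K)\<in>p. measure lborel K * f t - integral K f)"
    by (simp add: riemann_sum_def sum_subtractf[symmetric] split_def)
  also have "\<bar>\<dots>\<bar> \<le> (\<Sum>(t, K)\<in>p. \<bar>measure lborel K * f t - integral K f\<bar>)"
    unfolding split_def by (rule sum_abs)
  also have "\<dots> \<le> (\<Sum>(t, K)\<in>p. measure lborel K * v K)"
  proof (intro sum_mono, clarify)
    fix t K assume tK: "(t, K) \<in> p"
    then obtain c d where K: "K = {c..d}" "a \<le> c" "c \<le> t" "t \<le> d" "d \<le> b"
      using tagged_division_interval[OF td] by metis
    have fK: "f integrable_on {c..d}"
      using integrable_on_subinterval[OF f, of c d] K by auto
    have "v K \<ge> 0" using v[OF tK, of t] K by simp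
    have "((\<lambda>y. f t - f y) has_integral (measure lborel K * f t - integral K f)) {c..d}"
      using has_integral_diff[OF has_integral_const_real[of "f t" c d] integrable_integral[OF fK]] K by simp
    then have "norm (measure lborel K * f t - integral K f) \<le> v K * measure lborel {c..d}"
      using has_integral_bound[of "v K" "\<lambda>y. f t - f y" _ c d] v[OF tK] K \<open>v K \<ge> 0\<close> by simp
    then show "\<bar>measure lborel K * f t - integral K f\<bar> \<le> measure lborel K * v K"
      using K by (simp add: mult.commute)
  qed
  finally show ?thesis .
qed

lemma riemann_integrable_continuous:
  assumes f: "continuous_on {a..b} f" and "a \<le> b"
  shows "riemann_integrable f a b"
proof (rule riemann_integrableI)
  fix e :: real assume e: "e > 0"
  define e' where "e' = e / (b - a + 1)"
  have e': "e' > 0" using e \<open>a \<le> b\<close> by (simp add: e'_def)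
  have "uniformly_continuous_on {a..b} f" using f by (intro compact_uniformly_continuous) auto
  then obtain \<eta> where \<eta>: "\<eta> > 0" "\<And>x y. x \<in> {a..b} \<Longrightarrow> y \<in> {a..b} \<Longrightarrow> \<bar>x - y\<bar> < \<eta> \<Longrightarrow> \<bar>f x - f y\<bar> < e'"
    using e' unfolding uniformly_continuous_on_def dist_real_def by metis
  have "\<bar>riemann_sum f p - integral {a..b} f\<bar> < e" if p: "fine_tagged_division \<eta> a b p" for p
  proof -
    have td: "p tagged_division_of {a..b}" using p by (simp add: fine_tagged_division_def)
    have "\<bar>riemann_sum f p - integral {a..b} f\<bar> \<le> (\<Sum>(t, K)\<in>p. measure lborel K * e')"
    proof (rule riemann_sum_integral_diff[OF integrable_continuous_real[OF f] td])
      fix t K y assume tK: "(t, K) \<in> p" "y \<in> K"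
      then obtain c d where K: "K = {c..d}" "a \<le> c" "c \<le> t" "t \<le> d" "d \<le> b"
        using tagged_division_interval[OF td] by metis
      have "measure lborel K < \<eta>" using p tK by (auto simp: fine_tagged_division_def)
      then show "\<bar>f t - f y\<bar> \<le> e'" using K tK by (intro less_imp_le \<eta>(2)) (auto simp: abs_if)
    qed
    also have "\<dots> = e' * (b - a)" using riemann_sum_const[OF td \<open>a \<le> b\<close>] by (simp add: riemann_sum_def)
    also have "\<dots> < e" using e \<open>a \<le> b\<close> by (simp add: e'_def field_simps)
    finally show ?thesis .
  qed
  then show "\<exists>\<eta>>0. \<forall>p. fine_tagged_division \<eta> a b p \<longrightarrow> \<bar>riemann_sum f p - integral {a..b} f\<bar> < e"
    using \<eta>(1) by blast
qed

text \<open>The majorant is the total variation on [a, c], as a function of \<open>c\<close>.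
  Appending \<open>d\<close> to a chain that ends in \<open>c\<close> adds exactly |f(d) - f(c)| to
  its variation sum.\<close>

lemma bounded_variation_majorant:
  assumes bv: "bounded_variation_fun f a b"
  obtains V where "\<And>c d. a \<le> c \<Longrightarrow> c \<le> d \<Longrightarrow> d \<le> b \<Longrightarrow> \<bar>f d - f c\<bar> \<le> V d - V c"
proof -
  define T where "T c = {\<Sum>i<m. \<bar>f (x (Suc i)) - f (x i)\<bar> | (m::nat) x. x 0 = a \<and> x m = c \<and> (\<forall>i<m. x i \<le> x (Suc i))}" for c
  have step: "s + \<bar>f d - f c\<bar> \<in> T d" if s: "s \<in> T c" and "c \<le> d" for s c d
  proof -
    obtain m :: nat and x where x: "s = (\<Sum>i<m. \<bar>f (x (Suc i)) - f (x i)\<bar>)" "x 0 = a" "x m = c" "\<forall>i<m. x i \<le> x (Suc i)"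
      using s by (auto simp: T_def)
    define y where "y i = (if i \<le> m then x i else d)" for i
    have "(\<Sum>i<Suc m. \<bar>f (y (Suc i)) - f (y i)\<bar>) = s + \<bar>f d - f c\<bar>"
      using x by (simp add: y_def)
    moreover have "y 0 = a" "y (Suc m) = d" "\<forall>i<Suc m. y i \<le> y (Suc i)"
      using x \<open>c \<le> d\<close> by (auto simp: y_def less_Suc_eq)
    ultimately show ?thesis
      unfolding T_def by (intro CollectI exI[of _ "Suc m"] exI[of _ y]) auto
  qed
  obtain M where M: "\<And>s. s \<in> T b \<Longrightarrow> s \<le> M"
    using bv unfolding bounded_variation_fun_def T_def by blast
  have bdd: "bdd_above (T c)" if "c \<le> b" for c
    \<comment> \<open>Any chain up to \<open>c\<close> extends to \<open>b\<close> without
      decreasing its sum, so the bound \<open>M\<close> at \<open>b\<close> is valid for all earlier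
      \<open>c\<close>.\<close>
    using step[OF _ that] M by (intro bdd_aboveI[of _ M]) (smt (verit))
  have "0 \<in> T a" unfolding T_def by (auto intro!: exI[of _ 0] exI[of _ "\<lambda>_. a"])
  then have ne: "T c \<noteq> {}" if "a \<le> c" for c using step[of 0 a c] that by auto
  show ?thesis
  proof (rule that[of "\<lambda>c. Sup (T c)"])
    fix c d assume cd: "a \<le> c" "c \<le> d" "d \<le> b"
    have "Sup (T c) \<le> Sup (T d) - \<bar>f d - f c\<bar>"
    proof (rule cSup_least[OF ne[OF cd(1)]])
      fix s assume "s \<in> T c"
      then show "s \<le> Sup (T d) - \<bar>f d - f c\<bar>"
        using cSup_upper[OF step[OF _ cd(2)] bdd[OF cd(3)]] by (simp add: le_diff_eq)
    qed
    then show "\<bar>f d - f c\<bar> \<le> Sup (T d) - Sup (T c)" by simp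
  qed
qed

text \<open>With the variation majorant \<open>V\<close>, both \<open>V\<close> and V - f are
  increasing, which gives the existence of the integral. On each cell the oscillation is at most the
  increment of \<open>V\<close>; these increments telescope, so the error is at most the mesh times
  V(b) - V(a).\<close>

lemma riemann_integrable_bounded_variation:
  assumes bv: "bounded_variation_fun f a b" and "a \<le> b"
  shows "riemann_integrable f a b"
proof (rule riemann_integrableI)
  fix e :: real assume e: "e > 0"
  obtain V where V: "\<And>c d. a \<le> c \<Longrightarrow> c \<le> d \<Longrightarrow> d \<le> b \<Longrightarrow> \<bar>f d - f c\<bar> \<le> V d - V c"
    using bounded_variation_majorant[OF bv] by metis
  have "mono_on {a..b} V" "mono_on {a..b} (\<lambda>x. V x - f x)"
    using V by (force intro!: mono_onI)+
  then have "(\<lambda>x. V x - (V x - f x)) integrable_on {a..b}"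
    by (intro integrable_diff integrable_on_mono_on)
  then have int: "f integrable_on {a..b}" by simp
  define \<eta> where "\<eta> = e / (V b - V a + 1)"
  have Vab: "V b - V a \<ge> 0" using V[of a b] \<open>a \<le> b\<close> by simp
  then have \<eta>: "\<eta> > 0" using e by (simp add: \<eta>_def)
  have "\<bar>riemann_sum f p - integral {a..b} f\<bar> < e" if p: "fine_tagged_division \<eta> a b p" for p
  proof -
    have td: "p tagged_division_of {a..b}" using p by (simp add: fine_tagged_division_def)
    have "\<bar>riemann_sum f p - integral {a..b} f\<bar> \<le> (\<Sum>(t, K)\<in>p. measure lborel K * (V (Sup K) - V (Inf K)))"
    proof (rule riemann_sum_integral_diff[OF int td])
      fix t K y assume tK: "(t, K) \<in> p" "y \<in> K"
      then obtain c d where K: "K = {c..d}" "a \<le> c" "c \<le> t" "t \<le> d" "d \<le> b"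
        using tagged_division_interval[OF td] by metis
      have "c \<le> y" "y \<le> d" using tK K by auto
      then have "\<bar>f t - f y\<bar> \<le> V d - V c"
        using V[of t y] V[of y t] V[of c y] V[of c t] V[of y d] V[of t d] K
        by (cases "t \<le> y") auto
      then show "\<bar>f t - f y\<bar> \<le> V (Sup K) - V (Inf K)" using K by simp
    qed
    also have "\<dots> \<le> (\<Sum>(t, K)\<in>p. \<eta> * (V (Sup K) - V (Inf K)))"
    proof (intro sum_mono, clarify)
      fix t K assume tK: "(t, K) \<in> p"
      then obtain c d where K: "K = {c..d}" "a \<le> c" "c \<le> t" "t \<le> d" "d \<le> b"
        using tagged_division_interval[OF td] by metis
      have "measure lborel K < \<eta>" using p tK by (auto simp: fine_tagged_division_def)
      then show "measure lborel K * (V (Sup K) - V (Inf K)) \<le> \<eta> * (V (Sup K) - V (Inf K))"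
        using V[of c d] K by (intro mult_right_mono) auto
    qed
    also have "\<dots> = \<eta> * (\<Sum>(t, K)\<in>p. V (Sup K) - V (Inf K))" by (simp add: sum_distrib_left split_def)
    also have "\<dots> = \<eta> * (V b - V a)" using additive_tagged_division_1[OF \<open>a \<le> b\<close> td, of V] by simp
    also have "\<dots> < e" using e Vab by (simp add: \<eta>_def field_simps)
    finally show ?thesis .
  qed
  then show "\<exists>\<eta>>0. \<forall>p. fine_tagged_division \<eta> a b p \<longrightarrow> \<bar>riemann_sum f p - integral {a..b} f\<bar> < e"
    using \<eta> by blast
qed

lemma R_space_plus: "f \<in> R_space \<Longrightarrow> g \<in> R_space \<Longrightarrow> (\<lambda>x. f x + g x) \<in> R_space"
  by (simp add: R_space_def riemann_integrable_plus)

lemma R_space_cmult: "f \<in> R_space \<Longrightarrow> (\<lambda>x. c * f x) \<in> R_space"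
  by (simp add: R_space_def riemann_integrable_cmult)

lemma R_space_translate: "f \<in> R_space \<Longrightarrow> (\<lambda>x. f (x + h)) \<in> R_space"
  by (simp add: R_space_def riemann_integrable_translate)

lemma R_space_diff: "f \<in> R_space \<Longrightarrow> g \<in> R_space \<Longrightarrow> (\<lambda>x. f x - g x) \<in> R_space"
  using R_space_plus[OF _ R_space_cmult[of g "-1"]] by simp

lemma R_space_continuous: "continuous_on UNIV f \<Longrightarrow> f \<in> R_space"
  by (auto simp: R_space_def intro: riemann_integrable_continuous continuous_on_subset)

lemma R_space_BV: "BV_space \<subseteq> R_space"
  by (auto simp: R_space_def BV_space_def intro: riemann_integrable_bounded_variation)

lemma R_space_integrable: "f \<in> R_space \<Longrightarrow> f integrable_on {a..b}"
  by (cases "a \<le> b") (auto simp: R_space_def intro: riemann_integrableD(1))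

lemma R_space_bounded: "f \<in> R_space \<Longrightarrow> \<exists>B. \<forall>x\<in>{a..b}. \<bar>f x\<bar> \<le> B"
  by (cases "a \<le> b") (auto simp: R_space_def intro: riemann_integrable_bounded)

lemma AC_space_continuous:
  assumes "f \<in> AC_space"
  shows "continuous_on UNIV f"
proof -
  have "isCont f x" for x
    unfolding continuous_at_eps_delta
  proof (intro allI impI)
    fix e :: real assume "e > 0"
    have "absolutely_continuous_fun f (x - 1) (x + 1)" using assms by (simp add: AC_space_def)
    from this[unfolded absolutely_continuous_fun_def, rule_format, OF \<open>e > 0\<close>]
    obtain \<eta> where \<eta>: "\<eta> > 0" "\<And>(m::nat) s t.
        (\<forall>i<m. x - 1 \<le> s i \<and> s i \<le> t i \<and> t i \<le> x + 1) \<and> disjoint_family_on (\<lambda>i. {s i<..<t i}) {..<m} \<and>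
        (\<Sum>i<m. t i - s i) < \<eta> \<Longrightarrow> (\<Sum>i<m. \<bar>f (t i) - f (s i)\<bar>) < e"
      by blast
    have *: "\<bar>f v - f u\<bar> < e" if "x - 1 \<le> u" "u \<le> v" "v \<le> x + 1" "v - u < \<eta>" for u v
      using \<eta>(2)[of 1 "\<lambda>_. u" "\<lambda>_. v"] that by (auto simp: disjoint_family_on_def)
    have "\<bar>f y - f x\<bar> < e" if "\<bar>y - x\<bar> < min \<eta> 1" for y
      using *[of x y] *[of y x] that by (cases "x \<le> y") auto
    then show "\<exists>d>0. \<forall>y. dist y x < d \<longrightarrow> dist (f y) (f x) < e"
      using \<eta>(1) by (intro exI[of _ "min \<eta> 1"]) (auto simp: dist_real_def)
  qed
  then show ?thesis by (simp add: continuous_at_imp_continuous_on)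
qed

section \<open>The difference property\<close>

text \<open>The integral from \<open>0\<close> to \<open>x\<close>, oriented so that it is meaningful for negative \<open>x\<close>.\<close>

definition prim :: "(real \<Rightarrow> real) \<Rightarrow> real \<Rightarrow> real" where
  "prim f x = (if 0 \<le> x then integral {0..x} f else - integral {x..0} f)"

lemma integral_eq_prim_diff:
  assumes "f \<in> R_space" "a \<le> b"
  shows "integral {a..b} f = prim f b - prim f a"
proof -
  have c: "integral {u..v} f + integral {v..w} f = integral {u..w} f" if "u \<le> v" "v \<le> w" for u v w
    using Henstock_Kurzweil_Integration.integral_combine[OF that R_space_integrable[OF assms(1)]] .
  show ?thesis
    using c[of 0 a b] c[of a 0 b] c[of a b 0] assms(2) by (auto simp: prim_def)
qed

lemma prim_plus:
  assumes "f \<in> R_space" "g \<in> R_space"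
  shows "prim (\<lambda>x. f x + g x) x = prim f x + prim g x"
  using assms by (simp add: prim_def integral_add R_space_integrable)

lemma prim_const: "prim (\<lambda>_. c) x = c * x"
  by (simp add: prim_def)

lemma prim_translate:
  assumes "f \<in> R_space"
  shows "prim (\<lambda>x. f (x + c)) x = prim f (x + c) - prim f c"
proof (cases "0 \<le> x")
  case True
  have "integral {0..x} (\<lambda>x. f (x + c)) = integral {c..x + c} f"
    using integral_shift_real_ivl[of c c "x + c" f] by (simp only: diff_self add_diff_cancel_right')
  then show ?thesis using True integral_eq_prim_diff[OF assms, of c "x + c"] by (simp add: prim_def)
next
  case False
  have "integral {x..0} (\<lambda>x. f (x + c)) = integral {x + c..c} f"
    using integral_shift_real_ivl[of "x + c" c c f] by (simp only: diff_self add_diff_cancel_right')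
  then show ?thesis using False integral_eq_prim_diff[OF assms, of "x + c" c] by (simp add: prim_def)
qed

lemma prim_Lipschitz:
  assumes "f \<in> R_space"
  shows "\<exists>C\<ge>0. \<forall>x\<in>{a..b}. \<forall>y\<in>{a..b}. \<bar>prim f x - prim f y\<bar> \<le> C * \<bar>x - y\<bar>"
proof -
  obtain B where B: "\<And>x. x \<in> {a..b} \<Longrightarrow> \<bar>f x\<bar> \<le> B" using R_space_bounded[OF assms] by metis
  have *: "\<bar>prim f y - prim f x\<bar> \<le> \<bar>B\<bar> * \<bar>y - x\<bar>" if "x \<in> {a..b}" "y \<in> {a..b}" "x \<le> y" for x y
  proof -
    have "norm (f t) \<le> \<bar>B\<bar>" if "t \<in> {x..y}" for t
      using B[of t] that \<open>x \<in> {a..b}\<close> \<open>y \<in> {a..b}\<close> by auto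
    then have "norm (integral {x..y} f) \<le> \<bar>B\<bar> * measure lborel {x..y}"
      using has_integral_bound_real[OF _ finite.emptyI integrable_integral[OF R_space_integrable[OF assms]]]
      by simp
    then show ?thesis using integral_eq_prim_diff[OF assms \<open>x \<le> y\<close>] that by simp
  qed
  have "\<bar>prim f x - prim f y\<bar> \<le> \<bar>B\<bar> * \<bar>x - y\<bar>" if "x \<in> {a..b}" "y \<in> {a..b}" for x y
    using *[of x y] *[of y x] that by (cases "x \<le> y") (auto simp: abs_minus_commute)
  then show ?thesis by (intro exI[of _ "\<bar>B\<bar>"]) auto
qed

lemma prim_has_derivative:
  assumes "continuous_on UNIV f"
  shows "(prim f has_real_derivative f x) (at x)"
proof -
  have R: "f \<in> R_space" by (rule R_space_continuous[OF assms])
  \<comment> \<open>Starting at \<open>x - 1\<close> keeps the case distinction of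
    \<open>prim\<close> at 0 out of the neighbourhood of \<open>x\<close>.\<close>
  have "((\<lambda>y. integral {x - 1..y} f) has_real_derivative f x) (at x within {x - 1..x + 1})"
    using continuous_on_subset[OF assms] by (intro integral_has_real_derivative) auto
  then have "((\<lambda>y. integral {x - 1..y} f) has_real_derivative f x) (at x)"
    by (simp add: at_within_Icc_at)
  then have "((\<lambda>y. integral {x - 1..y} f + prim f (x - 1)) has_real_derivative f x) (at x)"
    by (auto intro!: derivative_eq_intros)
  then show ?thesis
  proof (rule has_field_derivative_transform_within_open[where S = "{x - 1<..}"])
    fix y assume "y \<in> {x - 1<..}"
    then show "integral {x - 1..y} f + prim f (x - 1) = prim f y"
      using integral_eq_prim_diff[OF R, of "x - 1" y] by simp
  qed auto
qed

text \<open>The gauge integral behind \<open>integral\<close> recovers a function from its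
  derivative even where that derivative is discontinuous.\<close>

lemma prim_eq_antiderivative:
  assumes "\<And>x. (F has_real_derivative f x) (at x)"
  shows "prim f x = F x - F 0"
proof -
  have *: "integral {a..b} f = F b - F a" if "a \<le> b" for a b
    using fundamental_theorem_of_calculus[OF that, of F f] assms
    by (intro integral_unique)
       (simp add: has_real_derivative_iff_has_vector_derivative has_vector_derivative_at_within)
  show ?thesis using *[of 0 x] *[of x 0] by (simp add: prim_def)
qed

text \<open>The additive function \<open>t \<mapsto> (\<integral>\<^sub>0\<^sup>1 \<Delta>\<^sub>t g) - (\<integral>\<^sub>0\<^sup>t \<Delta>\<^sub>1 g)\<close> vanishes.\<close>

definition normalized :: "(real \<Rightarrow> real) \<Rightarrow> bool" where
  "normalized g \<longleftrightarrow> (\<forall>h. diff_op h g \<in> R_space) \<and> (\<forall>t. prim (diff_op t g) 1 = prim (diff_op 1 g) t)"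

text \<open>A step of s + t is a step \<open>t\<close> followed by a step \<open>s\<close> from the
  shifted point; this identity for differences is integrated from 0 to \<open>x\<close>.\<close>

lemma prim_diff_op_cocycle:
  assumes "\<And>h. diff_op h f \<in> R_space"
  shows "prim (diff_op (s + t) f) x = prim (diff_op s f) (x + t) - prim (diff_op s f) t + prim (diff_op t f) x"
proof -
  have "diff_op (s + t) f = (\<lambda>x. diff_op s f (x + t) + diff_op t f x)"
    by (auto simp: diff_op_def algebra_simps)
  then show ?thesis
    using prim_plus[OF R_space_translate[OF assms] assms] prim_translate[OF assms] by simp
qed

text \<open>Both sides expand the same integral of the difference with step s + t, once for each
  order of the two steps.\<close>

lemma prim_diff_op_exchange:
  assumes "\<And>h. diff_op h f \<in> R_space"
  shows "prim (diff_op s f) (x + t) - prim (diff_op s f) t + prim (diff_op t f) x =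
         prim (diff_op t f) (x + s) - prim (diff_op t f) s + prim (diff_op s f) x"
  using prim_diff_op_cocycle[OF assms, of s t x] prim_diff_op_cocycle[OF assms, of t s x]
  by (simp add: add.commute)

text \<open>The cocycle identity leaves a defect in each of the two terms, and the exchange identity
  says that the defects agree. For additive \<open>f\<close> the value is L f(t) - t f(L); for
  integrable \<open>f\<close> it is 0.\<close>

lemma additive_prim_diff_op:
  assumes "\<And>h. diff_op h f \<in> R_space"
  shows "Modules.additive (\<lambda>t. prim (diff_op t f) L - prim (diff_op L f) t)"
proof
  fix s t
  show "prim (diff_op (s + t) f) L - prim (diff_op L f) (s + t) =
        prim (diff_op s f) L - prim (diff_op L f) s + (prim (diff_op t f) L - prim (diff_op L f) t)"
    using prim_diff_op_cocycle[OF assms, of s t L] prim_diff_op_exchange[OF assms, of s t L]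
    by (simp add: add.commute)
qed

text \<open>Read as a function of \<open>L\<close> with \<open>t\<close> fixed, the difference of
  the two sides is additive as well; it vanishes at 1 by normalization, hence at every
  rational.\<close>

lemma normalized_Rats:
  assumes "normalized g" "L \<in> \<rat>"
  shows "prim (diff_op t g) L = prim (diff_op L g) t"
proof -
  have "Modules.additive (\<lambda>L. prim (diff_op L g) t - prim (diff_op t g) L)"
    using assms(1) by (intro additive_prim_diff_op) (simp add: normalized_def)
  from additive_Rats[OF this assms(2), of 1] show ?thesis
    using assms(1) by (simp add: normalized_def)
qed

text \<open>If \<open>g\<close> were integrable, both sides would be the integral of
  \<open>g\<close> over the translated interval minus that over [a, b]. Without integrability the
  identity follows from the exchange identity once step and rational length may be swapped.\<close>

lemma normalized_average:
  assumes "normalized g" "a \<le> b" "b - a \<in> \<rat>"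
  shows "integral {a..b} (diff_op t g) =
         prim (diff_op (b - a) g) (a + t) - prim (diff_op (b - a) g) a"
proof -
  have R: "\<And>h. diff_op h g \<in> R_space" using assms(1) by (simp add: normalized_def)
  show ?thesis
    using integral_eq_prim_diff[OF R assms(2), of t] normalized_Rats[OF assms(1,3), of t]
      prim_diff_op_exchange[OF R, of t a "b - a"]
    by simp
qed

section \<open>Averaging difference functionals over translations\<close>

text \<open>These are the finite linear combinations of point evaluations that annihilate constants,
  and the generators are the induction cases of the averaging identity. Applied to translates of
  \<open>g\<close>, they see only differences of \<open>g\<close>, which are integrable by
  assumption.\<close>

inductive difference_functional :: "((real \<Rightarrow> real) \<Rightarrow> real) \<Rightarrow> bool" where
  pair: "difference_functional (\<lambda>\<phi>. \<phi> x - \<phi> y)"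
| plus: "difference_functional \<Lambda> \<Longrightarrow> difference_functional \<Lambda>' \<Longrightarrow> difference_functional (\<lambda>\<phi>. \<Lambda> \<phi> + \<Lambda>' \<phi>)"
| scale: "difference_functional \<Lambda> \<Longrightarrow> difference_functional (\<lambda>\<phi>. c * \<Lambda> \<phi>)"

lemma difference_functional_sum:
  assumes "\<And>i. i \<in> A \<Longrightarrow> difference_functional (\<Lambda> i)"
  shows "difference_functional (\<lambda>\<phi>. \<Sum>i\<in>A. \<Lambda> i \<phi>)"
proof -
  have zero: "difference_functional (\<lambda>\<phi>. 0)"
    using difference_functional.pair[of 0 0] by simp
  show ?thesis
  proof (cases "finite A")
    case True
    then show ?thesis using assms
      by (induction A) (auto intro!: zero difference_functional.plus)
  qed (use zero in simp)
qed

lemma difference_functional_linear: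
  assumes "difference_functional \<Lambda>"
  shows "\<Lambda> (\<lambda>x. f x - g x) = \<Lambda> f - \<Lambda> g" "\<Lambda> (\<lambda>x. f x / c) = \<Lambda> f / c"
  using assms by induction (simp_all add: right_diff_distrib add_divide_distrib diff_divide_distrib)

lemma difference_functional_average:
  assumes g: "normalized g" and ab: "a \<le> b" "b - a \<in> \<rat>" and "difference_functional \<Lambda>"
  shows "(\<lambda>h. \<Lambda> (\<lambda>x. g (x + h))) \<in> R_space \<and>
         integral {a..b} (\<lambda>h. \<Lambda> (\<lambda>x. g (x + h))) = \<Lambda> (\<lambda>x. prim (diff_op (b - a) g) (a + x))"
  using assms(4)
proof induction
  case (pair x y)
  have R: "\<And>h. diff_op h g \<in> R_space" using g by (simp add: normalized_def)
  \<comment> \<open>As a function of \<open>h\<close> the pair of evaluations is a difference of two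
    functions Delta g with steps \<open>x\<close> and \<open>y\<close>: the shift and the argument
    change roles.\<close>
  have eq: "(\<lambda>h. g (x + h) - g (y + h)) = (\<lambda>h. diff_op x g h - diff_op y g h)"
    by (auto simp: diff_op_def add.commute)
  show ?case
    unfolding eq using R_space_diff[OF R R] normalized_average[OF g ab]
    by (simp add: integral_diff R_space_integrable R)
next
  case (plus \<Lambda> \<Lambda>')
  then show ?case by (simp add: R_space_plus integral_add R_space_integrable)
next
  case (scale \<Lambda> c)
  then show ?case by (simp add: R_space_cmult)
qed

lemma baire_cover:
  fixes E :: "nat \<Rightarrow> real set"
  assumes "\<And>h. \<exists>i. h \<in> E i"
  obtains i a b where "a < b" "{a<..<b} \<subseteq> closure (E i)"
proof -
  have "\<exists>i. interior (closure (E i)) \<noteq> {}"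
  proof (rule ccontr)
    assume "\<not> ?thesis"
    then have empty: "interior (closure (E i)) = {}" for i by blast
    have "UNIV \<subseteq> closure (\<Inter>(range (\<lambda>i. - closure (E i))))"
    proof (rule Baire)
      fix T assume "T \<in> range (\<lambda>i. - closure (E i))"
      then obtain i where "T = - closure (E i)" by blast
      then show "openin (top_of_set UNIV) T \<and> UNIV \<subseteq> closure T"
        using empty[of i] by (simp add: closure_complement open_closed)
    qed auto
    moreover have "\<Inter>(range (\<lambda>i. - closure (E i))) = {}"
      using assms closure_subset by blast
    ultimately show False by simp
  qed
  then obtain i x where "x \<in> interior (closure (E i))" by blast
  then obtain e where e: "e > 0" "ball x e \<subseteq> closure (E i)" by (auto simp: mem_interior)
  have "{x - e<..<x + e} \<subseteq> closure (E i)"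
    using e(2) by (auto simp: subset_iff dist_real_def abs_less_iff)
  then show ?thesis using that[of "x - e" "x + e" i] e(1) by auto
qed

text \<open>The index \<open>i\<close> must be countable for Baire's theorem. Two uses occur:
  \<open>F i\<close> shrinks with the scale 1 / (i + 1) while the bound is fixed, or
  \<open>F i\<close> is constant and the bound grows with \<open>i\<close>.\<close>

theorem averaging_principle:
  fixes F :: "nat \<Rightarrow> ((real \<Rightarrow> real) \<Rightarrow> real) set"
  assumes g: "normalized g"
    and F: "\<And>i \<Lambda>. \<Lambda> \<in> F i \<Longrightarrow> difference_functional \<Lambda>"
    and cover: "\<And>h. \<exists>i. \<forall>\<Lambda>\<in>F i. \<bar>\<Lambda> (diff_op h g)\<bar> \<le> e i"
  shows "\<exists>i a L. \<forall>\<Lambda>\<in>F i. \<bar>\<Lambda> (\<lambda>x. g x - prim (diff_op L g) (a + x) / L)\<bar> \<le> e i"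
proof -
  define E where "E i = {h. \<forall>\<Lambda>\<in>F i. \<bar>\<Lambda> (diff_op h g)\<bar> \<le> e i}" for i
  have cov: "\<exists>i. h \<in> E i" for h using cover[of h] by (simp add: E_def)
  obtain i u v where uv: "u < v" "{u<..<v} \<subseteq> closure (E i)"
    by (rule baire_cover[OF cov])
  \<comment> \<open>Both endpoints are chosen rational so that the length is rational, as the
    averaging identity requires.\<close>
  obtain a where a: "a \<in> \<rat>" "u < a" "a < v" using Rats_dense_in_real[OF uv(1)] by blast
  obtain b where b: "b \<in> \<rat>" "a < b" "b < v" using Rats_dense_in_real[OF a(3)] by blast
  have ab: "a \<le> b" "b - a \<in> \<rat>" using a b by auto
  show ?thesis
  proof (rule exI[of _ i], rule exI[of _ a], rule exI[of _ "b - a"], rule ballI)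
    fix \<Lambda> assume \<Lambda>: "\<Lambda> \<in> F i"
    have df: "difference_functional \<Lambda>" by (rule F[OF \<Lambda>])
    note av = difference_functional_average[OF g ab df]
    have \<psi>: "\<Lambda> (diff_op h g) = \<Lambda> (\<lambda>x. g (x + h)) - \<Lambda> g" for h
      unfolding diff_op_def by (rule difference_functional_linear(1)[OF df])
    have const: "(\<lambda>_. \<Lambda> g) \<in> R_space" by (rule R_space_continuous) simp
    have R: "(\<lambda>h. \<Lambda> (diff_op h g)) \<in> R_space"
      unfolding \<psi> using av const by (intro R_space_diff) auto
    have "\<bar>integral {a..b} (\<lambda>h. \<Lambda> (diff_op h g))\<bar> \<le> e i * (b - a)"
    proof (rule integral_le_dense)
      show "riemann_integrable (\<lambda>h. \<Lambda> (diff_op h g)) a b" using R ab by (simp add: R_space_def)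
      fix c d assume cd: "a \<le> c" "c < d" "d \<le> b"
      have "(c + d) / 2 \<in> {c<..<d} \<inter> closure (E i)" using uv(2) a b cd by auto
      then have "{c<..<d} \<inter> E i \<noteq> {}"
        using open_Int_closure_eq_empty[of "{c<..<d}" "E i"] open_greaterThanLessThan by blast
      then show "\<exists>y\<in>{c..d}. \<bar>\<Lambda> (diff_op y g)\<bar> \<le> e i" using \<Lambda> by (force simp: E_def)
    qed (rule ab)
    also have "integral {a..b} (\<lambda>h. \<Lambda> (diff_op h g)) =
        \<Lambda> (\<lambda>x. prim (diff_op (b - a) g) (a + x)) - (b - a) * \<Lambda> g"
      unfolding \<psi> using av const ab by (simp add: integral_diff R_space_integrable)
    finally have "\<bar>\<Lambda> g * (b - a) - \<Lambda> (\<lambda>x. prim (diff_op (b - a) g) (a + x))\<bar> \<le> e i * (b - a)"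
      by (simp add: abs_minus_commute mult.commute)
    then have "\<bar>\<Lambda> g - \<Lambda> (\<lambda>x. prim (diff_op (b - a) g) (a + x)) / (b - a)\<bar> \<le> e i"
      using b(2) by (simp add: abs_le_iff field_simps)
    then show "\<bar>\<Lambda> (\<lambda>x. g x - prim (diff_op (b - a) g) (a + x) / (b - a))\<bar> \<le> e i"
      by (simp add: difference_functional_linear[OF df])
  qed
qed

lemma smoothing_Lipschitz:
  assumes "normalized g"
  shows "\<exists>C\<ge>0. \<forall>x\<in>{c..d}. \<forall>y\<in>{c..d}.
           \<bar>prim (diff_op L g) (a + x) / L - prim (diff_op L g) (a + y) / L\<bar> \<le> C * \<bar>x - y\<bar>"
proof -
  have "diff_op L g \<in> R_space" using assms by (simp add: normalized_def)
  from prim_Lipschitz[OF this, of "a + c" "a + d"] obtain C where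
    C: "C \<ge> 0" "\<And>x y. x \<in> {a + c..a + d} \<Longrightarrow> y \<in> {a + c..a + d} \<Longrightarrow>
      \<bar>prim (diff_op L g) x - prim (diff_op L g) y\<bar> \<le> C * \<bar>x - y\<bar>" by blast
  show ?thesis
  \<comment> \<open>The averaging principle does not report that \<open>L\<close> is nonzero; for L
    = 0 both quotients and this constant are 0, so the estimate persists.\<close>
  proof (intro exI[of _ "C / \<bar>L\<bar>"] conjI ballI)
    fix x y assume "x \<in> {c..d}" "y \<in> {c..d}"
    then have "\<bar>prim (diff_op L g) (a + x) - prim (diff_op L g) (a + y)\<bar> / \<bar>L\<bar> \<le> C * \<bar>x - y\<bar> / \<bar>L\<bar>"
      using C(2)[of "a + x" "a + y"] by (intro divide_right_mono) auto
    then show "\<bar>prim (diff_op L g) (a + x) / L - prim (diff_op L g) (a + y) / L\<bar> \<le> C / \<bar>L\<bar> * \<bar>x - y\<bar>"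
      by (simp add: diff_divide_distrib[symmetric])
  qed (use C in auto)
qed

lemma smoothing_continuous:
  assumes "normalized g"
  shows "continuous_on {c..d} (\<lambda>x. prim (diff_op L g) (a + x) / L)"
proof -
  obtain C where C: "C \<ge> 0" "\<And>x y. x \<in> {c..d} \<Longrightarrow> y \<in> {c..d} \<Longrightarrow>
     \<bar>prim (diff_op L g) (a + x) / L - prim (diff_op L g) (a + y) / L\<bar> \<le> C * \<bar>x - y\<bar>"
    using smoothing_Lipschitz[OF assms] by metis
  then have "C-lipschitz_on {c..d} (\<lambda>x. prim (diff_op L g) (a + x) / L)"
    by (intro lipschitz_onI) (auto simp: dist_real_def)
  then show ?thesis by (rule lipschitz_on_continuous_on)
qed

lemma nat_inverse_small:
  assumes "(\<eta>::real) > 0"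
  shows "\<exists>i. 1 / real (Suc i) < \<eta>"
  using nat_approx_posE[OF assms] by metis

section \<open>The difference property for integrable, continuous, AC, BV and differentiable
  functions\<close>

theorem difference_property_R:
  assumes g: "normalized g"
  shows "g \<in> R_space"
  unfolding R_space_def
proof (intro CollectI allI impI riemann_integrable_Cauchy)
  fix a b \<epsilon> :: real assume ab: "a \<le> b" and \<epsilon>: "\<epsilon> > 0"
  define F where "F i = {(\<lambda>\<phi>. riemann_sum \<phi> p - riemann_sum \<phi> q) | p q.
      fine_tagged_division (1 / real (Suc i)) a b p \<and> fine_tagged_division (1 / real (Suc i)) a b q}" for i
  have "\<exists>i c L. \<forall>\<Lambda>\<in>F i. \<bar>\<Lambda> (\<lambda>x. g x - prim (diff_op L g) (c + x) / L)\<bar> \<le> \<epsilon> / 3"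
  proof (rule averaging_principle[OF g, of F "\<lambda>_. \<epsilon> / 3"])
    fix i \<Lambda> assume "\<Lambda> \<in> F i"
    then obtain p q where pq: "p tagged_division_of {a..b}" "q tagged_division_of {a..b}"
      and \<Lambda>: "\<Lambda> = (\<lambda>\<phi>. riemann_sum \<phi> p - riemann_sum \<phi> q)"
      by (auto simp: F_def fine_tagged_division_def)
    \<comment> \<open>A single Riemann sum does not annihilate constants. Subtracting
      \<open>\<phi> a\<close> repairs this, and the correction is the same for \<open>p\<close> and
      \<open>q\<close> because both fill an interval of length b - a.\<close>
    have *: "riemann_sum \<phi> r = riemann_sum (\<lambda>x. \<phi> x - \<phi> a) r + \<phi> a * (b - a)"
      if "r tagged_division_of {a..b}" for r \<phi>
      using riemann_sum_const[OF that ab, of "\<phi> a"] by (simp add: riemann_sum_linear)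
    have df: "difference_functional (\<lambda>\<phi>. riemann_sum (\<lambda>x. \<phi> x - \<phi> a) r)" for r
      unfolding riemann_sum_def split_def
      by (intro difference_functional_sum difference_functional.scale difference_functional.pair)
    have "\<Lambda> = (\<lambda>\<phi>. riemann_sum (\<lambda>x. \<phi> x - \<phi> a) p + (-1) * riemann_sum (\<lambda>x. \<phi> x - \<phi> a) q)"
      unfolding \<Lambda>
    proof
      fix \<phi>
      show "riemann_sum \<phi> p - riemann_sum \<phi> q =
          riemann_sum (\<lambda>x. \<phi> x - \<phi> a) p + (-1) * riemann_sum (\<lambda>x. \<phi> x - \<phi> a) q"
        using *[OF pq(1), of \<phi>] *[OF pq(2), of \<phi>] by linarith
    qed
    then show "difference_functional \<Lambda>"
      by (simp only:) (intro difference_functional.plus difference_functional.scale df)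
  next
    fix h
    have "riemann_integrable (diff_op h g) a b" using g ab by (simp add: normalized_def R_space_def)
    from riemann_integrableD(2)[OF this, of "\<epsilon> / 6"] \<epsilon> obtain \<eta> where \<eta>: "\<eta> > 0"
      "\<And>p. fine_tagged_division \<eta> a b p \<Longrightarrow> \<bar>riemann_sum (diff_op h g) p - integral {a..b} (diff_op h g)\<bar> < \<epsilon> / 6"
      by auto
    obtain i where i: "1 / real (Suc i) < \<eta>" using nat_inverse_small[OF \<eta>(1)] by blast
    have "\<bar>riemann_sum (diff_op h g) p - riemann_sum (diff_op h g) q\<bar> \<le> \<epsilon> / 3"
      if "fine_tagged_division (1 / real (Suc i)) a b p" "fine_tagged_division (1 / real (Suc i)) a b q" for p q
      using \<eta>(2)[OF fine_tagged_division_mono[OF that(1)]] \<eta>(2)[OF fine_tagged_division_mono[OF that(2)]] i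
      by linarith
    then show "\<exists>i. \<forall>\<Lambda>\<in>F i. \<bar>\<Lambda> (diff_op h g)\<bar> \<le> \<epsilon> / 3" by (intro exI[of _ i]) (auto simp: F_def)
  qed
  then obtain i c L where i: "\<And>\<Lambda>. \<Lambda> \<in> F i \<Longrightarrow> \<bar>\<Lambda> (\<lambda>x. g x - prim (diff_op L g) (c + x) / L)\<bar> \<le> \<epsilon> / 3" by blast
  let ?w = "\<lambda>x. prim (diff_op L g) (c + x) / L"
  have "riemann_integrable ?w a b"
    by (rule riemann_integrable_continuous[OF smoothing_continuous[OF g] ab])
  from riemann_integrableD(2)[OF this, of "\<epsilon> / 6"] \<epsilon> obtain \<eta> where \<eta>: "\<eta> > 0"
      "\<And>p. fine_tagged_division \<eta> a b p \<Longrightarrow> \<bar>riemann_sum ?w p - integral {a..b} ?w\<bar> < \<epsilon> / 6"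
    by auto
  define \<eta>' where "\<eta>' = min \<eta> (1 / real (Suc i))"
  have "\<bar>riemann_sum g p - riemann_sum g q\<bar> < \<epsilon>"
    if p: "fine_tagged_division \<eta>' a b p" and q: "fine_tagged_division \<eta>' a b q" for p q
  proof -
    have "(\<lambda>\<phi>. riemann_sum \<phi> p - riemann_sum \<phi> q) \<in> F i"
      using fine_tagged_division_mono[OF p, of "1 / real (Suc i)"] fine_tagged_division_mono[OF q, of "1 / real (Suc i)"]
      unfolding F_def \<eta>'_def by (intro CollectI exI[of _ p] exI[of _ q]) auto
    from i[OF this] have "\<bar>(riemann_sum g p - riemann_sum g q) - (riemann_sum ?w p - riemann_sum ?w q)\<bar> \<le> \<epsilon> / 3"
      by (simp add: riemann_sum_linear algebra_simps)
    moreover have "\<bar>riemann_sum ?w p - integral {a..b} ?w\<bar> < \<epsilon> / 6" "\<bar>riemann_sum ?w q - integral {a..b} ?w\<bar> < \<epsilon> / 6"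
      using \<eta>(2)[OF fine_tagged_division_mono[OF p]] \<eta>(2)[OF fine_tagged_division_mono[OF q]]
      by (auto simp: \<eta>'_def)
    ultimately show ?thesis by linarith
  qed
  moreover have "\<eta>' > 0" using \<eta>(1) by (simp add: \<eta>'_def)
  ultimately show "\<exists>\<eta>>0. \<forall>p q. fine_tagged_division \<eta> a b p \<longrightarrow> fine_tagged_division \<eta> a b q \<longrightarrow>
      \<bar>riemann_sum g p - riemann_sum g q\<bar> < \<epsilon>" by blast
qed

lemma difference_property_continuous:
  assumes g: "normalized g" and cont: "\<And>h. continuous_on UNIV (diff_op h g)"
  shows "continuous_on UNIV g"
proof -
  have "isCont g x0" for x0
    unfolding continuous_at_eps_delta
  proof (intro allI impI)
    fix \<epsilon> :: real assume \<epsilon>: "\<epsilon> > 0"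
    define F :: "nat \<Rightarrow> ((real \<Rightarrow> real) \<Rightarrow> real) set" where
      "F i = {(\<lambda>\<phi>. \<phi> x - \<phi> x0) | x. \<bar>x - x0\<bar> < 1 / real (Suc i)}" for i
    have "\<exists>i a L. \<forall>\<Lambda>\<in>F i. \<bar>\<Lambda> (\<lambda>x. g x - prim (diff_op L g) (a + x) / L)\<bar> \<le> \<epsilon> / 2"
    proof (rule averaging_principle[OF g, of F "\<lambda>_. \<epsilon> / 2"])
      fix i \<Lambda> assume "\<Lambda> \<in> F i"
      then show "difference_functional \<Lambda>" by (auto simp: F_def intro: difference_functional.pair)
    next
      fix h
      have "isCont (diff_op h g) x0" using cont by (simp add: continuous_on_eq_continuous_at)
      then obtain \<eta> where \<eta>: "\<eta> > 0" "\<And>x. \<bar>x - x0\<bar> < \<eta> \<Longrightarrow> \<bar>diff_op h g x - diff_op h g x0\<bar> < \<epsilon> / 2"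
        unfolding continuous_at_eps_delta dist_real_def using \<epsilon> by (meson half_gt_zero)
      obtain i where "1 / real (Suc i) < \<eta>" using nat_inverse_small[OF \<eta>(1)] by blast
      then have "\<bar>diff_op h g x - diff_op h g x0\<bar> \<le> \<epsilon> / 2" if "\<bar>x - x0\<bar> < 1 / real (Suc i)" for x
        using \<eta>(2)[of x] that by linarith
      then show "\<exists>i. \<forall>\<Lambda>\<in>F i. \<bar>\<Lambda> (diff_op h g)\<bar> \<le> \<epsilon> / 2"
        unfolding F_def by blast
    qed
    then obtain i a L where i: "\<And>\<Lambda>. \<Lambda> \<in> F i \<Longrightarrow> \<bar>\<Lambda> (\<lambda>x. g x - prim (diff_op L g) (a + x) / L)\<bar> \<le> \<epsilon> / 2" by blast
    let ?w = "\<lambda>x. prim (diff_op L g) (a + x) / L"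
    obtain C where C: "C \<ge> 0" "\<And>x y. x \<in> {x0 - 1..x0 + 1} \<Longrightarrow> y \<in> {x0 - 1..x0 + 1} \<Longrightarrow> \<bar>?w x - ?w y\<bar> \<le> C * \<bar>x - y\<bar>"
      using smoothing_Lipschitz[OF g, of "x0 - 1" "x0 + 1"] by metis
    \<comment> \<open>The three bounds keep \<open>x\<close> where \<open>C\<close> is a Lipschitz
      constant, put the pair into \<open>F i\<close>, and make the Lipschitz term smaller than
      \<epsilon> / 2; \<open>C + 1\<close> avoids a zero denominator.\<close>
    define \<eta> where "\<eta> = min (min 1 (1 / real (Suc i))) (\<epsilon> / (2 * (C + 1)))"
    have "\<bar>g x - g x0\<bar> < \<epsilon>" if x: "\<bar>x - x0\<bar> < \<eta>" for x
    proof -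
      have "\<bar>(g x - ?w x) - (g x0 - ?w x0)\<bar> \<le> \<epsilon> / 2"
        using x by (intro i[of "\<lambda>\<phi>. \<phi> x - \<phi> x0"]) (auto simp: F_def \<eta>_def)
      moreover have "\<bar>?w x - ?w x0\<bar> \<le> C * \<bar>x - x0\<bar>"
      proof -
        have "\<bar>x - x0\<bar> < 1" using x unfolding \<eta>_def by linarith
        then show ?thesis by (intro C(2)) (auto simp: abs_less_iff)
      qed
      moreover have "C * \<bar>x - x0\<bar> < \<epsilon> / 2"
      proof -
        have "C * \<bar>x - x0\<bar> \<le> (C + 1) * \<bar>x - x0\<bar>" by (intro mult_right_mono) auto
        also have "\<dots> < \<epsilon> / 2" using x C(1) by (simp add: \<eta>_def field_simps)
        finally show ?thesis .
      qed
      ultimately show ?thesis by linarith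
    qed
    moreover have "\<eta> > 0" using \<epsilon> C(1) by (simp add: \<eta>_def)
    ultimately show "\<exists>d>0. \<forall>x. dist x x0 < d \<longrightarrow> dist (g x) (g x0) < \<epsilon>"
      by (intro exI[of _ \<eta>]) (auto simp: dist_real_def)
  qed
  then show ?thesis by (simp add: continuous_at_imp_continuous_on)
qed

lemma sum_abs_eq_signed:
  fixes d :: "nat \<Rightarrow> real"
  shows "(\<Sum>j<m. (if d j \<ge> 0 then 1 else -1) * d j) = (\<Sum>j<m. \<bar>d j\<bar>)"
  by (intro sum.cong) auto

lemma signed_sum_le:
  fixes d \<sigma> :: "nat \<Rightarrow> real"
  assumes "\<And>j. \<bar>\<sigma> j\<bar> = 1"
  shows "\<bar>\<Sum>j<m. \<sigma> j * d j\<bar> \<le> (\<Sum>j<m. \<bar>d j\<bar>)"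
  using sum_abs[of "\<lambda>j. \<sigma> j * d j" "{..<m}"] assms by (simp add: abs_mult)

text \<open>A sum of absolute increments is not linear in the function, so the families contain
  every choice of signs \<open>\<sigma>\<close>. The signs of the increments of g - w recover the
  absolute values at the end.\<close>

lemma difference_property_AC:
  assumes g: "normalized g" and ac: "\<And>h. diff_op h g \<in> AC_space"
  shows "g \<in> AC_space"
  unfolding AC_space_def absolutely_continuous_fun_def
proof (intro CollectI allI impI)
  fix a b \<epsilon> :: real assume ab: "a \<le> b" and \<epsilon>: "\<epsilon> > 0"
  define adm where "adm \<eta> m s t \<longleftrightarrow> (\<forall>i<m. a \<le> s i \<and> s i \<le> t i \<and> t i \<le> b) \<and>
      disjoint_family_on (\<lambda>i. {s i<..<t i}) {..<m} \<and> (\<Sum>i<m. t i - s i) < \<eta>" for \<eta> and m :: nat and s t :: "nat \<Rightarrow> real"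
  define F :: "nat \<Rightarrow> ((real \<Rightarrow> real) \<Rightarrow> real) set" where
    "F i = {(\<lambda>\<phi>. \<Sum>j<m. \<sigma> j * (\<phi> (t j) - \<phi> (s j))) | m s t \<sigma>.
      adm (1 / real (Suc i)) m s t \<and> (\<forall>j. \<bar>\<sigma> j\<bar> = 1)}" for i
  have "\<exists>i c L. \<forall>\<Lambda>\<in>F i. \<bar>\<Lambda> (\<lambda>x. g x - prim (diff_op L g) (c + x) / L)\<bar> \<le> \<epsilon> / 2"
  proof (rule averaging_principle[OF g, of F "\<lambda>_. \<epsilon> / 2"])
    fix i \<Lambda> assume "\<Lambda> \<in> F i"
    then show "difference_functional \<Lambda>"
      by (auto simp: F_def intro!: difference_functional_sum difference_functional.scale difference_functional.pair)
  next
    fix h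
    have "absolutely_continuous_fun (diff_op h g) a b" using ac ab by (simp add: AC_space_def)
    then obtain \<eta> where \<eta>: "\<eta> > 0" "\<And>m s t. adm \<eta> m s t \<Longrightarrow> (\<Sum>j<m. \<bar>diff_op h g (t j) - diff_op h g (s j)\<bar>) < \<epsilon> / 2"
      unfolding absolutely_continuous_fun_def adm_def[symmetric] using \<epsilon> by (meson half_gt_zero)
    obtain i where "1 / real (Suc i) < \<eta>" using nat_inverse_small[OF \<eta>(1)] by blast
    then have adm: "adm \<eta> m s t" if "adm (1 / real (Suc i)) m s t" for m s t
      using that by (auto simp: adm_def)
    have "\<bar>\<Lambda> (diff_op h g)\<bar> \<le> \<epsilon> / 2" if \<Lambda>F: "\<Lambda> \<in> F i" for \<Lambda>
    proof -
      obtain m s t \<sigma> where \<Lambda>: "\<Lambda> = (\<lambda>\<phi>. \<Sum>j<m. \<sigma> j * (\<phi> (t j) - \<phi> (s j)))"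
        "adm (1 / real (Suc i)) m s t" "\<And>j. \<bar>\<sigma> j\<bar> = 1"
        using \<Lambda>F unfolding F_def by blast
      show ?thesis
        using \<eta>(2)[OF adm[OF \<Lambda>(2)]] signed_sum_le[of \<sigma> "\<lambda>j. diff_op h g (t j) - diff_op h g (s j)" m, OF \<Lambda>(3)]
        by (simp add: \<Lambda>(1))
    qed
    then show "\<exists>i. \<forall>\<Lambda>\<in>F i. \<bar>\<Lambda> (diff_op h g)\<bar> \<le> \<epsilon> / 2" by blast
  qed
  then obtain i c L where i: "\<And>\<Lambda>. \<Lambda> \<in> F i \<Longrightarrow> \<bar>\<Lambda> (\<lambda>x. g x - prim (diff_op L g) (c + x) / L)\<bar> \<le> \<epsilon> / 2" by blast
  let ?w = "\<lambda>x. prim (diff_op L g) (c + x) / L"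
  obtain C where C: "C \<ge> 0" "\<And>x y. x \<in> {a..b} \<Longrightarrow> y \<in> {a..b} \<Longrightarrow> \<bar>?w x - ?w y\<bar> \<le> C * \<bar>x - y\<bar>"
    using smoothing_Lipschitz[OF g, of a b] by metis
  define \<eta> where "\<eta> = min (1 / real (Suc i)) (\<epsilon> / (2 * (C + 1)))"
  have "(\<Sum>j<m. \<bar>g (t j) - g (s j)\<bar>) < \<epsilon>" if st: "adm \<eta> m s t" for m s t
  proof -
    have st': "\<And>j. j < m \<Longrightarrow> a \<le> s j \<and> s j \<le> t j \<and> t j \<le> b" "(\<Sum>j<m. t j - s j) < \<eta>"
      using st by (auto simp: adm_def)
    define d where "d j = (g (t j) - ?w (t j)) - (g (s j) - ?w (s j))" for j
    define \<sigma> where "\<sigma> j = (if d j \<ge> 0 then 1 else -1 :: real)" for j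
    have "(\<lambda>\<phi>. \<Sum>j<m. \<sigma> j * (\<phi> (t j) - \<phi> (s j))) \<in> F i"
      using st unfolding F_def by (intro CollectI exI[of _ m] exI[of _ s] exI[of _ t] exI[of _ \<sigma>]) (auto simp: adm_def \<eta>_def \<sigma>_def)
    from i[OF this] have "\<bar>\<Sum>j<m. \<sigma> j * d j\<bar> \<le> \<epsilon> / 2" by (simp add: d_def)
    then have 1: "(\<Sum>j<m. \<bar>d j\<bar>) \<le> \<epsilon> / 2"
      unfolding \<sigma>_def sum_abs_eq_signed by linarith
    have "(\<Sum>j<m. \<bar>?w (t j) - ?w (s j)\<bar>) \<le> (\<Sum>j<m. (C + 1) * (t j - s j))"
    proof (intro sum_mono)
      fix j assume "j \<in> {..<m}"
      then have "\<bar>?w (t j) - ?w (s j)\<bar> \<le> C * \<bar>t j - s j\<bar>" "s j \<le> t j"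
        using st'(1)[of j] C(2)[of "t j" "s j"] by auto
      then show "\<bar>?w (t j) - ?w (s j)\<bar> \<le> (C + 1) * (t j - s j)" by (simp add: algebra_simps)
    qed
    also have "\<dots> = (C + 1) * (\<Sum>j<m. t j - s j)" by (simp add: sum_distrib_left)
    also have "\<dots> < \<epsilon> / 2" using st'(2) C(1) by (simp add: \<eta>_def field_simps)
    finally have 2: "(\<Sum>j<m. \<bar>?w (t j) - ?w (s j)\<bar>) < \<epsilon> / 2" .
    have "(\<Sum>j<m. \<bar>g (t j) - g (s j)\<bar>) \<le> (\<Sum>j<m. \<bar>d j\<bar> + \<bar>?w (t j) - ?w (s j)\<bar>)"
    proof (intro sum_mono)
      fix j
      show "\<bar>g (t j) - g (s j)\<bar> \<le> \<bar>d j\<bar> + \<bar>?w (t j) - ?w (s j)\<bar>" unfolding d_def by arith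
    qed
    then show ?thesis using 1 2 by (simp add: sum.distrib)
  qed
  moreover have "\<eta> > 0" using \<epsilon> C(1) by (simp add: \<eta>_def)
  ultimately show "\<exists>\<eta>>0. \<forall>(m::nat) s t. (\<forall>i<m. a \<le> s i \<and> s i \<le> t i \<and> t i \<le> b) \<and>
      disjoint_family_on (\<lambda>i. {s i<..<t i}) {..<m} \<and> (\<Sum>i<m. t i - s i) < \<eta> \<longrightarrow>
      (\<Sum>i<m. \<bar>g (t i) - g (s i)\<bar>) < \<epsilon>"
    unfolding adm_def by blast
qed

lemma chain_mono:
  fixes x :: "nat \<Rightarrow> real"
  assumes "\<forall>i<m. x i \<le> x (Suc i)" "i \<le> j" "j \<le> m"
  shows "x i \<le> x j"
  using assms(2,3)
proof (induction j rule: dec_induct)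
  case (step n)
  then show ?case using assms(1)[rule_format, of n] by simp
qed simp

text \<open>The family does not depend on the index; only the bound \<open>real i\<close> does. The
  variation of each difference is finite but depends on \<open>h\<close>, and the averaging
  principle fixes one level for all chains at once.\<close>

lemma difference_property_BV:
  assumes g: "normalized g" and bv: "\<And>h. diff_op h g \<in> BV_space"
  shows "g \<in> BV_space"
  unfolding BV_space_def bounded_variation_fun_def
proof (intro CollectI allI impI)
  fix a b :: real assume ab: "a \<le> b"
  define adm where "adm m x \<longleftrightarrow> x 0 = a \<and> x m = b \<and> (\<forall>i<m. x i \<le> x (Suc i))" for m :: nat and x :: "nat \<Rightarrow> real"
  define F :: "nat \<Rightarrow> ((real \<Rightarrow> real) \<Rightarrow> real) set" where
    "F i = {(\<lambda>\<phi>. \<Sum>j<m. \<sigma> j * (\<phi> (x (Suc j)) - \<phi> (x j))) | m x \<sigma>. adm m x \<and> (\<forall>j. \<bar>\<sigma> j\<bar> = 1)}" for i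
  have "\<exists>i c L. \<forall>\<Lambda>\<in>F i. \<bar>\<Lambda> (\<lambda>x. g x - prim (diff_op L g) (c + x) / L)\<bar> \<le> real i"
  proof (rule averaging_principle[OF g, of F real])
    fix i \<Lambda> assume "\<Lambda> \<in> F i"
    then show "difference_functional \<Lambda>"
      by (auto simp: F_def intro!: difference_functional_sum difference_functional.scale difference_functional.pair)
  next
    fix h
    have "bounded_variation_fun (diff_op h g) a b" using bv ab by (simp add: BV_space_def)
    then obtain V where V: "\<And>m x. adm m x \<Longrightarrow> (\<Sum>j<m. \<bar>diff_op h g (x (Suc j)) - diff_op h g (x j)\<bar>) \<le> V"
      unfolding bounded_variation_fun_def adm_def[symmetric] by blast
    obtain i where "V \<le> real i" using real_arch_simple by blast
    have "\<bar>\<Lambda> (diff_op h g)\<bar> \<le> real i" if "\<Lambda> \<in> F i" for \<Lambda>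
    proof -
      obtain m x \<sigma> where \<Lambda>: "\<Lambda> = (\<lambda>\<phi>. \<Sum>j<m. \<sigma> j * (\<phi> (x (Suc j)) - \<phi> (x j)))"
        "adm m x" "\<And>j. \<bar>\<sigma> j\<bar> = 1"
        using \<open>\<Lambda> \<in> F i\<close> by (auto simp: F_def)
      show ?thesis
        using V[OF \<Lambda>(2)] \<open>V \<le> real i\<close>
          signed_sum_le[of \<sigma> "\<lambda>j. diff_op h g (x (Suc j)) - diff_op h g (x j)" m, OF \<Lambda>(3)]
        by (simp add: \<Lambda>(1))
    qed
    then show "\<exists>i. \<forall>\<Lambda>\<in>F i. \<bar>\<Lambda> (diff_op h g)\<bar> \<le> real i" by blast
  qed
  then obtain i c L where i: "\<And>\<Lambda>. \<Lambda> \<in> F i \<Longrightarrow> \<bar>\<Lambda> (\<lambda>x. g x - prim (diff_op L g) (c + x) / L)\<bar> \<le> real i" by blast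
  let ?w = "\<lambda>x. prim (diff_op L g) (c + x) / L"
  obtain C where C: "C \<ge> 0" "\<And>x y. x \<in> {a..b} \<Longrightarrow> y \<in> {a..b} \<Longrightarrow> \<bar>?w x - ?w y\<bar> \<le> C * \<bar>x - y\<bar>"
    using smoothing_Lipschitz[OF g, of a b] by metis
  have "(\<Sum>j<m. \<bar>g (x (Suc j)) - g (x j)\<bar>) \<le> real i + C * (b - a)" if x: "adm m x" for m x
  proof -
    have x': "x 0 = a" "x m = b" "\<forall>i<m. x i \<le> x (Suc i)" using x by (auto simp: adm_def)
    define d where "d j = (g (x (Suc j)) - ?w (x (Suc j))) - (g (x j) - ?w (x j))" for j
    define \<sigma> where "\<sigma> j = (if d j \<ge> 0 then 1 else -1 :: real)" for j
    have "(\<lambda>\<phi>. \<Sum>j<m. \<sigma> j * (\<phi> (x (Suc j)) - \<phi> (x j))) \<in> F i"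
      using x unfolding F_def by (intro CollectI exI[of _ m] exI[of _ x] exI[of _ \<sigma>]) (auto simp: \<sigma>_def)
    from i[OF this] have "\<bar>\<Sum>j<m. \<sigma> j * d j\<bar> \<le> real i" by (simp add: d_def)
    then have 1: "(\<Sum>j<m. \<bar>d j\<bar>) \<le> real i"
      unfolding \<sigma>_def sum_abs_eq_signed by linarith
    have "(\<Sum>j<m. \<bar>?w (x (Suc j)) - ?w (x j)\<bar>) \<le> (\<Sum>j<m. C * (x (Suc j) - x j))"
    proof (intro sum_mono)
      fix j assume j: "j \<in> {..<m}"
      then have "x 0 \<le> x j" "x j \<le> x (Suc j)" "x (Suc j) \<le> x m"
        using chain_mono[OF x'(3)] by auto
      then show "\<bar>?w (x (Suc j)) - ?w (x j)\<bar> \<le> C * (x (Suc j) - x j)"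
        using C(2)[of "x (Suc j)" "x j"] x'(1,2) by simp
    qed
    also have "\<dots> = C * (b - a)"
      using sum_lessThan_telescope[of x m] x'(1,2) by (simp add: sum_distrib_left[symmetric])
    finally have 2: "(\<Sum>j<m. \<bar>?w (x (Suc j)) - ?w (x j)\<bar>) \<le> C * (b - a)" .
    have "(\<Sum>j<m. \<bar>g (x (Suc j)) - g (x j)\<bar>) \<le> (\<Sum>j<m. \<bar>d j\<bar> + \<bar>?w (x (Suc j)) - ?w (x j)\<bar>)"
    proof (intro sum_mono)
      fix j
      show "\<bar>g (x (Suc j)) - g (x j)\<bar> \<le> \<bar>d j\<bar> + \<bar>?w (x (Suc j)) - ?w (x j)\<bar>" unfolding d_def by arith
    qed
    then show ?thesis using 1 2 by (simp add: sum.distrib)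
  qed
  then show "\<exists>V. \<forall>(m::nat) x. x 0 = a \<and> x m = b \<and> (\<forall>i<m. x i \<le> x (Suc i)) \<longrightarrow>
      (\<Sum>i<m. \<bar>g (x (Suc i)) - g (x i)\<bar>) \<le> V"
    unfolding adm_def by blast
qed

text \<open>It lets a derivative be produced without a candidate value: the difference of two
  difference quotients is a difference functional.\<close>

lemma real_lim_Cauchy:
  fixes q :: "real \<Rightarrow> real"
  assumes "\<And>\<epsilon>. \<epsilon> > 0 \<Longrightarrow> \<exists>\<delta>>0. \<forall>s t. 0 < \<bar>s\<bar> \<longrightarrow> \<bar>s\<bar> < \<delta> \<longrightarrow> 0 < \<bar>t\<bar> \<longrightarrow> \<bar>t\<bar> < \<delta> \<longrightarrow> \<bar>q s - q t\<bar> < \<epsilon>"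
  shows "\<exists>D. (q \<longlongrightarrow> D) (at 0)"
proof -
  define s where "s n = 1 / real (Suc n)" for n :: nat
  have s0: "s n > 0" for n by (simp add: s_def)
  have s: "\<exists>N. \<forall>n\<ge>N. s n < \<delta>" if \<delta>: "\<delta> > 0" for \<delta>
  proof -
    obtain N where N: "1 / real (Suc N) < \<delta>" using nat_inverse_small[OF \<delta>] by blast
    have "s n < \<delta>" if n: "n \<ge> N" for n
    proof -
      have "s n \<le> 1 / real (Suc N)" unfolding s_def using n by (intro divide_left_mono) auto
      then show ?thesis using N by simp
    qed
    then show ?thesis by blast
  qed
  have "Cauchy (\<lambda>n. q (s n))"
  proof (rule metric_CauchyI)
    fix e :: real assume "e > 0"
    from assms[OF this] obtain \<delta> where \<delta>: "\<delta> > 0"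
      "\<And>s t. 0 < \<bar>s\<bar> \<Longrightarrow> \<bar>s\<bar> < \<delta> \<Longrightarrow> 0 < \<bar>t\<bar> \<Longrightarrow> \<bar>t\<bar> < \<delta> \<Longrightarrow> \<bar>q s - q t\<bar> < e" by blast
    obtain N where N: "\<And>n. n \<ge> N \<Longrightarrow> s n < \<delta>" using s[OF \<delta>(1)] by blast
    have "dist (q (s m)) (q (s n)) < e" if "m \<ge> N" "n \<ge> N" for m n
      using \<delta>(2)[of "s m" "s n"] N[OF that(1)] N[OF that(2)] s0[of m] s0[of n] by (simp add: dist_real_def)
    then show "\<exists>M. \<forall>m\<ge>M. \<forall>n\<ge>M. dist (q (s m)) (q (s n)) < e" by blast
  qed
  then obtain D where D: "(\<lambda>n. q (s n)) \<longlonglongrightarrow> D" using Cauchy_convergent convergent_def by blast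
  have "(q \<longlongrightarrow> D) (at 0)"
  proof (rule LIM_I)
    fix e :: real assume "e > 0"
    then have e: "e / 2 > 0" by simp
    from assms[OF this] obtain \<delta> where \<delta>: "\<delta> > 0"
      "\<And>s t. 0 < \<bar>s\<bar> \<Longrightarrow> \<bar>s\<bar> < \<delta> \<Longrightarrow> 0 < \<bar>t\<bar> \<Longrightarrow> \<bar>t\<bar> < \<delta> \<Longrightarrow> \<bar>q s - q t\<bar> < e / 2" by blast
    obtain N where N: "\<And>n. n \<ge> N \<Longrightarrow> s n < \<delta>" using s[OF \<delta>(1)] by blast
    obtain N' where N': "\<And>n. n \<ge> N' \<Longrightarrow> \<bar>q (s n) - D\<bar> < e / 2" using LIMSEQ_D[OF D e] by auto
    define n where "n = max N N'"
    have "\<bar>q x - D\<bar> < e" if "0 < \<bar>x\<bar>" "\<bar>x\<bar> < \<delta>" for x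
    proof -
      have "N \<le> n" "N' \<le> n" by (auto simp: n_def)
      then have "\<bar>q x - q (s n)\<bar> < e / 2" "\<bar>q (s n) - D\<bar> < e / 2"
        using \<delta>(2)[of x "s n", OF that] N[of n] N'[of n] s0[of n] by auto
      then show ?thesis by linarith
    qed
    then show "\<exists>d>0. \<forall>x. x \<noteq> 0 \<and> norm (x - 0) < d \<longrightarrow> norm (q x - D) < e"
      using \<delta>(1) by auto
  qed
  then show ?thesis by blast
qed

text \<open>A Lipschitz average would not be enough here, since its difference quotients need not
  converge. The differences of \<open>g\<close> are continuous, so the average is a primitive of a
  continuous function and is differentiable.\<close>

lemma difference_property_differentiable:
  assumes g: "normalized g" and diff: "\<And>h x. diff_op h g field_differentiable at x"
  shows "g field_differentiable at x0"
proof -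
  define q where "q \<phi> s = (\<phi> (x0 + s) - \<phi> x0) / s" for \<phi> :: "real \<Rightarrow> real" and s
  have limit_bound: "\<exists>\<delta>>0. \<forall>s t. 0 < \<bar>s\<bar> \<longrightarrow> \<bar>s\<bar> < \<delta> \<longrightarrow> 0 < \<bar>t\<bar> \<longrightarrow> \<bar>t\<bar> < \<delta> \<longrightarrow> \<bar>q \<phi> s - q \<phi> t\<bar> < \<epsilon>"
    if \<phi>: "\<phi> field_differentiable at x0" and \<epsilon>: "\<epsilon> > 0" for \<phi> \<epsilon>
  proof -
    obtain D where "DERIV \<phi> x0 :> D" using \<phi> by (auto simp: field_differentiable_def)
    then have "(q \<phi> \<longlongrightarrow> D) (at 0)" by (simp add: DERIV_def q_def[abs_def])
    then obtain \<delta> where \<delta>: "\<delta> > 0" "\<And>s. s \<noteq> 0 \<Longrightarrow> \<bar>s\<bar> < \<delta> \<Longrightarrow> \<bar>q \<phi> s - D\<bar> < \<epsilon> / 2"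
      using LIM_D[of "q \<phi>" D 0 "\<epsilon> / 2"] \<epsilon> by auto
    have "\<bar>q \<phi> s - q \<phi> t\<bar> < \<epsilon>" if "0 < \<bar>s\<bar>" "\<bar>s\<bar> < \<delta>" "0 < \<bar>t\<bar>" "\<bar>t\<bar> < \<delta>" for s t
      using \<delta>(2)[of s] \<delta>(2)[of t] that by linarith
    then show ?thesis using \<delta>(1) by blast
  qed
  have cont: "continuous_on UNIV (diff_op h g)" for h
    using diff field_differentiable_imp_continuous_at by (blast intro: continuous_at_imp_continuous_on)
  have "\<exists>D. (q g \<longlongrightarrow> D) (at 0)"
  proof (rule real_lim_Cauchy)
    fix \<epsilon> :: real assume \<epsilon>: "\<epsilon> > 0"
    define F where "F i = {(\<lambda>\<phi>. q \<phi> s - q \<phi> t) | s t.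
      0 < \<bar>s\<bar> \<and> \<bar>s\<bar> < 1 / real (Suc i) \<and> 0 < \<bar>t\<bar> \<and> \<bar>t\<bar> < 1 / real (Suc i)}" for i
    have "\<exists>i a L. \<forall>\<Lambda>\<in>F i. \<bar>\<Lambda> (\<lambda>x. g x - prim (diff_op L g) (a + x) / L)\<bar> \<le> \<epsilon> / 2"
    proof (rule averaging_principle[OF g, of F "\<lambda>_. \<epsilon> / 2"])
      fix i \<Lambda> assume "\<Lambda> \<in> F i"
      then obtain s t where "\<Lambda> = (\<lambda>\<phi>. q \<phi> s - q \<phi> t)" by (auto simp: F_def)
      then have "\<Lambda> = (\<lambda>\<phi>. inverse s * (\<phi> (x0 + s) - \<phi> x0) + (- inverse t) * (\<phi> (x0 + t) - \<phi> x0))"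
        by (auto simp: q_def divide_inverse algebra_simps)
      then show "difference_functional \<Lambda>"
        by (simp only:) (intro difference_functional.plus difference_functional.scale difference_functional.pair)
    next
      fix h
      obtain \<delta> where \<delta>: "\<delta> > 0" "\<And>s t. 0 < \<bar>s\<bar> \<Longrightarrow> \<bar>s\<bar> < \<delta> \<Longrightarrow> 0 < \<bar>t\<bar> \<Longrightarrow> \<bar>t\<bar> < \<delta> \<Longrightarrow>
          \<bar>q (diff_op h g) s - q (diff_op h g) t\<bar> < \<epsilon> / 2"
        using limit_bound[OF diff, of "\<epsilon> / 2" h] \<epsilon> by (metis half_gt_zero)
      obtain i where "1 / real (Suc i) < \<delta>" using nat_inverse_small[OF \<delta>(1)] by blast
      then have "\<bar>q (diff_op h g) s - q (diff_op h g) t\<bar> \<le> \<epsilon> / 2"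
        if "0 < \<bar>s\<bar>" "\<bar>s\<bar> < 1 / real (Suc i)" "0 < \<bar>t\<bar>" "\<bar>t\<bar> < 1 / real (Suc i)" for s t
        using \<delta>(2)[of s t] that by linarith
      then show "\<exists>i. \<forall>\<Lambda>\<in>F i. \<bar>\<Lambda> (diff_op h g)\<bar> \<le> \<epsilon> / 2"
        unfolding F_def by blast
    qed
    then obtain i a L where i: "\<And>\<Lambda>. \<Lambda> \<in> F i \<Longrightarrow> \<bar>\<Lambda> (\<lambda>x. g x - prim (diff_op L g) (a + x) / L)\<bar> \<le> \<epsilon> / 2" by blast
    let ?w = "\<lambda>x. prim (diff_op L g) (a + x) / L"
    have "(prim (diff_op L g) has_real_derivative diff_op L g (a + x0)) (at (a + x0))"
      by (rule prim_has_derivative[OF cont])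
    then have "((\<lambda>x. prim (diff_op L g) (a + x)) has_real_derivative diff_op L g (a + x0)) (at x0)"
      using DERIV_shift[of "prim (diff_op L g)" _ x0 a] by (simp add: add.commute)
    then have "?w field_differentiable at x0"
      by (auto simp: field_differentiable_def intro: DERIV_cdivide)
    then obtain \<delta> where \<delta>: "\<delta> > 0" "\<And>s t. 0 < \<bar>s\<bar> \<Longrightarrow> \<bar>s\<bar> < \<delta> \<Longrightarrow> 0 < \<bar>t\<bar> \<Longrightarrow> \<bar>t\<bar> < \<delta> \<Longrightarrow>
          \<bar>q ?w s - q ?w t\<bar> < \<epsilon> / 2"
      using limit_bound[of ?w "\<epsilon> / 2"] \<epsilon> by (metis half_gt_zero)
    have "\<bar>q g s - q g t\<bar> < \<epsilon>"
      if st: "0 < \<bar>s\<bar>" "\<bar>s\<bar> < min \<delta> (1 / real (Suc i))" "0 < \<bar>t\<bar>" "\<bar>t\<bar> < min \<delta> (1 / real (Suc i))" for s t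
    proof -
      have "(\<lambda>\<phi>. q \<phi> s - q \<phi> t) \<in> F i" using st by (auto simp: F_def)
      from i[OF this] have "\<bar>q (\<lambda>x. g x - ?w x) s - q (\<lambda>x. g x - ?w x) t\<bar> \<le> \<epsilon> / 2" .
      moreover have "q (\<lambda>x. g x - ?w x) s = q g s - q ?w s" "q (\<lambda>x. g x - ?w x) t = q g t - q ?w t"
        by (simp_all add: q_def diff_divide_distrib)
      moreover have "\<bar>q ?w s - q ?w t\<bar> < \<epsilon> / 2" using \<delta>(2)[of s t] st by auto
      ultimately show ?thesis by linarith
    qed
    then show "\<exists>\<delta>>0. \<forall>s t. 0 < \<bar>s\<bar> \<longrightarrow> \<bar>s\<bar> < \<delta> \<longrightarrow> 0 < \<bar>t\<bar> \<longrightarrow> \<bar>t\<bar> < \<delta> \<longrightarrow> \<bar>q g s - q g t\<bar> < \<epsilon>"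
      using \<delta>(1) by (intro exI[of _ "min \<delta> (1 / real (Suc i))"]) auto
  qed
  then show ?thesis by (auto simp: field_differentiable_def DERIV_def q_def[abs_def])
qed

section \<open>Smooth and analytic functions\<close>

lemma D_space_mono: "f \<in> D_space k \<Longrightarrow> j \<le> k \<Longrightarrow> f \<in> D_space j"
  by (auto simp: D_space_def)

lemma D_space_DERIV:
  assumes "f \<in> D_space k" "j < k"
  shows "((deriv ^^ j) f has_real_derivative (deriv ^^ Suc j) f x) (at x)"
  using assms by (simp add: D_space_def DERIV_deriv_iff_field_differentiable)

lemma D_space_Suc:
  "f \<in> D_space (Suc k) \<longleftrightarrow> (\<forall>x. f field_differentiable at x) \<and> deriv f \<in> D_space k"
  by (simp add: D_space_def All_less_Suc2 funpow_Suc_right del: funpow.simps(2))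

lemma C_space_Suc:
  "f \<in> C_space (Suc k) \<longleftrightarrow> (\<forall>x. f field_differentiable at x) \<and> deriv f \<in> C_space k"
  by (simp add: C_space_def D_space_Suc funpow_Suc_right conj_assoc del: funpow.simps(2))

lemma deriv_funpow_combination:
  assumes "f \<in> D_space k" "g \<in> D_space k"
  shows "(deriv ^^ k) (\<lambda>x. f (x + h) + c * g x) = (\<lambda>x. (deriv ^^ k) f (x + h) + c * (deriv ^^ k) g x)"
  using assms
proof (induction k)
  case (Suc k)
  have "((\<lambda>x. (deriv ^^ k) f (x + h) + c * (deriv ^^ k) g x) has_real_derivative
      (deriv ^^ Suc k) f (x + h) + c * (deriv ^^ Suc k) g x) (at x)" for x
    using D_space_DERIV[OF Suc.prems(1), of k "x + h"] D_space_DERIV[OF Suc.prems(2), of k x]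
    by (intro DERIV_add DERIV_cmult) (simp_all add: DERIV_shift)
  then show ?case
    using Suc.IH D_space_mono[OF Suc.prems(1), of k] D_space_mono[OF Suc.prems(2), of k]
    by (auto intro!: DERIV_imp_deriv)
qed simp

lemma deriv_funpow_diff_op:
  assumes "f \<in> D_space k"
  shows "(deriv ^^ k) (diff_op h f) x = (deriv ^^ k) f (x + h) - (deriv ^^ k) f x"
  using deriv_funpow_combination[OF assms assms, of h "-1"] by (simp add: diff_op_def)

section \<open>Closure of the function classes under translations and linear combinations\<close>

text \<open>One condition bundles translation, addition and scaling: h = 0 or c = 1 gives the pure
  sum, and c = -1 with g = f gives the difference operator.\<close>

definition combination_closed :: "(real \<Rightarrow> real) set \<Rightarrow> bool" where
  "combination_closed X \<longleftrightarrow>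
     (\<forall>f\<in>X. \<forall>g\<in>X. \<forall>h c. (\<lambda>x. f (x + h) + c * g x) \<in> X) \<and> (\<forall>c. (\<lambda>_. c) \<in> X)"

lemma combination_closedD:
  assumes "combination_closed X" "f \<in> X" "g \<in> X"
  shows "(\<lambda>x. f (x + h) + c * g x) \<in> X"
  using assms by (simp add: combination_closed_def)

lemma deriv_const_funpow: "(deriv ^^ j) (\<lambda>_. c :: real) = (\<lambda>_. if j = 0 then c else 0)"
  by (induction j) auto

lemma combination_closed_D_space: "combination_closed (D_space k)"
  unfolding combination_closed_def
proof (intro conjI ballI allI)
  fix f g h c assume fg: "f \<in> D_space k" "g \<in> D_space k"
  show "(\<lambda>x. f (x + h) + c * g x) \<in> D_space k"
    unfolding D_space_def
  proof (intro CollectI allI impI)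
    fix j x assume "j < k"
    then have "((\<lambda>x. (deriv ^^ j) f (x + h) + c * (deriv ^^ j) g x) has_real_derivative
        (deriv ^^ Suc j) f (x + h) + c * (deriv ^^ Suc j) g x) (at x)"
      using D_space_DERIV[OF fg(1), of j "x + h"] D_space_DERIV[OF fg(2), of j x]
      by (intro DERIV_add DERIV_cmult) (simp_all add: DERIV_shift)
    moreover have "f \<in> D_space j" "g \<in> D_space j" using fg \<open>j < k\<close> D_space_mono less_imp_le by metis+
    ultimately show "(deriv ^^ j) (\<lambda>x. f (x + h) + c * g x) field_differentiable at x"
      unfolding deriv_funpow_combination[OF \<open>f \<in> D_space j\<close> \<open>g \<in> D_space j\<close>]
      by (auto simp: field_differentiable_def)
  qed
qed (simp add: D_space_def deriv_const_funpow)

lemma combination_closed_C_space: "combination_closed (C_space k)"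
  unfolding combination_closed_def
proof (intro conjI ballI allI)
  fix f g h c assume fg: "f \<in> C_space k" "g \<in> C_space k"
  then have D: "f \<in> D_space k" "g \<in> D_space k" by (simp_all add: C_space_def)
  have "continuous_on UNIV (\<lambda>x. (deriv ^^ k) f (x + h) + c * (deriv ^^ k) g x)"
  proof (intro continuous_on_add continuous_on_mult continuous_on_const)
    have "continuous_on UNIV (\<lambda>x. x + h)" by (intro continuous_intros)
    then show "continuous_on UNIV (\<lambda>x. (deriv ^^ k) f (x + h))"
      using continuous_on_compose2[of UNIV "(deriv ^^ k) f" UNIV "\<lambda>x. x + h"] fg by (simp add: C_space_def)
  qed (use fg in \<open>simp add: C_space_def\<close>)
  moreover have "(\<lambda>x. f (x + h) + c * g x) \<in> D_space k"
    using combination_closed_D_space D by (simp add: combination_closed_def)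
  ultimately show "(\<lambda>x. f (x + h) + c * g x) \<in> C_space k"
    unfolding C_space_def by (simp add: deriv_funpow_combination[OF D])
next
  fix c :: real
  show "(\<lambda>_. c) \<in> C_space k"
    using combination_closed_D_space by (simp add: C_space_def combination_closed_def deriv_const_funpow)
qed

lemma combination_closed_R_space: "combination_closed R_space"
  unfolding combination_closed_def
  using R_space_plus[OF R_space_translate R_space_cmult] R_space_continuous[OF continuous_on_const]
  by blast

lemma combination_closed_AC_space: "combination_closed AC_space"
  unfolding combination_closed_def
proof (intro conjI ballI allI)
  fix f g h c assume fg: "f \<in> AC_space" "g \<in> AC_space"
  show "(\<lambda>x. f (x + h) + c * g x) \<in> AC_space"
    unfolding AC_space_def
  proof (intro CollectI allI impI)
    fix a b :: real assume ab: "a \<le> b"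
    show "absolutely_continuous_fun (\<lambda>x. f (x + h) + c * g x) a b"
      unfolding absolutely_continuous_fun_def
    proof (intro allI impI)
      fix e :: real assume e: "e > 0"
      have ac: "absolutely_continuous_fun f (a + h) (b + h)" "absolutely_continuous_fun g a b"
        using fg ab by (auto simp: AC_space_def)
      \<comment> \<open>The summand 1 keeps the denominator positive when c = 0.\<close>
      have pos: "e / 2 > 0" "e / (2 * (\<bar>c\<bar> + 1)) > 0" using e by auto
      obtain \<eta>1 where \<eta>1: "\<eta>1 > 0" "\<And>(m::nat) s t.
        (\<forall>i<m. a + h \<le> s i \<and> s i \<le> t i \<and> t i \<le> b + h) \<and> disjoint_family_on (\<lambda>i. {s i<..<t i}) {..<m} \<and>
        (\<Sum>i<m. t i - s i) < \<eta>1 \<Longrightarrow> (\<Sum>i<m. \<bar>f (t i) - f (s i)\<bar>) < e / 2"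
        using ac(1)[unfolded absolutely_continuous_fun_def, rule_format, OF pos(1)] by blast
      obtain \<eta>2 where \<eta>2: "\<eta>2 > 0" "\<And>(m::nat) s t.
        (\<forall>i<m. a \<le> s i \<and> s i \<le> t i \<and> t i \<le> b) \<and> disjoint_family_on (\<lambda>i. {s i<..<t i}) {..<m} \<and>
        (\<Sum>i<m. t i - s i) < \<eta>2 \<Longrightarrow> (\<Sum>i<m. \<bar>g (t i) - g (s i)\<bar>) < e / (2 * (\<bar>c\<bar> + 1))"
        using ac(2)[unfolded absolutely_continuous_fun_def, rule_format, OF pos(2)] by blast
      have "(\<Sum>i<m. \<bar>(f (t i + h) + c * g (t i)) - (f (s i + h) + c * g (s i))\<bar>) < e"
        if st: "(\<forall>i<m. a \<le> s i \<and> s i \<le> t i \<and> t i \<le> b) \<and> disjoint_family_on (\<lambda>i. {s i<..<t i}) {..<m} \<and>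
          (\<Sum>i<m. t i - s i) < min \<eta>1 \<eta>2" for m :: nat and s t
      proof -
        have "disjoint_family_on (\<lambda>i. {s i + h<..<t i + h}) {..<m}"
          unfolding disjoint_family_on_def
        proof (intro ballI impI)
          fix i j assume "i \<in> {..<m}" "j \<in> {..<m}" "i \<noteq> j"
          then have disj: "{s i<..<t i} \<inter> {s j<..<t j} = {}"
            using st by (auto simp: disjoint_family_on_def)
          show "{s i + h<..<t i + h} \<inter> {s j + h<..<t j + h} = {}"
          proof (rule ccontr)
            assume "\<not> ?thesis"
            then obtain y where "y \<in> {s i + h<..<t i + h} \<inter> {s j + h<..<t j + h}" by blast
            then have "y - h \<in> {s i<..<t i} \<inter> {s j<..<t j}" by auto
            then show False using disj by blast
          qed
        qed
        then have 1: "(\<Sum>i<m. \<bar>f (t i + h) - f (s i + h)\<bar>) < e / 2"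
          using st by (intro \<eta>1(2)) auto
        have 2: "(\<Sum>i<m. \<bar>g (t i) - g (s i)\<bar>) < e / (2 * (\<bar>c\<bar> + 1))"
          using st by (intro \<eta>2(2)) auto
        have "(\<Sum>i<m. \<bar>(f (t i + h) + c * g (t i)) - (f (s i + h) + c * g (s i))\<bar>) \<le>
            (\<Sum>i<m. \<bar>f (t i + h) - f (s i + h)\<bar> + (\<bar>c\<bar> + 1) * \<bar>g (t i) - g (s i)\<bar>)"
        proof (intro sum_mono)
          fix i
          have "\<bar>c * (g (t i) - g (s i))\<bar> \<le> (\<bar>c\<bar> + 1) * \<bar>g (t i) - g (s i)\<bar>"
            by (simp add: abs_mult mult_right_mono)
          moreover have "c * (g (t i) - g (s i)) = c * g (t i) - c * g (s i)" by (rule right_diff_distrib)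
          ultimately show "\<bar>(f (t i + h) + c * g (t i)) - (f (s i + h) + c * g (s i))\<bar> \<le>
            \<bar>f (t i + h) - f (s i + h)\<bar> + (\<bar>c\<bar> + 1) * \<bar>g (t i) - g (s i)\<bar>" by linarith
        qed
        also have "\<dots> = (\<Sum>i<m. \<bar>f (t i + h) - f (s i + h)\<bar>) + (\<bar>c\<bar> + 1) * (\<Sum>i<m. \<bar>g (t i) - g (s i)\<bar>)"
          by (simp add: sum.distrib sum_distrib_left)
        also have "(\<bar>c\<bar> + 1) * (\<Sum>i<m. \<bar>g (t i) - g (s i)\<bar>) < (\<bar>c\<bar> + 1) * (e / (2 * (\<bar>c\<bar> + 1)))"
          using 2 by (intro mult_strict_left_mono) auto
        also have "(\<bar>c\<bar> + 1) * (e / (2 * (\<bar>c\<bar> + 1))) = e / 2"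
          using abs_ge_zero[of c] by (simp add: field_simps add_nonneg_eq_0_iff)
        finally show ?thesis using 1 by linarith
      qed
      then show "\<exists>\<eta>>0. \<forall>(m::nat) s t. (\<forall>i<m. a \<le> s i \<and> s i \<le> t i \<and> t i \<le> b) \<and>
          disjoint_family_on (\<lambda>i. {s i<..<t i}) {..<m} \<and> (\<Sum>i<m. t i - s i) < \<eta> \<longrightarrow>
          (\<Sum>i<m. \<bar>(f (t i + h) + c * g (t i)) - (f (s i + h) + c * g (s i))\<bar>) < e"
        using \<eta>1(1) \<eta>2(1) by (intro exI[of _ "min \<eta>1 \<eta>2"]) auto
    qed
  qed
next
  fix c :: real
  show "(\<lambda>_. c) \<in> AC_space"
    by (auto simp: AC_space_def absolutely_continuous_fun_def intro: exI[of _ 1])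
qed

lemma combination_closed_BV_space: "combination_closed BV_space"
  unfolding combination_closed_def
proof (intro conjI ballI allI)
  fix f g h c assume fg: "f \<in> BV_space" "g \<in> BV_space"
  show "(\<lambda>x. f (x + h) + c * g x) \<in> BV_space"
    unfolding BV_space_def
  proof (intro CollectI allI impI)
    fix a b :: real assume ab: "a \<le> b"
    have "bounded_variation_fun f (a + h) (b + h)" "bounded_variation_fun g a b"
      using fg ab by (auto simp: BV_space_def)
    then obtain V W where V: "\<And>(m::nat) x. x 0 = a + h \<and> x m = b + h \<and> (\<forall>i<m. x i \<le> x (Suc i)) \<Longrightarrow>
        (\<Sum>i<m. \<bar>f (x (Suc i)) - f (x i)\<bar>) \<le> V"
      and W: "\<And>(m::nat) x. x 0 = a \<and> x m = b \<and> (\<forall>i<m. x i \<le> x (Suc i)) \<Longrightarrow>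
        (\<Sum>i<m. \<bar>g (x (Suc i)) - g (x i)\<bar>) \<le> W"
      unfolding bounded_variation_fun_def by blast
    have "(\<Sum>i<m. \<bar>(f (x (Suc i) + h) + c * g (x (Suc i))) - (f (x i + h) + c * g (x i))\<bar>) \<le> V + \<bar>c\<bar> * W"
      if x: "x 0 = a \<and> x m = b \<and> (\<forall>i<m. x i \<le> x (Suc i))" for m :: nat and x
    proof -
      have "(\<Sum>i<m. \<bar>(f (x (Suc i) + h) + c * g (x (Suc i))) - (f (x i + h) + c * g (x i))\<bar>) \<le>
          (\<Sum>i<m. \<bar>f (x (Suc i) + h) - f (x i + h)\<bar> + \<bar>c\<bar> * \<bar>g (x (Suc i)) - g (x i)\<bar>)"
      proof (intro sum_mono)
        fix i
        have "\<bar>c * (g (x (Suc i)) - g (x i))\<bar> = \<bar>c\<bar> * \<bar>g (x (Suc i)) - g (x i)\<bar>" by (rule abs_mult)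
        moreover have "c * (g (x (Suc i)) - g (x i)) = c * g (x (Suc i)) - c * g (x i)" by (rule right_diff_distrib)
        ultimately show "\<bar>(f (x (Suc i) + h) + c * g (x (Suc i))) - (f (x i + h) + c * g (x i))\<bar> \<le>
          \<bar>f (x (Suc i) + h) - f (x i + h)\<bar> + \<bar>c\<bar> * \<bar>g (x (Suc i)) - g (x i)\<bar>" by linarith
      qed
      also have "\<dots> = (\<Sum>i<m. \<bar>f (x (Suc i) + h) - f (x i + h)\<bar>) + \<bar>c\<bar> * (\<Sum>i<m. \<bar>g (x (Suc i)) - g (x i)\<bar>)"
        by (simp add: sum.distrib sum_distrib_left)
      also have "\<dots> \<le> V + \<bar>c\<bar> * W"
        using x by (intro add_mono mult_left_mono V[of "\<lambda>i. x i + h"] W) auto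
      finally show ?thesis .
    qed
    then show "bounded_variation_fun (\<lambda>x. f (x + h) + c * g x) a b"
      unfolding bounded_variation_fun_def by blast
  qed
next
  fix c :: real
  show "(\<lambda>_. c) \<in> BV_space"
    by (auto simp: BV_space_def bounded_variation_fun_def)
qed

lemma combination_closed_C_omega_space: "combination_closed C_omega_space"
  unfolding combination_closed_def
proof (intro conjI ballI allI)
  fix f g h k assume fg: "f \<in> C_omega_space" "g \<in> C_omega_space"
  show "(\<lambda>x. f (x + h) + k * g x) \<in> C_omega_space"
    unfolding C_omega_space_def
  proof (intro CollectI allI)
    fix x
    obtain r c where r: "r > 0" "\<And>y. \<bar>y - (x + h)\<bar> < r \<Longrightarrow> (\<lambda>i. c i * (y - (x + h)) ^ i) sums f y"
      using fg(1) unfolding C_omega_space_def by blast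
    obtain s d where s: "s > 0" "\<And>y. \<bar>y - x\<bar> < s \<Longrightarrow> (\<lambda>i. d i * (y - x) ^ i) sums g y"
      using fg(2) unfolding C_omega_space_def by blast
    have "(\<lambda>i. (c i + k * d i) * (y - x) ^ i) sums (f (y + h) + k * g y)" if "\<bar>y - x\<bar> < min r s" for y
      using sums_add[OF r(2)[of "y + h"] sums_mult[OF s(2)[of y], of k]] that by (simp add: algebra_simps)
    then show "\<exists>r>0. \<exists>c. \<forall>y. \<bar>y - x\<bar> < r \<longrightarrow> (\<lambda>i. c i * (y - x) ^ i) sums (f (y + h) + k * g y)"
      using r(1) s(1) by (intro exI[of _ "min r s"] conjI exI[of _ "\<lambda>i. c i + k * d i"]) auto
  qed
next
  fix c :: real
  have "(\<lambda>i. (if i = 0 then c else 0) * z ^ i) sums c" for z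
  proof -
    have "(\<lambda>i. if i = 0 then c * z ^ i else 0) sums (c * z ^ 0)" by (rule sums_single)
    moreover have "(\<lambda>i. (if i = 0 then c else 0) * z ^ i) = (\<lambda>i. if i = 0 then c * z ^ i else 0)" by auto
    ultimately show ?thesis by simp
  qed
  then show "(\<lambda>_. c) \<in> C_omega_space"
    unfolding C_omega_space_def by (intro CollectI allI exI[of _ 1] conjI exI[of _ "\<lambda>i. if i = 0 then c else 0"]) auto
qed

section \<open>Derivatives of real analytic functions\<close>

lemma power_series_deriv:
  fixes f :: "real \<Rightarrow> real"
  assumes "\<And>y. \<bar>y - x\<bar> < r \<Longrightarrow> (\<lambda>i. c i * (y - x) ^ i) sums f y" "\<bar>y - x\<bar> < r"
  shows "f field_differentiable at y" "(\<lambda>i. diffs c i * (y - x) ^ i) sums deriv f y"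
proof -
  define F where "F z = (\<Sum>n. c n * z ^ n)" for z
  have summ: "summable (\<lambda>n. c n * z ^ n)" if "norm z < r" for z
    using assms(1)[of "x + z"] that by (auto simp: sums_iff)
  have f: "f y = F (y - x)" if "\<bar>y - x\<bar> < r" for y
    using assms(1)[OF that] by (simp add: F_def sums_iff)
  have "(F has_real_derivative (\<Sum>n. diffs c n * (y - x) ^ n)) (at (y - x))"
    unfolding F_def using assms(2) by (intro termdiffs_strong'[of r]) (auto intro: summ)
  then have "((\<lambda>y. F (y - x)) has_real_derivative (\<Sum>n. diffs c n * (y - x) ^ n)) (at y)"
    using DERIV_shift[of F _ y "- x"] by simp
  then have D: "(f has_real_derivative (\<Sum>n. diffs c n * (y - x) ^ n)) (at y)"
  proof (rule has_field_derivative_transform_within_open[where S = "ball x r"])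
    show "y \<in> ball x r" using assms(2) by (simp add: dist_real_def abs_minus_commute)
  qed (auto simp: f dist_real_def abs_minus_commute)
  then show "f field_differentiable at y" by (auto simp: field_differentiable_def)
  have "summable (\<lambda>n. diffs c n * (y - x) ^ n)"
    by (rule termdiff_converges[of "y - x" r]) (use assms(2) summ in auto)
  then show "(\<lambda>i. diffs c i * (y - x) ^ i) sums deriv f y"
    using DERIV_imp_deriv[OF D] by (simp add: sums_iff)
qed

lemma C_omega_deriv:
  assumes "f \<in> C_omega_space"
  shows "f field_differentiable at x" "deriv f \<in> C_omega_space"
proof -
  have *: "\<exists>r>0. \<exists>c. \<forall>y. \<bar>y - x\<bar> < r \<longrightarrow> (\<lambda>i. c i * (y - x) ^ i) sums f y" for x
    using assms by (simp add: C_omega_space_def)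
  show "f field_differentiable at x"
    using *[of x] power_series_deriv(1)[of x _ _ f x] by force
  show "deriv f \<in> C_omega_space"
    unfolding C_omega_space_def
  proof (intro CollectI allI)
    fix x
    show "\<exists>r>0. \<exists>c. \<forall>y. \<bar>y - x\<bar> < r \<longrightarrow> (\<lambda>i. c i * (y - x) ^ i) sums deriv f y"
      using *[of x] power_series_deriv(2)[of x _ _ f] by metis
  qed
qed

lemma C_omega_subset_C_space: "f \<in> C_omega_space \<Longrightarrow> f \<in> C_space k"
proof (induction k arbitrary: f)
  case 0
  then show ?case
    using C_omega_deriv(1)[THEN field_differentiable_imp_continuous_at]
    by (auto simp: C_space_def D_space_def intro!: continuous_at_imp_continuous_on)
next
  case (Suc k)
  then show ?case by (simp add: C_space_Suc C_omega_deriv)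
qed

text \<open>A Cauchy estimate at one point: convergence at distance r / 2 bounds the coefficients by
  B (2 / r)^j, and j! times a coefficient is the derivative. One natural number majorizes both
  \<open>B\<close> and 2 / r, so that the estimates are indexed by a countable set.\<close>

lemma C_omega_deriv_bound:
  assumes "f \<in> C_omega_space"
  shows "\<exists>N::nat. \<forall>j. \<bar>(deriv ^^ j) f x\<bar> \<le> real N ^ (j + 1) * fact j"
proof -
  obtain r c where r: "r > 0" and c: "\<And>y. \<bar>y - x\<bar> < r \<Longrightarrow> (\<lambda>i. c i * (y - x) ^ i) sums f y"
    using assms unfolding C_omega_space_def by blast
  have series: "(\<lambda>i. (diffs ^^ j) c i * (y - x) ^ i) sums (deriv ^^ j) f y" if "\<bar>y - x\<bar> < r" for j y
    using that
  proof (induction j arbitrary: y)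
    case (Suc j)
    then show ?case using power_series_deriv(2)[OF Suc.IH Suc.prems] by simp
  qed (simp add: c)
  have diffs: "(diffs ^^ j) c i * fact i = fact (i + j) * c (i + j)" for i j
  proof (induction j arbitrary: i)
    case (Suc j)
    then show ?case using Suc.IH[of "Suc i"] by (simp add: diffs_def algebra_simps)
  qed simp
  have coeff: "(deriv ^^ j) f x = fact j * c j" for j
    using series[of x j] r diffs[of j 0] by simp
  have "summable (\<lambda>i. c i * (r / 2) ^ i)" using c[of "x + r / 2"] r by (auto simp: sums_iff)
  then have "Bseq (\<lambda>i. c i * (r / 2) ^ i)"
    by (rule summable_imp_Bseq)
  then obtain B where B: "\<And>i. \<bar>c i * (r / 2) ^ i\<bar> \<le> B"
    unfolding Bseq_def real_norm_def by blast
  obtain N where N: "max B (2 / r) \<le> real N" using real_arch_simple by blast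
  have "\<bar>(deriv ^^ j) f x\<bar> \<le> real N ^ (j + 1) * fact j" for j
  proof -
    have "\<bar>c j\<bar> = \<bar>c j * (r / 2) ^ j\<bar> * (2 / r) ^ j"
      using r by (simp add: abs_mult power_divide)
    also have "\<dots> \<le> real N * real N ^ j"
      using N B[of j] r by (intro mult_mono power_mono) auto
    finally show ?thesis by (simp add: coeff abs_mult mult.commute mult_left_mono)
  qed
  then show ?thesis by blast
qed

section \<open>The difference property for higher derivatives and analytic functions\<close>

text \<open>Integrating a difference of the derivative from 0 to 1 gives a second difference of
  \<open>g\<close> at 0 with steps \<open>t\<close> and 1, which is symmetric in the two steps. So
  no additive correction arises when passing from \<open>g\<close> to its derivative.\<close>

lemma normalized_deriv:
  assumes diff: "\<And>x. g field_differentiable at x" and R: "\<And>h. diff_op h (deriv g) \<in> R_space"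
  shows "normalized (deriv g)"
proof -
  have D: "(g has_real_derivative deriv g x) (at x)" for x
    using diff by (simp add: DERIV_deriv_iff_field_differentiable)
  have "(diff_op t g has_real_derivative diff_op t (deriv g) x) (at x)" for t x
    unfolding diff_op_def using D[of x] D[of "x + t"] by (intro DERIV_diff) (simp_all add: DERIV_shift)
  then have "prim (diff_op t (deriv g)) x = diff_op t g x - diff_op t g 0" for t x
    by (rule prim_eq_antiderivative)
  moreover have "diff_op t g 1 - diff_op t g 0 = diff_op 1 g t - diff_op 1 g 0" for t
    by (simp add: diff_op_def add.commute)
  ultimately show ?thesis using R by (simp add: normalized_def)
qed

lemma differentiable_imp_continuous_on_UNIV:
  fixes f :: "real \<Rightarrow> real"
  assumes "\<forall>x. f field_differentiable at x"
  shows "continuous_on UNIV f"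
  using assms field_differentiable_imp_continuous_at by (blast intro: continuous_at_imp_continuous_on)

lemma D_space_continuous:
  assumes "f \<in> D_space k" "k \<ge> 1"
  shows "continuous_on UNIV f"
proof (rule differentiable_imp_continuous_on_UNIV)
  show "\<forall>x. f field_differentiable at x"
    using assms D_space_Suc[of f "k - 1"] by simp
qed

lemma C_space_continuous:
  assumes "f \<in> C_space k"
  shows "continuous_on UNIV f"
proof (cases "k = 0")
  case True
  then show ?thesis using assms by (simp add: C_space_def)
next
  case False
  then show ?thesis using assms D_space_continuous[of f k] by (simp add: C_space_def)
qed

lemma deriv_diff_op:
  assumes "\<And>x. g field_differentiable at x"
  shows "deriv (diff_op h g) = diff_op h (deriv g)"
proof -
  have "g \<in> D_space 1" using assms by (simp add: D_space_def)
  from deriv_funpow_diff_op[OF this, of h] show ?thesis by (auto simp: diff_op_def)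
qed

text \<open>Once \<open>g\<close> is differentiable, its derivative is again normalized and its
  differences lie in the class of order one less, so the order can be reduced to the continuous
  case.\<close>

lemma difference_property_C_space:
  assumes "normalized g" "\<And>h. diff_op h g \<in> C_space k"
  shows "g \<in> C_space k"
  using assms
proof (induction k arbitrary: g)
  case 0
  then show ?case
    using difference_property_continuous[of g] by (simp add: C_space_def D_space_def)
next
  case (Suc k)
  have diff: "g field_differentiable at x" for x
    by (rule difference_property_differentiable[OF Suc.prems(1)]) (use Suc.prems(2) in \<open>simp add: C_space_Suc\<close>)
  have *: "diff_op h (deriv g) \<in> C_space k" for h
    using Suc.prems(2)[of h] by (simp add: C_space_Suc deriv_diff_op[OF diff])
  then have "normalized (deriv g)"
    by (intro normalized_deriv[OF diff] R_space_continuous C_space_continuous)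
  then show ?case using Suc.IH[OF _ *] diff by (simp add: C_space_Suc)
qed

text \<open>The induction starts at order 1 because \<open>D_space 0\<close> contains every
  function; positive order also supplies the continuity that puts the differences of the derivative
  into \<open>R_space\<close>.\<close>

lemma difference_property_D_space:
  assumes "normalized g" "\<And>h. diff_op h g \<in> D_space (Suc k)"
  shows "g \<in> D_space (Suc k)"
  using assms
proof (induction k arbitrary: g)
  case 0
  have "g field_differentiable at x" for x
    by (rule difference_property_differentiable[OF 0(1)]) (use 0(2) in \<open>simp add: D_space_Suc\<close>)
  then show ?case by (simp add: D_space_def)
next
  case (Suc k)
  have diff: "g field_differentiable at x" for x
    by (rule difference_property_differentiable[OF Suc.prems(1)])
       (use Suc.prems(2) in \<open>simp add: D_space_Suc[of _ "Suc k"]\<close>)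
  have *: "diff_op h (deriv g) \<in> D_space (Suc k)" for h
    using Suc.prems(2)[of h] by (simp add: D_space_Suc[of _ "Suc k"] deriv_diff_op[OF diff])
  then have "normalized (deriv g)"
    by (intro normalized_deriv[OF diff] R_space_continuous D_space_continuous[of _ "Suc k"]) auto
  then show ?case using Suc.IH[OF _ *] diff by (simp add: D_space_Suc[of _ "Suc k"])
qed

text \<open>Factorial growth of the derivatives on a whole interval, not just at \<open>m\<close>,
  makes the Lagrange remainder geometric. The bound concerns only positive orders, so only
  remainders with n > 0 are estimated.\<close>

lemma C_omega_at_point:
  assumes D: "\<And>k. g \<in> D_space k" and ab: "a < b" and Q: "Q > 0"
    and bound: "\<And>h j. h \<in> {a<..<b} \<Longrightarrow> j \<ge> 1 \<Longrightarrow> \<bar>(deriv ^^ j) g h\<bar> \<le> Q ^ (j + 1) * fact j"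
  defines "m \<equiv> (a + b) / 2"
  shows "\<exists>r>0. \<exists>c. \<forall>y. \<bar>y - m\<bar> < r \<longrightarrow> (\<lambda>i. c i * (y - m) ^ i) sums g y"
proof -
  \<comment> \<open>Half the length of the interval keeps the intermediate point in it, and 1 / (2
    Q) makes the ratio of the geometric bound at most 1 / 2.\<close>
  define r where "r = min ((b - a) / 2) (1 / (2 * Q))"
  have r: "r > 0" using ab Q by (simp add: r_def)
  define c where "c i = (deriv ^^ i) g m / fact i" for i
  have "(\<lambda>i. c i * (y - m) ^ i) sums g y" if y: "\<bar>y - m\<bar> < r" for y
  proof (cases "y = m")
    case True
    have "c 0 = g m" by (simp add: c_def)
    then show ?thesis using True by simp
  next
    case False
    have yab: "y \<in> {a<..<b}" and mab: "m \<in> {a<..<b}"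
      using y ab by (auto simp: r_def m_def abs_less_iff field_simps)
    have Qy: "Q * \<bar>y - m\<bar> \<le> 1 / 2"
    proof -
      have "\<bar>y - m\<bar> \<le> 1 / (2 * Q)" using y by (simp add: r_def)
      then show ?thesis using Q by (simp add: field_simps)
    qed
    have rem: "\<bar>g y - (\<Sum>i<n. c i * (y - m) ^ i)\<bar> \<le> Q * (1 / 2) ^ n" if n: "n > 0" for n
    proof -
      have "\<exists>t. (if y < m then y < t \<and> t < m else m < t \<and> t < y) \<and>
          g y = (\<Sum>i<n. (deriv ^^ i) g m / fact i * (y - m) ^ i) + (deriv ^^ n) g t / fact n * (y - m) ^ n"
        using yab mab False n D_space_DERIV[OF D]
        by (intro Taylor[where diff = "\<lambda>i. (deriv ^^ i) g" and a = "min y m" and b = "max y m"]) auto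
      then obtain t where t: "if y < m then y < t \<and> t < m else m < t \<and> t < y"
        "g y - (\<Sum>i<n. c i * (y - m) ^ i) = (deriv ^^ n) g t / fact n * (y - m) ^ n"
        by (auto simp: c_def)
      have "t \<in> {a<..<b}" using t(1) yab mab by (auto split: if_splits)
      then have "\<bar>(deriv ^^ n) g t\<bar> / fact n \<le> Q ^ (n + 1)"
        using bound[of t n] n by (simp add: divide_le_eq)
      then have "\<bar>(deriv ^^ n) g t\<bar> / fact n * \<bar>y - m\<bar> ^ n \<le> Q ^ (n + 1) * \<bar>y - m\<bar> ^ n"
        by (intro mult_right_mono) auto
      also have "\<dots> = Q * (Q * \<bar>y - m\<bar>) ^ n" by (simp add: power_mult_distrib)
      also have "\<dots> \<le> Q * (1 / 2) ^ n"
        using Q Qy by (intro mult_left_mono power_mono) auto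
      finally show ?thesis unfolding t(2) by (simp add: abs_mult power_abs)
    qed
    have lim: "(\<lambda>n. Q * (1 / 2) ^ n) \<longlonglongrightarrow> 0"
      using tendsto_mult[OF tendsto_const LIMSEQ_realpow_zero[of "1 / 2"], of Q] by simp
    have "(\<lambda>n. g y - (\<Sum>i<n. c i * (y - m) ^ i)) \<longlonglongrightarrow> 0"
      by (rule Lim_null_comparison[OF _ lim])
         (use rem in \<open>auto simp: eventually_sequentially intro!: exI[of _ 1]\<close>)
    then have "(\<lambda>n. g y - (g y - (\<Sum>i<n. c i * (y - m) ^ i))) \<longlonglongrightarrow> g y - 0"
      by (intro tendsto_diff tendsto_const)
    then show ?thesis by (simp add: sums_def)
  qed
  then show ?thesis using r by blast
qed

text \<open>Baire's theorem bounds \<open>g\<^sup>j(h) - g\<^sup>j(0)\<close> (\<open>j\<close>-th derivatives) by \<open>N\<^sup>j\<^sup>+\<^sup>1 j!\<close> on an interval of \<open>h\<close>. By the mean value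
  theorem some \<open>g\<^sup>j(\<xi>)\<close> there is a multiple of a derivative of the analytic function \<open>\<Delta>\<^sub>L g\<close>, so \<open>g\<^sup>j\<close> itself
  satisfies such a bound and the Taylor series converges to \<open>g\<close>. Analyticity at one point spreads by adding \<open>\<Delta>\<^sub>h g\<close>.\<close>

lemma difference_property_C_omega:
  assumes norm: "normalized g" and an: "\<And>h. diff_op h g \<in> C_omega_space"
  shows "g \<in> C_omega_space"
proof -
  have C: "g \<in> C_space k" for k
    using C_omega_subset_C_space[OF an] by (intro difference_property_C_space[OF norm])
  then have D: "g \<in> D_space k" for k by (simp add: C_space_def)
  have cont: "continuous_on UNIV ((deriv ^^ j) g)" for j using C by (simp add: C_space_def)
  note dd = deriv_funpow_diff_op[OF D]
  define E where "E N = {h. \<forall>j. \<bar>(deriv ^^ j) g h - (deriv ^^ j) g 0\<bar> \<le> real N ^ (j + 1) * fact j}" for N :: nat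
  have "\<exists>N. h \<in> E N" for h
    using C_omega_deriv_bound[OF an, of h 0] by (simp add: dd E_def)
  then obtain N a b where ab: "a < b" "{a<..<b} \<subseteq> closure (E N)"
    by (rule baire_cover)
  \<comment> \<open>All derivatives of \<open>g\<close> are already known to be continuous, so the
    bound passes from the dense set to the entire interval.\<close>
  have "closed (E N)"
    unfolding E_def by (intro closed_Collect_all closed_Collect_le continuous_intros cont)
  then have EN: "\<bar>(deriv ^^ j) g h - (deriv ^^ j) g 0\<bar> \<le> real N ^ (j + 1) * fact j" if "h \<in> {a<..<b}" for h j
    using ab(2) that by (auto simp: E_def closure_closed)
  \<comment> \<open>[u, u + L] is the middle third of the interval, so the mean value point lies
    where the Baire bound holds.\<close>
  define u where "u = (2 * a + b) / 3"
  define L where "L = (b - a) / 3"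
  have L: "L > 0" "a < u" "u + L < b" using ab(1) by (auto simp: u_def L_def field_simps)
  obtain M where M: "\<And>j. \<bar>(deriv ^^ j) (diff_op L g) u\<bar> \<le> real M ^ (j + 1) * fact j"
    using C_omega_deriv_bound[OF an, of L u] by blast
  \<comment> \<open>The comparison of the derivative at \<open>h\<close> with that at
    \<open>\<xi>\<close> passes through 0 and costs \<open>N\<close> twice; 1 / L comes from the
    mean value theorem, and \<open>M\<close> is included so that its powers are dominated by those
    of \<open>Q\<close>.\<close>
  define Q where "Q = 2 * real N + real M + 1 / L"
  have Q: "Q > 0" "real N \<le> Q" "real M \<le> Q" using L(1) by (auto simp: Q_def add_nonneg_pos)
  have "\<bar>(deriv ^^ j) g h\<bar> \<le> Q ^ (j + 1) * fact j" if h: "h \<in> {a<..<b}" and j: "j \<ge> 1" for h j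
  proof -
    obtain i where i: "j = Suc i" using j by (cases j) auto
    obtain \<xi> where \<xi>: "u < \<xi>" "\<xi> < u + L"
      "(deriv ^^ i) g (u + L) - (deriv ^^ i) g u = (u + L - u) * (deriv ^^ j) g \<xi>"
      using MVT2[of u "u + L" "(deriv ^^ i) g" "(deriv ^^ j) g"] D_space_DERIV[OF D] L(1) i by auto
    have "L * \<bar>(deriv ^^ j) g \<xi>\<bar> = \<bar>(deriv ^^ i) (diff_op L g) u\<bar>"
      using \<xi>(3) L(1) by (simp add: dd abs_mult)
    also have "\<dots> \<le> real M ^ (i + 1) * fact i" by (rule M)
    \<comment> \<open>The mean value theorem reaches order \<open>j\<close> from order i = j - 1:
      the exponent i + 1 is \<open>j\<close>, and the factorial only grows.\<close>
    also have "\<dots> \<le> real M ^ j * fact j" using i by (simp add: fact_mono mult_left_mono)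
    finally have 1: "\<bar>(deriv ^^ j) g \<xi>\<bar> \<le> 1 / L * (real M ^ j * fact j)" using L(1) by (simp add: field_simps)
    have 2: "\<bar>(deriv ^^ j) g \<xi> - (deriv ^^ j) g 0\<bar> \<le> real N ^ (j + 1) * fact j"
      using EN[of \<xi> j] \<xi> L by auto
    have "\<bar>(deriv ^^ j) g h\<bar> \<le> 2 * (real N ^ (j + 1) * fact j) + 1 / L * (real M ^ j * fact j)"
      using EN[OF h, of j] 1 2 by linarith
    also have "\<dots> = (2 * real N * real N ^ j + 1 / L * real M ^ j) * fact j" by (simp add: algebra_simps)
    also have "\<dots> \<le> (2 * real N * Q ^ j + 1 / L * Q ^ j) * fact j"
      using Q L by (intro mult_right_mono add_mono mult_left_mono power_mono) auto
    also have "\<dots> = (2 * real N + 1 / L) * Q ^ j * fact j" by (simp add: algebra_simps)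
    also have "\<dots> \<le> Q * Q ^ j * fact j"
      using Q by (intro mult_right_mono) (auto simp: Q_def)
    finally show ?thesis by simp
  qed
  from C_omega_at_point[OF D ab(1) Q(1) this]
  obtain m r c where m: "r > 0" "\<And>y. \<bar>y - m\<bar> < r \<Longrightarrow> (\<lambda>i. c i * (y - m) ^ i) sums g y"
    by blast
  show ?thesis
    unfolding C_omega_space_def
  proof (intro CollectI allI)
    fix x
    obtain s d where s: "s > 0"
      "\<And>y. \<bar>y - m\<bar> < s \<Longrightarrow> (\<lambda>i. d i * (y - m) ^ i) sums diff_op (x - m) g y"
      using an[of "x - m"] unfolding C_omega_space_def by blast
    \<comment> \<open>With z = y - (x - m) one has g(y) = g(z) plus the difference of
      \<open>g\<close> with step x - m at z, and z - m = y - x, so the two series around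
      \<open>m\<close> add up to one around \<open>x\<close>.\<close>
    have "(\<lambda>i. (c i + d i) * (y - x) ^ i) sums g y" if "\<bar>y - x\<bar> < min r s" for y
      using sums_add[OF m(2)[of "y - (x - m)"] s(2)[of "y - (x - m)"]] that
      by (simp add: algebra_simps diff_op_def)
    then show "\<exists>r>0. \<exists>c. \<forall>y. \<bar>y - x\<bar> < r \<longrightarrow> (\<lambda>i. c i * (y - x) ^ i) sums g y"
      using m(1) s(1) by (intro exI[of _ "min r s"] conjI exI[of _ "\<lambda>i. c i + d i"]) auto
  qed
qed

section \<open>Decomposition into a derivation and a regular part\<close>

lemma delta_funpow_Suc:
  "(delta \<alpha> ^^ Suc m) f x = (delta \<alpha> ^^ m) f (\<alpha> * x) - \<alpha> * (delta \<alpha> ^^ m) f x"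
  by (simp add: fun_cong[OF delta_def])

text \<open>Each further operator evaluates the previous iterate at \<open>\<alpha> * x\<close>,
  which enlarges the range of \<open>x\<close> from \<open>K\<close> to \<open>N * K\<close>; hence
  the induction runs over all \<open>K\<close>.\<close>

lemma delta_funpow_bounded:
  assumes "\<And>a b. \<exists>B. \<forall>x\<in>{a..b}. \<bar>f x\<bar> \<le> B" "N \<ge> 0"
  shows "\<exists>B. \<forall>\<alpha>\<in>{-N..N}. \<forall>x\<in>{-K..K}. \<bar>(delta \<alpha> ^^ m) f x\<bar> \<le> B"
proof (induction m arbitrary: K)
  case 0
  then show ?case using assms(1) by auto
next
  case (Suc m)
  obtain B where B: "\<And>\<alpha> x. \<alpha> \<in> {-N..N} \<Longrightarrow> x \<in> {-(N * K)..N * K} \<Longrightarrow> \<bar>(delta \<alpha> ^^ m) f x\<bar> \<le> B"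
    using Suc[of "N * K"] by blast
  obtain B' where B': "\<And>\<alpha> x. \<alpha> \<in> {-N..N} \<Longrightarrow> x \<in> {-K..K} \<Longrightarrow> \<bar>(delta \<alpha> ^^ m) f x\<bar> \<le> B'"
    using Suc[of K] by blast
  have "\<bar>(delta \<alpha> ^^ Suc m) f x\<bar> \<le> B + N * B'" if \<alpha>: "\<alpha> \<in> {-N..N}" and x: "x \<in> {-K..K}" for \<alpha> x
  proof -
    have "\<bar>\<alpha> * x\<bar> \<le> N * K" unfolding abs_mult using \<alpha> x assms(2) by (intro mult_mono) auto
    then have "\<bar>(delta \<alpha> ^^ m) f (\<alpha> * x)\<bar> \<le> B" by (intro B \<alpha>) auto
    moreover have "\<bar>\<alpha> * (delta \<alpha> ^^ m) f x\<bar> \<le> N * B'"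
      unfolding abs_mult using \<alpha> B'[OF \<alpha> x] assms(2) by (intro mult_mono) auto
    ultimately show ?thesis unfolding delta_funpow_Suc by linarith
  qed
  then show ?case by blast
qed

lemma bold_D_bounded:
  assumes "\<gamma> \<in> R_space" "N \<ge> 0"
  shows "\<exists>B. \<forall>\<alpha>\<in>{-N..N}. \<bar>bold_D n \<gamma> \<alpha>\<bar> \<le> B"
proof -
  obtain B where "\<forall>\<alpha>\<in>{-N..N}. \<forall>x\<in>{-1..1}. \<bar>(delta \<alpha> ^^ (n + 1)) \<gamma> x\<bar> \<le> B"
    using delta_funpow_bounded[OF R_space_bounded[OF assms(1)] assms(2), of 1 "n + 1"] by blast
  moreover have "(1::real) \<in> {-1..1}" by simp
  ultimately show ?thesis unfolding bold_D_def by blast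
qed

lemma bold_D_bounded_on_positive_set:
  assumes "\<gamma> \<in> R_space"
  shows "bounded_or_measurable_on_positive_set (bold_D n \<gamma>)"
proof -
  obtain B where "\<forall>\<alpha>\<in>{-1..1}. \<bar>bold_D n \<gamma> \<alpha>\<bar> \<le> B" using bold_D_bounded[OF assms, of 1 n] by auto
  then have "bounded (bold_D n \<gamma> ` {-1..1})" by (auto simp: bounded_iff)
  then show ?thesis
    unfolding bounded_or_measurable_on_positive_set_def by (intro disjI1 bexI[of _ "{-1..1}"]) auto
qed

lemma bold_D_continuous:
  assumes "continuous_on UNIV \<gamma>"
  shows "isCont (bold_D n \<gamma>) \<alpha>"
proof -
  \<comment> \<open>Continuity has to be joint in both variables, because each further operator uses
    \<alpha> as a parameter and also inside the argument.\<close>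
  have *: "continuous_on UNIV (\<lambda>p::real \<times> real. (delta (fst p) ^^ m) \<gamma> (snd p))" for m
  proof (induction m)
    case 0
    show ?case using continuous_on_compose2[OF assms continuous_on_snd[OF continuous_on_id], of UNIV] by simp
  next
    case (Suc m)
    have "continuous_on UNIV (\<lambda>p::real \<times> real. (fst p, fst p * snd p))" by (intro continuous_intros)
    from continuous_on_compose2[OF Suc this]
    have "continuous_on UNIV (\<lambda>p::real \<times> real. (delta (fst p) ^^ m) \<gamma> (fst p * snd p))" by simp
    then have "continuous_on UNIV (\<lambda>p::real \<times> real. (delta (fst p) ^^ m) \<gamma> (fst p * snd p) - fst p * (delta (fst p) ^^ m) \<gamma> (snd p))"
      using Suc by (intro continuous_on_diff continuous_on_mult continuous_on_fst continuous_on_id)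
    then show ?case by (simp only: delta_funpow_Suc)
  qed
  have "continuous_on UNIV (\<lambda>\<alpha>::real. (\<alpha>, 1::real))" by (intro continuous_intros)
  from continuous_on_compose2[OF *[of "n + 1"] this]
  have "continuous_on UNIV (bold_D n \<gamma>)" unfolding bold_D_def by simp
  then show ?thesis by (simp add: continuous_on_eq_continuous_at)
qed

text \<open>This reduces the conditions with a continuity point to the conditions on a set of
  positive measure: near that point the function is bounded.\<close>

lemma isCont_bounded_on_positive_set:
  assumes "isCont g \<alpha>"
  shows "bounded_or_measurable_on_positive_set g"
proof -
  obtain \<delta> where \<delta>: "\<delta> > 0" "\<And>x. \<bar>x - \<alpha>\<bar> < \<delta> \<Longrightarrow> \<bar>g x - g \<alpha>\<bar> < 1"
    using assms unfolding continuous_at_eps_delta dist_real_def by (meson zero_less_one)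
  have "\<bar>g x\<bar> \<le> \<bar>g \<alpha>\<bar> + 1" if "x \<in> {\<alpha> - \<delta><..<\<alpha> + \<delta>}" for x
  proof -
    have "\<bar>x - \<alpha>\<bar> < \<delta>" using that by (auto simp: abs_less_iff)
    from \<delta>(2)[OF this] show ?thesis by linarith
  qed
  then have "bounded (g ` {\<alpha> - \<delta><..<\<alpha> + \<delta>})" unfolding bounded_iff by (intro exI[of _ "\<bar>g \<alpha>\<bar> + 1"]) auto
  then show ?thesis
    unfolding bounded_or_measurable_on_positive_set_def
    using \<delta>(1) by (intro disjI1 bexI[of _ "{\<alpha> - \<delta><..<\<alpha> + \<delta>}"]) auto
qed

lemma bold_D_plus: "bold_D n (\<lambda>x. f x + g x) \<alpha> = bold_D n f \<alpha> + bold_D n g \<alpha>"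
  by (simp only: bold_D_def delta_funpow_plus)

lemma bold_D_linear: "bold_D n (\<lambda>x. c * x) \<alpha> = 0"
proof -
  have "(delta \<alpha> ^^ m) (\<lambda>_. 0) = (\<lambda>_. 0)" for m by (induction m) (simp_all add: delta_def)
  moreover have "delta \<alpha> (\<lambda>x. c * x) = (\<lambda>_. 0)" by (simp add: delta_def)
  ultimately show ?thesis by (simp add: bold_D_def funpow_Suc_right del: funpow.simps(2))
qed

lemma bold_D_derivation:
  assumes "derivation_of_order n d"
  shows "bold_D n d \<alpha> = 0"
proof -
  have "foldr delta (replicate (n + 1) \<alpha>) d 1 = 0"
    using assms unfolding derivation_of_order_def by (meson length_replicate)
  then show ?thesis unfolding bold_D_def by (simp only: foldr_replicate)
qed

text \<open>The class \<open>X\<close> and the weak regularity \<open>P\<close> are abstract, so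
  that one proof covers all six cases. In the converse direction \<open>bold_D\<close> annihilates
  the derivation and the linear term, so that \<open>P\<close> is required only for
  \<open>bold_D n \<gamma>\<close>.\<close>

theorem decomposition_iff:
  assumes X: "combination_closed X" "X \<subseteq> R_space"
    and dp: "\<And>g. normalized g \<Longrightarrow> (\<And>h. diff_op h g \<in> X) \<Longrightarrow> g \<in> X"
    and P: "\<And>F. P F \<Longrightarrow> bounded_or_measurable_on_positive_set F"
    and P\<gamma>: "\<And>\<gamma>. \<gamma> \<in> X \<Longrightarrow> P (bold_D n \<gamma>)"
  shows "(\<forall>h. diff_op h f \<in> X) \<and> P (bold_D n f) \<longleftrightarrow>
         (\<exists>d (c::real) \<gamma>. derivation_of_order n d \<and> \<gamma> \<in> X \<and> (\<forall>x. f x = d x + c * x + \<gamma> x))"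
proof
  assume lhs: "(\<forall>h. diff_op h f \<in> X) \<and> P (bold_D n f)"
  then have fX: "diff_op h f \<in> X" for h by blast
  then have fR: "\<And>h. diff_op h f \<in> R_space" using X(2) by blast
  define A where "A t = prim (diff_op t f) 1 - prim (diff_op 1 f) t" for t
  have A: "Modules.additive A" unfolding A_def[abs_def] by (rule additive_prim_diff_op[OF fR])
  have A1: "A 1 = 0" by (simp add: A_def)
  define g where "g x = f x - A x" for x
  have dg: "diff_op h g = (\<lambda>x. diff_op h f x + (- A h))" for h
    using additive.add[OF A] by (auto simp: diff_op_def g_def)
  have gX: "diff_op h g \<in> X" for h
  proof -
    have "(\<lambda>_. - A h) \<in> X" using X(1) by (simp add: combination_closed_def)
    then have "(\<lambda>x. diff_op h f (x + 0) + 1 * (- A h)) \<in> X"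
      by (rule combination_closedD[OF X(1) fX])
    then show ?thesis by (simp add: dg)
  qed
  \<comment> \<open>Subtracting \<open>A\<close> changes each difference only by a constant. At
    length 1 this constant is exactly the defect \<open>A h\<close>, and with step 1 it vanishes by
    \<open>A1\<close>; this is the normalization.\<close>
  have prim_dg: "prim (diff_op h g) x = prim (diff_op h f) x - A h * x" for h x
    unfolding dg using prim_plus[OF fR R_space_continuous[OF continuous_on_const], of h "- A h" x]
    by (simp add: prim_const)
  have "normalized g"
    using gX X(2) A1 by (auto simp: normalized_def prim_dg A_def)
  then have g: "g \<in> X" using gX by (rule dp)
  have f_eq: "f = (\<lambda>x. A x + g x)" by (simp add: g_def)
  obtain S N where S: "S \<in> lmeasurable" "measure lebesgue S > 0"
    "\<And>x. x \<in> S \<Longrightarrow> \<bar>x\<bar> \<le> N" "\<And>x. x \<in> S \<Longrightarrow> \<bar>bold_D n f x\<bar> \<le> N"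
    using bounded_on_bounded_positive_set[OF P[of "bold_D n f"]] lhs by blast
  have gR: "g \<in> R_space" using g X(2) by blast
  \<comment> \<open>\<open>bold_D n A\<close> is \<open>bold_D n f\<close> minus
    \<open>bold_D n g\<close>; the latter is bounded on the bounded set \<open>S\<close> because
    \<open>g\<close> is Riemann integrable.\<close>
  obtain B where B: "\<And>\<alpha>. \<alpha> \<in> {-\<bar>N\<bar>..\<bar>N\<bar>} \<Longrightarrow> \<bar>bold_D n g \<alpha>\<bar> \<le> B"
    using bold_D_bounded[OF gR abs_ge_zero[of N], of n] by blast
  have "\<bar>(delta x ^^ (n + 1)) A 1\<bar> \<le> N + B" if x: "x \<in> S" for x
  proof -
    have "bold_D n f x = bold_D n A x + bold_D n g x" unfolding f_eq by (rule bold_D_plus)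
    moreover have "\<bar>bold_D n g x\<bar> \<le> B" using S(3)[OF x] by (intro B) auto
    ultimately have "\<bar>bold_D n A x\<bar> \<le> N + B" using S(4)[OF x] by linarith
    then show ?thesis by (simp add: bold_D_def)
  qed
  then have "foldr delta \<alpha>s A 1 = 0" if "length \<alpha>s = n + 1" for \<alpha>s
    by (rule delta_mixed_vanish[OF A S(1,2) _ _ that]) auto
  then have "derivation_of_order n A" by (intro derivation_of_orderI A A1)
  then show "\<exists>d (c::real) \<gamma>. derivation_of_order n d \<and> \<gamma> \<in> X \<and> (\<forall>x. f x = d x + c * x + \<gamma> x)"
    \<comment> \<open>The linear term stays inside the regular part \<open>g\<close>, hence the
      witness 0 for its coefficient.\<close>
    using g by (intro exI[of _ A] exI[of _ 0] exI[of _ g]) (simp add: g_def)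
next
  assume "\<exists>d (c::real) \<gamma>. derivation_of_order n d \<and> \<gamma> \<in> X \<and> (\<forall>x. f x = d x + c * x + \<gamma> x)"
  then obtain d c \<gamma> where d: "derivation_of_order n d" and \<gamma>: "\<gamma> \<in> X"
    and "\<forall>x. f x = d x + c * x + \<gamma> x" by blast
  then have f: "f = (\<lambda>x. (d x + c * x) + \<gamma> x)" by auto
  have add: "d (x + y) = d x + d y" for x y
    using d by (simp add: derivation_of_order_def additive.add)
  have "diff_op h f \<in> X" for h
  proof -
    have "(\<lambda>x. \<gamma> (x + h) + (-1) * \<gamma> x) \<in> X"
      by (rule combination_closedD[OF X(1) \<gamma> \<gamma>])
    moreover have "(\<lambda>_. d h + c * h) \<in> X" using X(1) by (simp add: combination_closed_def)
    ultimately have "(\<lambda>x. (\<gamma> ((x + 0) + h) + (-1) * \<gamma> (x + 0)) + 1 * (d h + c * h)) \<in> X"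
      by (rule combination_closedD[OF X(1)])
    then show ?thesis by (simp add: diff_op_def f add algebra_simps)
  qed
  moreover have "bold_D n f = bold_D n \<gamma>"
    unfolding f by (rule ext) (simp only: bold_D_plus bold_D_linear bold_D_derivation[OF d] add_0)
  ultimately show "(\<forall>h. diff_op h f \<in> X) \<and> P (bold_D n f)" using P\<gamma>[OF \<gamma>] by simp
qed

theorem theorem2p6:
  fixes n :: nat and f :: "real \<Rightarrow> real"
  assumes "n \<ge> 1"
  shows "(\<forall>k. ((\<forall>h. diff_op h f \<in> C_space k) \<and> (\<exists>\<alpha>. isCont (bold_D n f) \<alpha>)
              \<longleftrightarrow> (\<exists>d (c::real) \<gamma>. derivation_of_order n d \<and> \<gamma> \<in> C_space k \<and>
                 (\<forall>x. f x = d x + c * x + \<gamma> x)))) \<and>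
         (\<forall>k\<ge>1. ((\<forall>h. diff_op h f \<in> D_space k) \<and> (\<exists>\<alpha>. isCont (bold_D n f) \<alpha>)
              \<longleftrightarrow> (\<exists>d (c::real) \<gamma>. derivation_of_order n d \<and> \<gamma> \<in> D_space k \<and>
                 (\<forall>x. f x = d x + c * x + \<gamma> x)))) \<and>
         ((\<forall>h. diff_op h f \<in> C_omega_space) \<and> (\<exists>\<alpha>. isCont (bold_D n f) \<alpha>)
              \<longleftrightarrow> (\<exists>d (c::real) \<gamma>. derivation_of_order n d \<and> \<gamma> \<in> C_omega_space \<and>
                 (\<forall>x. f x = d x + c * x + \<gamma> x))) \<and>
         ((\<forall>h. diff_op h f \<in> R_space) \<and> bounded_or_measurable_on_positive_set (bold_D n f)
              \<longleftrightarrow> (\<exists>d (c::real) \<gamma>. derivation_of_order n d \<and> \<gamma> \<in> R_space \<and>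
                 (\<forall>x. f x = d x + c * x + \<gamma> x))) \<and>
         ((\<forall>h. diff_op h f \<in> AC_space) \<and> bounded_or_measurable_on_positive_set (bold_D n f)
              \<longleftrightarrow> (\<exists>d (c::real) \<gamma>. derivation_of_order n d \<and> \<gamma> \<in> AC_space \<and>
                 (\<forall>x. f x = d x + c * x + \<gamma> x))) \<and>
         ((\<forall>h. diff_op h f \<in> BV_space) \<and> bounded_or_measurable_on_positive_set (bold_D n f)
              \<longleftrightarrow> (\<exists>d (c::real) \<gamma>. derivation_of_order n d \<and> \<gamma> \<in> BV_space \<and>
                 (\<forall>x. f x = d x + c * x + \<gamma> x)))"
proof -
  \<comment> \<open>The first three cases take a continuity point as \<open>P\<close>, the last
    three the condition on a set of positive measure; the difference property of the class is left
    to each case.\<close>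
  have continuous_case: "(\<forall>h. diff_op h f \<in> X) \<and> (\<exists>\<alpha>. isCont (bold_D n f) \<alpha>) \<longleftrightarrow>
      (\<exists>d (c::real) \<gamma>. derivation_of_order n d \<and> \<gamma> \<in> X \<and> (\<forall>x. f x = d x + c * x + \<gamma> x))"
    if "combination_closed X" "\<And>\<gamma>. \<gamma> \<in> X \<Longrightarrow> continuous_on UNIV \<gamma>"
      "\<And>g. normalized g \<Longrightarrow> (\<And>h. diff_op h g \<in> X) \<Longrightarrow> g \<in> X" for X
    using that by (intro decomposition_iff[where P = "\<lambda>F. \<exists>\<alpha>. isCont F \<alpha>"])
      (auto intro: R_space_continuous isCont_bounded_on_positive_set bold_D_continuous)
  have integrable_case: "(\<forall>h. diff_op h f \<in> X) \<and> bounded_or_measurable_on_positive_set (bold_D n f) \<longleftrightarrow>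
      (\<exists>d (c::real) \<gamma>. derivation_of_order n d \<and> \<gamma> \<in> X \<and> (\<forall>x. f x = d x + c * x + \<gamma> x))"
    if "combination_closed X" "X \<subseteq> R_space"
      "\<And>g. normalized g \<Longrightarrow> (\<And>h. diff_op h g \<in> X) \<Longrightarrow> g \<in> X" for X
    using that by (intro decomposition_iff) (auto intro: bold_D_bounded_on_positive_set)
  show ?thesis
  proof (intro conjI allI impI)
    fix k :: nat
    show "(\<forall>h. diff_op h f \<in> C_space k) \<and> (\<exists>\<alpha>. isCont (bold_D n f) \<alpha>) \<longleftrightarrow>
        (\<exists>d (c::real) \<gamma>. derivation_of_order n d \<and> \<gamma> \<in> C_space k \<and> (\<forall>x. f x = d x + c * x + \<gamma> x))"
    proof (rule continuous_case[OF combination_closed_C_space])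
      show "g \<in> C_space k" if "normalized g" "\<And>h. diff_op h g \<in> C_space k" for g
        by (rule difference_property_C_space[OF that])
    qed (rule C_space_continuous)
  next
    fix k :: nat assume k: "1 \<le> k"
    then obtain j where j: "k = Suc j" by (cases k) auto
    show "(\<forall>h. diff_op h f \<in> D_space k) \<and> (\<exists>\<alpha>. isCont (bold_D n f) \<alpha>) \<longleftrightarrow>
        (\<exists>d (c::real) \<gamma>. derivation_of_order n d \<and> \<gamma> \<in> D_space k \<and> (\<forall>x. f x = d x + c * x + \<gamma> x))"
    proof (rule continuous_case[OF combination_closed_D_space])
      show "continuous_on UNIV \<gamma>" if "\<gamma> \<in> D_space k" for \<gamma>
        by (rule D_space_continuous[OF that k])
      show "g \<in> D_space k" if "normalized g" "\<And>h. diff_op h g \<in> D_space k" for g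
        unfolding j by (rule difference_property_D_space[OF that[unfolded j]])
    qed
  next
    show "(\<forall>h. diff_op h f \<in> C_omega_space) \<and> (\<exists>\<alpha>. isCont (bold_D n f) \<alpha>) \<longleftrightarrow>
        (\<exists>d (c::real) \<gamma>. derivation_of_order n d \<and> \<gamma> \<in> C_omega_space \<and> (\<forall>x. f x = d x + c * x + \<gamma> x))"
    proof (rule continuous_case[OF combination_closed_C_omega_space])
      show "g \<in> C_omega_space" if "normalized g" "\<And>h. diff_op h g \<in> C_omega_space" for g
        by (rule difference_property_C_omega[OF that])
    qed (rule C_space_continuous[OF C_omega_subset_C_space[of _ 0]])
  next
    show "(\<forall>h. diff_op h f \<in> R_space) \<and> bounded_or_measurable_on_positive_set (bold_D n f) \<longleftrightarrow>
        (\<exists>d (c::real) \<gamma>. derivation_of_order n d \<and> \<gamma> \<in> R_space \<and> (\<forall>x. f x = d x + c * x + \<gamma> x))"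
      by (rule integrable_case[OF combination_closed_R_space order_refl]) (rule difference_property_R)
  next
    show "(\<forall>h. diff_op h f \<in> AC_space) \<and> bounded_or_measurable_on_positive_set (bold_D n f) \<longleftrightarrow>
        (\<exists>d (c::real) \<gamma>. derivation_of_order n d \<and> \<gamma> \<in> AC_space \<and> (\<forall>x. f x = d x + c * x + \<gamma> x))"
    proof (rule integrable_case[OF combination_closed_AC_space])
      show "AC_space \<subseteq> R_space" using R_space_continuous[OF AC_space_continuous] by blast
      show "g \<in> AC_space" if "normalized g" "\<And>h. diff_op h g \<in> AC_space" for g
        by (rule difference_property_AC[OF that])
    qed
  next
    show "(\<forall>h. diff_op h f \<in> BV_space) \<and> bounded_or_measurable_on_positive_set (bold_D n f) \<longleftrightarrow>
        (\<exists>d (c::real) \<gamma>. derivation_of_order n d \<and> \<gamma> \<in> BV_space \<and> (\<forall>x. f x = d x + c * x + \<gamma> x))"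
    proof (rule integrable_case[OF combination_closed_BV_space R_space_BV])
      show "g \<in> BV_space" if "normalized g" "\<And>h. diff_op h g \<in> BV_space" for g
        by (rule difference_property_BV[OF that])
    qed
  qed
qed

end
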